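(* Let $(\Omega,\mathcal{A},\mu)$ be a measure space, let $p\in[1,\infty)$, and let $T=(T(t))_{t\ge 0}$ be a positive $C_0$-semigroup on $L_p(\mu)$ with generator $A$. Let $V\colon\Omega\to[0,\infty]$ be $T$-admissible. Then $$T_{0,V}=(T_V)_{-V},$$ where $T_{0,V}=\operatorname{s-lim}_{\varepsilon\to0+}T_{\varepsilon V}$ and $(T_V)_{-V}=\operatorname{s-lim}_{n\to\infty}T_{V-V\wedge n}$. In particular, $V$ is $T$-regular if and only if $V$ is strongly $T$-regular.
   Context: Setting: $(\Omega,\mathcal{A},\mu)$ is a measure space, $p\in[1,\infty)$, $T$ is a positive $C_0$-semigroup on $L_p(\mu)$ with generator $A$. Here $\wedge$ and $\vee$ denote pointwise minimum and maximum, and s-lim denotes the limit in the strong operator topology. A function $V\colon\Omega\to[-\infty,\infty]$ is locally measurable if its restriction to every set $C\in\mathcal{A}$ of finite measure is measurable. For bounded locally measurable $W\colon\Omega\to\mathbb{R}$, $(\mathrm{e}^{t(A-W)})_{t\ge0}$ is the $C_0$-semigroup generated by $A-W$, where $W$ acts as a (bounded) multiplication operator on $L_p(\mu)$. Admissibility: A function $V\colon\Omega\to[0,\infty]$ or $V\colon\Omega\to[-\infty,0]$ is called $T$-admissible if $V$ is locally measurable, the limit $$T_V(t):=\operatorname{s-lim}_{n\to\infty}\mathrm{e}^{t(A-(V\wedge n)\vee(-n))}$$ exists for all $t\ge0$, and $T_V=(T_V(t))_{t\ge0}$ thus defined is a $C_0$-semigroup on $L_p(\mu)$. In that case the convergence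 is uniform for $t$ in bounded subsets of $[0,\infty)$, which is written $T_V=\operatorname{s-lim}_{n\to\infty}T_{(V\wedge n)\vee(-n)}$. The generator of $T_V$ is denoted by $A_V$. The same notions and notation are used with other positive $C_0$-semigroups (such as $T_V$) in place of $T$. For a $T$-admissible $V\colon\Omega\to[0,\infty]$: the set $[V=\infty]$ is a local null set (its intersection with every set of finite measure is a null set). For all $\varepsilon\in(0,1]$ and $n\in\mathbb{N}$ the functions $\varepsilon V$ and $V-V\wedge n$ (with $\infty-n=\infty$) are $T$-admissible, so $T_{\varepsilon V}$ and $T_{V-V\wedge n}$ are defined. One sets $$T_{0,V}:=\operatorname{s-lim}_{\varepsilon\to0+}T_{\varepsilon V},$$ i.e. $T_{0,V}(t)$ is the strong limit of $T_{\varepsilon V}(t)$ as $\varepsilon\to0+$, for $t\ge 0$; and $(T_V)_{-V}$ is the semigroup obtained from $T_V$ by applying the absorption rate $-V$, i.e. $$(T_V)_{-V}(t)=\operatorname{s-lim}_{n\to\infty}\mathrm{e}^{t(A_V+V\wedge n)}=\operatorname{s-lim}_{n\to\infty}T_{V-V\wedge n}(t)\qquad(t\ge0),$$ where the second equality is always valid. These limits exist (the operators are monotone in $\varepsilon$, respectively $n$, and dominated by $T(t)$), with convergence uniform for $t$ in bounded subsets of $[0,\infty)$. Regularity: $V\colon\Omega\to[0,\infty]$ is called $T$-regular if $V$ is $T$-admissible and $T_{0,V}=T$. It is called strongly $T$-regular if $V$ is $T$-admissible and $(T_V)_{-V}=T$. *)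

theory Defs
  imports "HOL-Analysis.Analysis"
begin

text \<open>
  Elements of \<open>L\<^sub>p(\<mu>)\<close> (real scalars) are represented by \<open>p\<close>-integrable functions; equality in
  \<open>L\<^sub>p(\<mu>)\<close> is equality almost everywhere. Operators act on representatives and satisfy their
  defining equations almost everywhere; only their values on \<open>Lp_set M p\<close> and, for one-parameter
  families, at times \<open>t \<ge> 0\<close> are relevant. No finiteness condition on the measure is imposed.
\<close>

definition Lp_set :: "'a measure \<Rightarrow> real \<Rightarrow> ('a \<Rightarrow> real) set" where
  "Lp_set M p = {f \<in> borel_measurable M. integrable M (\<lambda>x. \<bar>f x\<bar> powr p)}"

definition Lp_norm :: "'a measure \<Rightarrow> real \<Rightarrow> ('a \<Rightarrow> real) \<Rightarrow> real" where
  "Lp_norm M p f = (\<integral>x. \<bar>f x\<bar> powr p \<partial>M) powr (1 / p)"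

definition Lp_tendsto ::
    "'a measure \<Rightarrow> real \<Rightarrow> ('i \<Rightarrow> 'a \<Rightarrow> real) \<Rightarrow> ('a \<Rightarrow> real) \<Rightarrow> 'i filter \<Rightarrow> bool" where
  "Lp_tendsto M p u g F \<longleftrightarrow> g \<in> Lp_set M p \<and> (\<forall>\<^sub>F i in F. u i \<in> Lp_set M p) \<and>
     ((\<lambda>i. Lp_norm M p (\<lambda>x. u i x - g x)) \<longlongrightarrow> 0) F"

definition Lp_bounded_op ::
    "'a measure \<Rightarrow> real \<Rightarrow> (('a \<Rightarrow> real) \<Rightarrow> 'a \<Rightarrow> real) \<Rightarrow> bool" where
  "Lp_bounded_op M p B \<longleftrightarrow>
     (\<forall>f\<in>Lp_set M p. B f \<in> Lp_set M p) \<and>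
     (\<forall>f\<in>Lp_set M p. \<forall>g\<in>Lp_set M p. \<forall>a b.
        AE x in M. B (\<lambda>y. a * f y + b * g y) x = a * B f x + b * B g x) \<and>
     (\<exists>C. \<forall>f\<in>Lp_set M p. Lp_norm M p (B f) \<le> C * Lp_norm M p f)"

type_synonym 'a op_family = "real \<Rightarrow> ('a \<Rightarrow> real) \<Rightarrow> 'a \<Rightarrow> real"

text \<open>Equality of two families \<open>(S(t))\<^sub>t\<^sub>\<ge>\<^sub>0\<close>, \<open>(S'(t))\<^sub>t\<^sub>\<ge>\<^sub>0\<close> of operators on \<open>L\<^sub>p(\<mu>)\<close>.\<close>

definition family_eq :: "'a measure \<Rightarrow> real \<Rightarrow> 'a op_family \<Rightarrow> 'a op_family \<Rightarrow> bool" where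
  "family_eq M p S S' \<longleftrightarrow> (\<forall>t\<ge>0. \<forall>f\<in>Lp_set M p. AE x in M. S t f x = S' t f x)"

definition C0_semigroup :: "'a measure \<Rightarrow> real \<Rightarrow> 'a op_family \<Rightarrow> bool" where
  "C0_semigroup M p T \<longleftrightarrow>
     (\<forall>t\<ge>0. Lp_bounded_op M p (T t)) \<and>
     (\<forall>f\<in>Lp_set M p. AE x in M. T 0 f x = f x) \<and>
     (\<forall>s\<ge>0. \<forall>t\<ge>0. \<forall>f\<in>Lp_set M p. AE x in M. T (s + t) f x = T s (T t f) x) \<and>
     (\<forall>f\<in>Lp_set M p. Lp_tendsto M p (\<lambda>t. T t f) f (at_right 0))"

definition positive_family :: "'a measure \<Rightarrow> real \<Rightarrow> 'a op_family \<Rightarrow> bool" where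
  "positive_family M p T \<longleftrightarrow>
     (\<forall>t\<ge>0. \<forall>f\<in>Lp_set M p. (AE x in M. 0 \<le> f x) \<longrightarrow> (AE x in M. 0 \<le> T t f x))"

text \<open>The graph of the generator, closed under almost everywhere equality in both components.\<close>

definition generator :: "'a measure \<Rightarrow> real \<Rightarrow> 'a op_family \<Rightarrow> (('a \<Rightarrow> real) \<times> ('a \<Rightarrow> real)) set" where
  "generator M p T = {(f, g). f \<in> Lp_set M p \<and>
     Lp_tendsto M p (\<lambda>h x. (T h f x - f x) / h) g (at_right 0)}"

text \<open>The graph of \<open>A - W\<close>, where \<open>W\<close> acts by multiplication, on the domain of \<open>A\<close>.\<close>

definition minus_mult ::
    "(('a \<Rightarrow> real) \<times> ('a \<Rightarrow> real)) set \<Rightarrow> ('a \<Rightarrow> real) \<Rightarrow> (('a \<Rightarrow> real) \<times> ('a \<Rightarrow> real)) set" where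
  "minus_mult A W = {(f, \<lambda>x. g x - W x * f x) | f g. (f, g) \<in> A}"

text \<open>
  \<open>gen_semigroup M p A\<close> is the \<open>C\<^sub>0\<close>-semigroup generated by \<open>A\<close>. If it exists, it is unique up to
  \<open>family_eq\<close>; the choice operator only selects representatives.
\<close>

definition gen_semigroup ::
    "'a measure \<Rightarrow> real \<Rightarrow> (('a \<Rightarrow> real) \<times> ('a \<Rightarrow> real)) set \<Rightarrow> 'a op_family" where
  "gen_semigroup M p A = (SOME S. C0_semigroup M p S \<and> generator M p S = A)"

definition strong_lim ::
    "'a measure \<Rightarrow> real \<Rightarrow> 'i filter \<Rightarrow> ('i \<Rightarrow> 'a op_family) \<Rightarrow> 'a op_family" where
  "strong_lim M p F S = (\<lambda>t f. SOME g. Lp_tendsto M p (\<lambda>i. S i t f) g F)"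

definition strong_lim_exists ::
    "'a measure \<Rightarrow> real \<Rightarrow> 'i filter \<Rightarrow> ('i \<Rightarrow> 'a op_family) \<Rightarrow> bool" where
  "strong_lim_exists M p F S \<longleftrightarrow>
     (\<forall>t\<ge>0. \<forall>f\<in>Lp_set M p. \<exists>g. Lp_tendsto M p (\<lambda>i. S i t f) g F)"

definition locally_measurable :: "'a measure \<Rightarrow> ('a \<Rightarrow> ereal) \<Rightarrow> bool" where
  "locally_measurable M V \<longleftrightarrow>
     (\<forall>C\<in>sets M. emeasure M C < \<infinity> \<longrightarrow> V \<in> borel_measurable (restrict_space M C))"

definition truncate :: "('a \<Rightarrow> ereal) \<Rightarrow> nat \<Rightarrow> 'a \<Rightarrow> real" where
  "truncate V n x = real_of_ereal (max (min (V x) (ereal (real n))) (- ereal (real n)))"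

definition truncated_semigroup ::
    "'a measure \<Rightarrow> real \<Rightarrow> 'a op_family \<Rightarrow> ('a \<Rightarrow> ereal) \<Rightarrow> nat \<Rightarrow> 'a op_family" where
  "truncated_semigroup M p T V n = gen_semigroup M p (minus_mult (generator M p T) (truncate V n))"

text \<open>The semigroup \<open>T\<^sub>V\<close>; meaningful only if \<open>V\<close> is \<open>T\<close>-admissible.\<close>

definition absorption_semigroup ::
    "'a measure \<Rightarrow> real \<Rightarrow> 'a op_family \<Rightarrow> ('a \<Rightarrow> ereal) \<Rightarrow> 'a op_family" where
  "absorption_semigroup M p T V = strong_lim M p sequentially (truncated_semigroup M p T V)"

definition T_admissible :: "'a measure \<Rightarrow> real \<Rightarrow> 'a op_family \<Rightarrow> ('a \<Rightarrow> ereal) \<Rightarrow> bool" where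
  "T_admissible M p T V \<longleftrightarrow>
     ((\<forall>x\<in>space M. 0 \<le> V x) \<or> (\<forall>x\<in>space M. V x \<le> 0)) \<and>
     locally_measurable M V \<and>
     strong_lim_exists M p sequentially (truncated_semigroup M p T V) \<and>
     C0_semigroup M p (absorption_semigroup M p T V)"

text \<open>\<open>T\<^sub>0\<^sub>,\<^sub>V\<close>, the strong limit of \<open>T\<^sub>\<epsilon>\<^sub>V\<close> as \<open>\<epsilon> \<rightarrow> 0+\<close>.\<close>

definition zero_absorption ::
    "'a measure \<Rightarrow> real \<Rightarrow> 'a op_family \<Rightarrow> ('a \<Rightarrow> ereal) \<Rightarrow> 'a op_family" where
  "zero_absorption M p T V =
     strong_lim M p (at_right 0) (\<lambda>\<epsilon>::real. absorption_semigroup M p T (\<lambda>x. ereal \<epsilon> * V x))"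

text \<open>
  \<open>(T\<^sub>V)\<^sub>-\<^sub>V\<close>. The truncations of \<open>-V\<close> are \<open>-(V \<and> n)\<close> for \<open>V \<ge> 0\<close>, so this is the strong limit of the
  semigroups generated by \<open>A\<^sub>V + V \<and> n\<close>.
\<close>

definition restored_semigroup ::
    "'a measure \<Rightarrow> real \<Rightarrow> 'a op_family \<Rightarrow> ('a \<Rightarrow> ereal) \<Rightarrow> 'a op_family" where
  "restored_semigroup M p T V =
     absorption_semigroup M p (absorption_semigroup M p T V) (\<lambda>x. - V x)"

definition T_regular :: "'a measure \<Rightarrow> real \<Rightarrow> 'a op_family \<Rightarrow> ('a \<Rightarrow> ereal) \<Rightarrow> bool" where
  "T_regular M p T V \<longleftrightarrow>
     (\<forall>x\<in>space M. 0 \<le> V x) \<and> T_admissible M p T V \<and> family_eq M p (zero_absorption M p T V) T"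

definition strongly_T_regular ::
    "'a measure \<Rightarrow> real \<Rightarrow> 'a op_family \<Rightarrow> ('a \<Rightarrow> ereal) \<Rightarrow> bool" where
  "strongly_T_regular M p T V \<longleftrightarrow>
     (\<forall>x\<in>space M. 0 \<le> V x) \<and> T_admissible M p T V \<and> family_eq M p (restored_semigroup M p T V) T"

end

theory Submission
  imports Defs "HOL-Probability.Discrete_Topology"
begin

text \<open>
  Write \<open>v\<^sub>n = V \<and> n\<close> and, for a bounded potential \<open>W\<close>, \<open>T\<^sub>W\<close> for the semigroup generated by \<open>A - W\<close>.
  The common value of both sides is the strong limit \<open>S\<close> of the increasing sequence \<open>T\<^bsub>V - v\<^sub>n\<^esub>\<close>.

  On positive elements \<open>T\<^bsub>\<epsilon>V\<^esub>\<close> is squeezed between two bounds. From below, \<open>V - v\<^sub>n \<ge> \<epsilon>V - \<epsilon>n\<close>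
  gives \<open>T\<^bsub>V - v\<^sub>n\<^esub>(t) \<le> e\<^bsup>\<epsilon>nt\<^esup> T\<^bsub>\<epsilon>V\<^esub>(t)\<close> (lemma \<open>T_excess_le_T_scaled\<close>). From above,
  \<open>T\<^bsub>\<epsilon>V\<^esub> \<le> S\<close> (lemma \<open>T_scaled_le_T_restored\<close>): the map \<open>s \<mapsto> T\<^bsub>W + sD\<^esub>\<close> is convex for \<open>D \<ge> 0\<close>
  (lemma \<open>convexity\<close>), and \<open>\<epsilon>V\<close> lies at \<open>s = \<epsilon>\<close> on the segment from \<open>\<epsilon>v\<^sub>n\<close> to \<open>\<epsilon>v\<^sub>n + (V - v\<^sub>n)\<close>, hence
  \<open>T\<^bsub>\<epsilon>V\<^esub> \<le> (1 - \<epsilon>) T\<^bsub>\<epsilon>v\<^sub>n\<^esub> + \<epsilon> T\<^bsub>V - v\<^sub>n\<^esub>\<close>. As \<open>n \<rightarrow> \<infinity>\<close> the first term tends to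
  \<open>(1 - \<epsilon>) T\<^bsub>\<epsilon>V\<^esub>\<close>, which leaves \<open>\<epsilon> T\<^bsub>\<epsilon>V\<^esub> \<le> \<epsilon> S\<close>. Since \<open>\<epsilon>\<close> may go to \<open>0\<close> with \<open>n\<close> fixed, the two bounds
  give \<open>T\<^sub>0\<^sub>,\<^sub>V = S\<close>.

  That \<open>(T\<^sub>V)\<^bsub>-V\<^esub> = S\<close> rests on \<open>(T\<^sub>V)\<^bsub>-v\<^sub>n\<^esub> = T\<^bsub>V - v\<^sub>n\<^esub>\<close>. For each \<open>k\<close> the semigroup
  \<open>T\<^bsub>v\<^sub>n\<^sub>+\<^sub>k - v\<^sub>n\<^esub>\<close> is the perturbation of \<open>T\<^bsub>v\<^sub>n\<^sub>+\<^sub>k\<^esub>\<close> by \<open>v\<^sub>n\<close>; all of these lie between \<open>T\<^sub>V\<close> and \<open>T\<close>,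
  which makes the relation survive the limit \<open>k \<rightarrow> \<infinity>\<close> (lemma \<open>tangent_limit\<close>).

  The relation ``\<open>S\<close> is the perturbation of \<open>U\<close> by the bounded operator \<open>B\<close>'' is expressed throughout as
  tangency: \<open>(S(h)x - U(h)x)/h \<rightarrow> Bx\<close> as \<open>h \<rightarrow> 0+\<close> for every \<open>x\<close>, not only for \<open>x\<close> in the domain of the
  generator. It is additive in \<open>B\<close>, it determines \<open>S\<close>, and it yields Duhamel's formula, from which
  monotonicity and convexity follow.

  Vector-valued integration needs a Banach space that is a type, whereas \<open>L\<^sub>p(\<mu>)\<close> depends on the values
  \<open>\<mu>\<close> and \<open>p\<close>. So \<open>L\<^sub>p(\<mu>)\<close> is embedded isometrically, by duality, into a space of bounded functions on
  \<open>'a \<Rightarrow> real\<close>, and the semigroup theory is developed on a closed subspace \<open>E\<close> of a Banach space.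
\<close>

section \<open>Riemann sums and one-sided derivatives\<close>

lemmas hk_combine = Henstock_Kurzweil_Integration.integral_combine
lemmas hk_cong = Henstock_Kurzweil_Integration.integral_cong
lemmas hk_norm_bound = Henstock_Kurzweil_Integration.integral_norm_bound_integral

lemma sum_in_cone:
  assumes "finite D" "0 \<in> C" "\<And>x y. x \<in> C \<Longrightarrow> y \<in> C \<Longrightarrow> x + y \<in> C" "\<And>d. d \<in> D \<Longrightarrow> g d \<in> C"
  shows "sum g D \<in> (C :: 'b::real_normed_vector set)"
  using assms(1,4) by (induction D rule: finite_induct) (auto intro: assms)

text \<open>
  One tagged division serves two integrands at once. This is what lets an operator that is only defined
  on a subspace, and so is not a bounded linear map of the whole type, be moved through an integral.
\<close>

lemma integral_riemann_sum:
  fixes f :: "real \<Rightarrow> 'b::banach"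
  assumes "f integrable_on {a..b}" "g integrable_on {a..b}" "e > 0"
  obtains D :: "(real \<times> real set) set"
  where "finite D" "\<forall>(x, k)\<in>D. x \<in> {a..b}"
    "norm ((\<Sum>(x,k)\<in>D. measure lborel k *\<^sub>R f x) - integral {a..b} f) < e"
    "norm ((\<Sum>(x,k)\<in>D. measure lborel k *\<^sub>R g x) - integral {a..b} (g :: real \<Rightarrow> 'b)) < e"
proof -
  have F: "(f has_integral integral {a..b} f) (cbox a b)"
    using assms(1) by (simp add: integrable_integral)
  have G: "(g has_integral integral {a..b} g) (cbox a b)"
    using assms(2) by (simp add: integrable_integral)
  obtain u where u: "gauge u" "\<And>D. D tagged_division_of cbox a b \<Longrightarrow> u fine D \<Longrightarrow>
      norm ((\<Sum>(x,k)\<in>D. measure lborel k *\<^sub>R f x) - integral {a..b} f) < e"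
    using F \<open>e > 0\<close> unfolding has_integral by meson
  obtain v where v: "gauge v" "\<And>D. D tagged_division_of cbox a b \<Longrightarrow> v fine D \<Longrightarrow>
      norm ((\<Sum>(x,k)\<in>D. measure lborel k *\<^sub>R g x) - integral {a..b} g) < e"
    using G \<open>e > 0\<close> unfolding has_integral by meson
  obtain D where D: "D tagged_division_of cbox a b" "(\<lambda>x. u x \<inter> v x) fine D"
    using fine_division_exists[OF gauge_Int[OF u(1) v(1)]] by blast
  have "u fine D" "v fine D" using D(2) by (auto simp: fine_Int)
  moreover have "finite D" using D(1) by blast
  moreover have "\<forall>(x, k)\<in>D. x \<in> {a..b}"
    using tagged_division_ofD(2,3)[OF D(1)] by fastforce
  ultimately show ?thesis
    by (intro that[of D] u(2)[OF D(1)] v(2)[OF D(1)])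
qed

lemma integral_in_cone:
  fixes f :: "real \<Rightarrow> 'b::banach"
  assumes f: "f integrable_on {a..b}"
    and C: "closed C" "0 \<in> C" "\<And>x y. x \<in> C \<Longrightarrow> y \<in> C \<Longrightarrow> x + y \<in> C"
      "\<And>c x. 0 \<le> c \<Longrightarrow> x \<in> C \<Longrightarrow> c *\<^sub>R x \<in> C"
    and fC: "\<And>s. s \<in> {a..b} \<Longrightarrow> f s \<in> C"
  shows "integral {a..b} f \<in> C"
proof -
  have "\<exists>y\<in>C. dist y (integral {a..b} f) < e" if e: "e > 0" for e
  proof -
    obtain D :: "(real \<times> real set) set" where D: "finite D" "\<forall>(x, k)\<in>D. x \<in> {a..b}"
      "norm ((\<Sum>(x,k)\<in>D. measure lborel k *\<^sub>R f x) - integral {a..b} f) < e"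
      by (rule integral_riemann_sum[OF f f e]) (rule that, assumption+)
    have "(\<Sum>(x,k)\<in>D. measure lborel k *\<^sub>R f x) \<in> C"
      using D(2) by (intro sum_in_cone[OF D(1) C(2,3)]) (auto intro!: C(4) fC)
    then show ?thesis using D(3) by (auto simp: dist_norm)
  qed
  then show ?thesis using C(1) closure_approachable closure_closed by blast
qed

text \<open>
  Only right derivatives of \<open>s \<mapsto> U(t - s)S(s)x\<close> come for free from strong continuity at \<open>0\<close>. They suffice:
  at the last point \<open>c\<close> with \<open>\<parallel>f c - f a\<parallel> \<le> e (c - a)\<close> the right derivative prolongs the estimate unless \<open>c = b\<close>.
\<close>

lemma zero_right_derivative_imp_const:
  fixes f :: "real \<Rightarrow> 'b::real_normed_vector"
  assumes cont: "continuous_on {a..b} f" and ab: "a \<le> b"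
    and der: "\<And>s. s \<in> {a..<b} \<Longrightarrow> ((\<lambda>h. (f (s + h) - f s) /\<^sub>R h) \<longlongrightarrow> 0) (at_right 0)"
  shows "f b = f a"
proof -
  have bd: "norm (f b - f a) \<le> e * (b - a)" if e: "e > 0" for e
  proof (rule ccontr)
    assume neg: "\<not> ?thesis"
    define g where "g s = norm (f s - f a) - e * (s - a)" for s
    have g: "continuous_on {a..b} g"
      unfolding g_def by (intro continuous_intros cont)
    define S where "S = {s \<in> {a..b}. g s \<le> 0}"
    have "closed S" unfolding S_def
      using continuous_closed_preimage[OF g closed_real_atLeastAtMost, of "{..0}"]
      by (simp add: vimage_def Int_def)
    moreover have "bounded S" unfolding S_def by (rule bounded_subset[of "{a..b}"]) auto
    ultimately have "compact S" by (simp add: compact_eq_bounded_closed)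
    moreover have "a \<in> S" using ab by (simp add: S_def g_def)
    ultimately obtain c where c: "c \<in> S" "\<And>s. s \<in> S \<Longrightarrow> s \<le> c"
      using compact_attains_sup[of S] by blast
    have "c \<noteq> b" using c(1) neg by (auto simp: S_def g_def)
    then have cab: "c \<in> {a..<b}" using c(1) by (auto simp: S_def)
    have "eventually (\<lambda>h. norm ((f (c + h) - f c) /\<^sub>R h) < e) (at_right 0)"
      using tendstoD[OF der[OF cab] e] by simp
    moreover have "eventually (\<lambda>h. h \<in> {0<..<b-c}) (at_right 0)"
      using cab by (intro eventually_at_right_real) auto
    ultimately have "eventually (\<lambda>h. norm ((f (c + h) - f c) /\<^sub>R h) < e \<and> h \<in> {0<..<b-c}) (at_right 0)"
      by eventually_elim simp
    then obtain h where h: "norm ((f (c + h) - f c) /\<^sub>R h) < e" "0 < h" "h < b - c"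
      using eventually_happens'[OF trivial_limit_at_right_real[of "0::real"]] that
      unfolding greaterThanLessThan_iff by blast
    have "norm (f (c + h) - f c) / h < e"
      using h(1,2) by (simp add: divide_inverse mult.commute)
    then have "norm (f (c + h) - f c) < e * h"
      using h(2) by (simp add: field_simps)
    moreover have "norm (f (c + h) - f a) \<le> norm (f (c + h) - f c) + norm (f c - f a)"
      using norm_triangle_ineq[of "f (c+h) - f c" "f c - f a"] by simp
    ultimately have "g (c + h) \<le> 0"
      using c(1) by (simp add: S_def g_def algebra_simps)
    then have "c + h \<in> S" using h cab by (auto simp: S_def)
    then show False using c(2)[of "c + h"] h by simp
  qed
  have "norm (f b - f a) \<le> 0"
  proof (rule field_le_epsilon)
    fix e :: real assume "e > 0"
    then have "norm (f b - f a) \<le> e / (b - a + 1) * (b - a)"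
      using ab by (intro bd) simp
    also have "\<dots> = e * ((b - a) / (b - a + 1))" by simp
    also have "\<dots> \<le> e * 1" using ab \<open>e > 0\<close> by (intro mult_left_mono) auto
    finally show "norm (f b - f a) \<le> 0 + e" by simp
  qed
  then show ?thesis by simp
qed

section \<open>Bounded operators on a closed subspace\<close>

locale closed_subspace =
  fixes E :: "'b::banach set"
  assumes closed_E: "closed E" and subspace_E: "subspace E"
begin

lemma E_simps [simp, intro]:
  "0 \<in> E" "x \<in> E \<Longrightarrow> y \<in> E \<Longrightarrow> x + y \<in> E" "x \<in> E \<Longrightarrow> y \<in> E \<Longrightarrow> x - y \<in> E"
  "x \<in> E \<Longrightarrow> - x \<in> E" "x \<in> E \<Longrightarrow> c *\<^sub>R x \<in> E"
  using subspace_E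
  by (auto simp: subspace_0 subspace_add subspace_diff subspace_neg subspace_scale)

lemma E_lim: "(f \<longlongrightarrow> x) F \<Longrightarrow> F \<noteq> bot \<Longrightarrow> eventually (\<lambda>i. f i \<in> E) F \<Longrightarrow> x \<in> E"
  using Lim_in_closed_set[OF closed_E] by blast

definition bounded_op :: "('b \<Rightarrow> 'b) \<Rightarrow> bool" where
  "bounded_op B \<longleftrightarrow> (\<forall>x\<in>E. B x \<in> E) \<and>
     (\<forall>x\<in>E. \<forall>y\<in>E. \<forall>a b. B (a *\<^sub>R x + b *\<^sub>R y) = a *\<^sub>R B x + b *\<^sub>R B y) \<and>
     (\<exists>C. \<forall>x\<in>E. norm (B x) \<le> C * norm x)"

lemma bopI:
  assumes "\<And>x. x \<in> E \<Longrightarrow> B x \<in> E"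
    "\<And>x y a b. x \<in> E \<Longrightarrow> y \<in> E \<Longrightarrow> B (a *\<^sub>R x + b *\<^sub>R y) = a *\<^sub>R B x + b *\<^sub>R B y"
    "\<And>x. x \<in> E \<Longrightarrow> norm (B x) \<le> C * norm x"
  shows "bounded_op B"
  using assms unfolding bounded_op_def by blast

lemma bounded_op_in [simp, intro]: "bounded_op B \<Longrightarrow> x \<in> E \<Longrightarrow> B x \<in> E"
  by (simp add: bounded_op_def)

lemma bounded_op_lin: "bounded_op B \<Longrightarrow> x \<in> E \<Longrightarrow> y \<in> E \<Longrightarrow> B (a *\<^sub>R x + b *\<^sub>R y) = a *\<^sub>R B x + b *\<^sub>R B y"
  by (simp add: bounded_op_def)

lemma bounded_op_add: "bounded_op B \<Longrightarrow> x \<in> E \<Longrightarrow> y \<in> E \<Longrightarrow> B (x + y) = B x + B y"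
  using bounded_op_lin[of B x y 1 1] by simp

lemma bounded_op_diff: "bounded_op B \<Longrightarrow> x \<in> E \<Longrightarrow> y \<in> E \<Longrightarrow> B (x - y) = B x - B y"
  using bounded_op_lin[of B x y 1 "-1"] by simp

lemma bounded_op_scale: "bounded_op B \<Longrightarrow> x \<in> E \<Longrightarrow> B (a *\<^sub>R x) = a *\<^sub>R B x"
  using bounded_op_lin[of B x 0 a 0] by simp

lemma bounded_op_0: "bounded_op B \<Longrightarrow> B 0 = 0"
  using bounded_op_scale[of B 0 0] by simp

lemma bounded_op_bound: "bounded_op B \<Longrightarrow> \<exists>C\<ge>0. \<forall>x\<in>E. norm (B x) \<le> C * norm x"
proof -
  assume "bounded_op B"
  then obtain C where C: "\<And>x. x \<in> E \<Longrightarrow> norm (B x) \<le> C * norm x"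
    unfolding bounded_op_def by blast
  have "norm (B x) \<le> max C 0 * norm x" if "x \<in> E" for x
    using C[OF that] mult_right_mono[of C "max C 0" "norm x"] by simp
  then show ?thesis by (intro exI[of _ "max C 0"]) auto
qed

lemma bounded_op_sum:
  assumes "bounded_op B" "finite D" "\<And>d. d \<in> D \<Longrightarrow> g d \<in> E"
  shows "B (\<Sum>d\<in>D. g d) = (\<Sum>d\<in>D. B (g d))"
  using assms(2,3,1)
proof (induction D rule: finite_induct)
  case (insert d D)
  have "sum g D \<in> E" using insert by (intro sum_in_cone) auto
  then show ?case using insert by (simp add: bounded_op_add)
qed (simp add: bounded_op_0)

lemma bounded_op_lipschitz: "bounded_op B \<Longrightarrow> \<exists>C\<ge>0. \<forall>x\<in>E. \<forall>y\<in>E. norm (B x - B y) \<le> C * norm (x - y)"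
  using bounded_op_bound[of B] by (metis E_simps(3) bounded_op_diff)

lemma bounded_op_continuous_on:
  assumes "bounded_op B" shows "continuous_on E B"
proof -
  obtain C where C: "C \<ge> 0" "\<And>x y. x \<in> E \<Longrightarrow> y \<in> E \<Longrightarrow> norm (B x - B y) \<le> C * norm (x - y)"
    using bounded_op_lipschitz[OF assms] by blast
  then have "C-lipschitz_on E B" by (auto simp: lipschitz_on_def dist_norm)
  then show ?thesis by (rule lipschitz_on_continuous_on)
qed

lemma bounded_op_continuous_on2:
  "bounded_op B \<Longrightarrow> continuous_on S u \<Longrightarrow> (\<And>s. s \<in> S \<Longrightarrow> u s \<in> E) \<Longrightarrow> continuous_on S (\<lambda>s. B (u s))"
  using continuous_on_compose2[OF bounded_op_continuous_on] by blast

lemma bounded_op_tendsto: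
  assumes "bounded_op B" "(u \<longlongrightarrow> x) F" "x \<in> E" "eventually (\<lambda>i. u i \<in> E) F"
  shows "((\<lambda>i. B (u i)) \<longlongrightarrow> B x) F"
proof -
  obtain C where C: "C \<ge> 0" "\<And>x y. x \<in> E \<Longrightarrow> y \<in> E \<Longrightarrow> norm (B x - B y) \<le> C * norm (x - y)"
    using bounded_op_lipschitz[OF assms(1)] by blast
  have "((\<lambda>i. C * norm (u i - x)) \<longlongrightarrow> C * 0) F"
    by (intro tendsto_mult tendsto_const tendsto_norm_zero LIM_zero assms(2))
  moreover have "eventually (\<lambda>i. norm (B (u i) - B x) \<le> C * norm (u i - x)) F"
    using assms(4) by eventually_elim (rule C(2)[OF _ assms(3)])
  ultimately have "((\<lambda>i. B (u i) - B x) \<longlongrightarrow> 0) F"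
    by (rule_tac Lim_null_comparison[where g="\<lambda>i. C * norm (u i - x)"]) simp_all
  then show ?thesis by (rule LIM_zero_cancel)
qed

lemma integral_in_E:
  fixes f :: "real \<Rightarrow> 'b"
  assumes "f integrable_on {a..b}" "\<And>s. s \<in> {a..b} \<Longrightarrow> f s \<in> E"
  shows "integral {a..b} f \<in> E"
  by (rule integral_in_cone[OF assms(1) closed_E]) (use assms(2) in auto)

lemma bounded_op_integral:
  fixes f :: "real \<Rightarrow> 'b"
  assumes B: "bounded_op B" and f: "f integrable_on {a..b}" and Bf: "(\<lambda>s. B (f s)) integrable_on {a..b}"
    and fE: "\<And>s. s \<in> {a..b} \<Longrightarrow> f s \<in> E"
  shows "B (integral {a..b} f) = integral {a..b} (\<lambda>s. B (f s))"
proof -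
  obtain C where C: "C \<ge> 0" "\<And>x y. x \<in> E \<Longrightarrow> y \<in> E \<Longrightarrow> norm (B x - B y) \<le> C * norm (x - y)"
    using bounded_op_lipschitz[OF B] by blast
  have IE: "integral {a..b} f \<in> E" by (rule integral_in_E[OF f fE])
  have "norm (B (integral {a..b} f) - integral {a..b} (\<lambda>s. B (f s))) \<le> 0"
  proof (rule field_le_epsilon)
    fix e :: real assume e: "e > 0"
    define d where "d = e / (C + 1)"
    have d: "d > 0" using e C(1) by (simp add: d_def)
    obtain D :: "(real \<times> real set) set" where D: "finite D" "\<forall>(x, k)\<in>D. x \<in> {a..b}"
      "norm ((\<Sum>(x,k)\<in>D. measure lborel k *\<^sub>R f x) - integral {a..b} f) < d"
      "norm ((\<Sum>(x,k)\<in>D. measure lborel k *\<^sub>R B (f x)) - integral {a..b} (\<lambda>s. B (f s))) < d"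
      by (rule integral_riemann_sum[OF f Bf d]) (rule that, assumption+)
    let ?s = "\<Sum>(x,k)\<in>D. measure lborel k *\<^sub>R f x"
    have sE: "?s \<in> E" using D(2) fE by (intro sum_in_cone[OF D(1)]) auto
    have "B ?s = (\<Sum>d\<in>D. B (case d of (x,k) \<Rightarrow> measure lborel k *\<^sub>R f x))"
      using D(2) fE by (intro bounded_op_sum[OF B D(1)]) auto
    also have "\<dots> = (\<Sum>(x,k)\<in>D. measure lborel k *\<^sub>R B (f x))"
      using D(2) fE by (intro sum.cong) (auto simp: bounded_op_scale[OF B])
    finally have Bs: "B ?s = (\<Sum>(x,k)\<in>D. measure lborel k *\<^sub>R B (f x))" .
    have "norm (B (integral {a..b} f) - B ?s) \<le> C * d"
      using C(2)[OF IE sE] D(3) C(1) mult_left_mono[of _ d C]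
      by (smt (verit) norm_minus_commute)
    moreover have "norm (B ?s - integral {a..b} (\<lambda>s. B (f s))) < d"
      using D(4) Bs by simp
    ultimately have "norm (B (integral {a..b} f) - integral {a..b} (\<lambda>s. B (f s))) \<le> C * d + d"
      using norm_triangle_ineq[of "B (integral {a..b} f) - B ?s" "B ?s - integral {a..b} (\<lambda>s. B (f s))"]
      by simp
    also have "\<dots> = (C + 1) * d" by (simp add: algebra_simps)
    also have "\<dots> = e" using C(1) by (simp add: d_def)
    finally show "norm (B (integral {a..b} f) - integral {a..b} (\<lambda>s. B (f s))) \<le> 0 + e" by simp
  qed
  then show ?thesis by simp
qed

text \<open>
  The gliding-hump argument for the uniform boundedness principle: since
  \<open>max (\<parallel>B(x + w)\<parallel>) (\<parallel>B(x - w)\<parallel>) \<ge> \<parallel>Bw\<parallel>\<close>, one may walk from \<open>0\<close> by steps \<open>\<plusminus> w\<^sub>n\<close> of length at most \<open>3\<^bsup>-n\<^esup>\<close> such that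
  \<open>\<parallel>B\<^sub>n x\<parallel>\<close> is large at the point \<open>x\<close> reached by the \<open>n\<close>-th step, and the remaining steps, of total length at most \<open>3\<^bsup>-n\<^esup>/2\<close>, cannot
  undo this. The ratio \<open>4/3\<close> is the growth \<open>4\<^sup>n\<close> of the norms against the shrinking \<open>3\<^bsup>-n\<^esup>\<close> of the steps.
\<close>

lemma uniform_boundedness_aux:
  assumes B: "\<And>n. bounded_op (B n)" and big: "\<And>n::nat. \<not> (\<forall>x\<in>E. norm (B n x) \<le> 4 ^ n * norm x)"
  shows "\<exists>x\<in>E. \<forall>n. norm (B n x) \<ge> (4/3) ^ n / 4"
proof -
  define N where "N n = Sup ((\<lambda>x. norm (B n x)) ` {x \<in> E. norm x \<le> 1})" for n
  have bdd: "bdd_above ((\<lambda>x. norm (B n x)) ` {x \<in> E. norm x \<le> 1})" for n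
  proof -
    obtain C where C: "C \<ge> 0" "\<And>x. x \<in> E \<Longrightarrow> norm (B n x) \<le> C * norm x"
      using bounded_op_bound[OF B] by blast
    have "norm (B n x) \<le> C" if "x \<in> E" "norm x \<le> 1" for x
      using C(2)[OF that(1)] mult_left_mono[OF that(2) C(1)] by simp
    then show ?thesis by (intro bdd_aboveI[of _ C]) auto
  qed
  have N: "norm (B n x) \<le> N n * norm x" if x: "x \<in> E" for n x
  proof (cases "x = 0")
    case False
    have "norm (B n (x /\<^sub>R norm x)) \<le> N n" unfolding N_def
      using x False by (intro cSup_upper bdd) auto
    then have "norm (B n x) / norm x \<le> N n"
      using x by (simp add: bounded_op_scale[OF B] divide_inverse mult.commute)
    then show ?thesis using False by (simp add: field_simps)
  qed (simp add: bounded_op_0[OF B])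
  have Nbig: "N n > 4 ^ n" for n
  proof (rule ccontr)
    assume "\<not> N n > 4 ^ n"
    then have "norm (B n x) \<le> 4 ^ n * norm x" if "x \<in> E" for x
      using N[OF that, of n] mult_right_mono[of "N n" "4^n" "norm x"] by simp
    then show False using big by blast
  qed
  have "\<exists>x\<in>E. norm x \<le> 1 \<and> norm (B n x) > 3/4 * N n" for n
  proof -
    have "3/4 * N n < N n" using Nbig[of n] less_trans[of 0 "4 ^ n" "N n"] by simp
    then have "\<exists>y\<in>(\<lambda>x. norm (B n x)) ` {x \<in> E. norm x \<le> 1}. 3/4 * N n < y"
      unfolding N_def by (subst less_cSup_iff[symmetric]) (use bdd in \<open>auto simp: N_def\<close>)
    then show ?thesis by auto
  qed
  then obtain z where z: "\<And>n. z n \<in> E" "\<And>n. norm (z n) \<le> 1" "\<And>n. norm (B n (z n)) > 3/4 * N n"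
    by metis
  define w where "w n = (1/3) ^ n *\<^sub>R z n" for n
  have w: "w n \<in> E" "norm (w n) \<le> (1/3) ^ n" for n
    using z by (auto simp: w_def power_le_one mult_left_le)
  define step where "step n x = (if norm (B n (x + w n)) \<ge> norm (B n (w n)) then w n else - w n)" for n x
  define X where "X = rec_nat 0 (\<lambda>n x. x + step n x)"
  have X0: "X 0 = 0" and XS: "\<And>n. X (Suc n) = X n + step n (X n)" by (auto simp: X_def)
  have stepE: "step n x \<in> E" "norm (step n x) \<le> (1/3)^n" for n x using w by (auto simp: step_def)
  have XE: "X n \<in> E" for n by (induction n) (auto simp: X0 XS stepE)
  have hit: "norm (B n (X (Suc n))) \<ge> norm (B n (w n))" for n
  proof (cases "norm (B n (X n + w n)) \<ge> norm (B n (w n))")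
    case False
    have "2 * norm (B n (w n)) = norm (B n (X n + w n) - B n (X n - w n))"
      using XE w by (simp add: bounded_op_diff[OF B, symmetric] algebra_simps) (simp add: scaleR_2[symmetric] bounded_op_scale[OF B])
    also have "\<dots> \<le> norm (B n (X n + w n)) + norm (B n (X n - w n))" by (rule norm_triangle_ineq4)
    finally show ?thesis using False by (simp add: XS step_def)
  qed (simp add: XS step_def)
  have summ: "summable (\<lambda>n. step n (X n))"
    by (rule summable_comparison_test[OF _ summable_geometric[of "1/3::real"]])
      (use stepE in auto)
  define x where "x = (\<Sum>n. step n (X n))"
  have Xsum: "X n = (\<Sum>i<n. step i (X i))" for n
    by (induction n) (auto simp: X0 XS)
  have xlim: "X \<longlonglongrightarrow> x"
    using summable_LIMSEQ[OF summ] unfolding Xsum[symmetric, abs_def] x_def by simp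
  have xE: "x \<in> E" using E_lim[OF xlim] XE by simp
  have tail: "norm (x - X (Suc n)) \<le> (1/3)^n / 2" for n
  proof -
    have s2: "(\<lambda>i. (1/3::real) ^ (i + Suc n)) sums ((1/3)^n / 2)"
      using sums_mult[OF geometric_sums[of "1/3::real"], of "(1/3)^Suc n"]
      by (simp add: power_add mult_ac)
    have "x - X (Suc n) = (\<Sum>i. step (i + Suc n) (X (i + Suc n)))"
      using suminf_minus_initial_segment[OF summ, of "Suc n"] Xsum[of "Suc n"] by (simp only: x_def)
    also have "norm \<dots> \<le> (\<Sum>i. (1/3::real) ^ (i + Suc n))"
    proof (rule norm_suminf_le)
      show "norm (step (i + Suc n) (X (i + Suc n))) \<le> (1/3) ^ (i + Suc n)" for i by (rule stepE(2))
      show "summable (\<lambda>i. (1/3::real) ^ (i + Suc n))" using s2 by (rule sums_summable)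
    qed
    finally show ?thesis using s2 by (simp add: sums_iff)
  qed
  have "norm (B n x) \<ge> (4/3) ^ n / 4" for n
  proof -
    have a: "norm (B n (w n)) \<ge> 3/4 * N n * (1/3)^n"
      using z(3)[of n] z(1) by (simp add: w_def bounded_op_scale[OF B] field_simps)
    have "norm (B n (X (Suc n)) - B n x) \<le> N n * norm (X (Suc n) - x)"
      using N[of "X (Suc n) - x" n] XE xE by (simp add: bounded_op_diff[OF B])
    also have "\<dots> \<le> N n * ((1/3)^n / 2)"
      using tail[of n] Nbig[of n] less_trans[of 0 "4 ^ n" "N n"]
      by (intro mult_left_mono) (auto simp: norm_minus_commute)
    finally have b: "norm (B n (X (Suc n)) - B n x) \<le> N n * (1/3)^n / 2" by simp
    have "norm (B n x) \<ge> N n * (1/3)^n / 4"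
      using a b hit[of n] norm_triangle_ineq2[of "B n (X (Suc n))" "B n x"] by linarith
    moreover have "N n * (1/3)^n / 4 \<ge> 4^n * (1/3)^n / 4"
      using Nbig[of n] by (intro divide_right_mono mult_right_mono) auto
    ultimately show ?thesis by (simp add: power_divide)
  qed
  then show ?thesis using xE by blast
qed

end

section \<open>Strongly continuous semigroups\<close>

context closed_subspace begin

lemma uniform_boundedness_seq:
  assumes B: "\<And>n::nat. bounded_op (B n)" and pw: "\<And>x. x \<in> E \<Longrightarrow> bounded (range (\<lambda>n. B n x))"
  shows "\<exists>n. \<forall>x\<in>E. norm (B n x) \<le> 4 ^ n * norm x"
proof (rule ccontr)
  assume "\<not> ?thesis"
  then have "\<exists>x\<in>E. \<forall>n. norm (B n x) \<ge> (4/3) ^ n / 4"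
    by (intro uniform_boundedness_aux B) auto
  then obtain x where x: "x \<in> E" "\<And>n. norm (B n x) \<ge> (4/3) ^ n / 4"
    by auto
  obtain c where c: "\<And>n. norm (B n x) \<le> c" using pw[OF x(1)] by (auto simp: bounded_iff)
  obtain n where "4 * c < (4/3::real) ^ n" using real_arch_pow[of "4/3" "4*c"] by auto
  then show False using x(2)[of n] c[of n] by simp
qed

definition c0_sg :: "(real \<Rightarrow> 'b \<Rightarrow> 'b) \<Rightarrow> bool" where
  "c0_sg U \<longleftrightarrow> (\<forall>t\<ge>0. bounded_op (U t)) \<and> (\<forall>x\<in>E. U 0 x = x) \<and>
     (\<forall>s\<ge>0. \<forall>t\<ge>0. \<forall>x\<in>E. U (s + t) x = U s (U t x)) \<and>
     (\<forall>x\<in>E. ((\<lambda>t. U t x) \<longlongrightarrow> x) (at_right 0))"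

definition gen_graph :: "(real \<Rightarrow> 'b \<Rightarrow> 'b) \<Rightarrow> ('b \<times> 'b) set" where
  "gen_graph U = {(x, y). x \<in> E \<and> ((\<lambda>h. (U h x - x) /\<^sub>R h) \<longlongrightarrow> y) (at_right 0)}"

text \<open>
  \<open>tangent U B S\<close> says that \<open>S\<close> is the perturbation of \<open>U\<close> by the bounded operator \<open>B\<close>. The limit is required for all
  \<open>x \<in> E\<close>, which makes the relation additive in \<open>B\<close> without any discussion of domains.
\<close>

definition tangent :: "(real \<Rightarrow> 'b \<Rightarrow> 'b) \<Rightarrow> ('b \<Rightarrow> 'b) \<Rightarrow> (real \<Rightarrow> 'b \<Rightarrow> 'b) \<Rightarrow> bool" where
  "tangent U B S \<longleftrightarrow> (\<forall>x\<in>E. ((\<lambda>h. (S h x - U h x) /\<^sub>R h) \<longlongrightarrow> B x) (at_right 0))"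

lemma c0_sgD:
  assumes "c0_sg U"
  shows "t \<ge> 0 \<Longrightarrow> bounded_op (U t)" "x \<in> E \<Longrightarrow> U 0 x = x"
    "s \<ge> 0 \<Longrightarrow> t \<ge> 0 \<Longrightarrow> x \<in> E \<Longrightarrow> U (s + t) x = U s (U t x)"
    "x \<in> E \<Longrightarrow> ((\<lambda>t. U t x) \<longlongrightarrow> x) (at_right 0)"
    "t \<ge> 0 \<Longrightarrow> x \<in> E \<Longrightarrow> U t x \<in> E"
  using assms unfolding c0_sg_def by (auto intro: bounded_op_in)

text \<open>
  Otherwise there are times \<open>t\<^sub>n \<rightarrow> 0\<close> at which the norm exceeds \<open>4\<^sup>n\<close>, although \<open>U(t\<^sub>n)x \<rightarrow> x\<close> is bounded for each \<open>x\<close>.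
\<close>

lemma c0_sg_local_bound:
  assumes U: "c0_sg U"
  shows "\<exists>d>0. \<exists>C. \<forall>t\<in>{0..d}. \<forall>x\<in>E. norm (U t x) \<le> C * norm x"
proof (rule ccontr)
  assume neg: "\<not> ?thesis"
  have "\<exists>t. t \<in> {0..1 / Suc n} \<and> \<not> (\<forall>x\<in>E. norm (U t x) \<le> 4 ^ n * norm x)" for n
  proof -
    have "1 / real (Suc n) > 0" by simp
    then show ?thesis using neg by meson
  qed
  then obtain t where t: "\<And>n. t n \<in> {0..1 / Suc n}"
      "\<And>n. \<not> (\<forall>x\<in>E. norm (U (t n) x) \<le> 4 ^ n * norm x)"
    by metis
  have t0: "t \<longlonglongrightarrow> 0"
    by (rule tendsto_sandwich[OF _ _ tendsto_const LIMSEQ_inverse_real_of_nat])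
      (use t(1) in \<open>auto simp: inverse_eq_divide intro!: always_eventually\<close>)
  have "bounded (range (\<lambda>n. U (t n) x))" if x: "x \<in> E" for x
  proof -
    have "((\<lambda>s. U s x) \<longlongrightarrow> x) (at 0 within {0..})"
      using c0_sgD(4)[OF U x] by (simp add: at_within_Ici_at_right)
    moreover have "U 0 x = x" using c0_sgD(2)[OF U x] .
    ultimately have "((\<lambda>s. U s x) \<longlongrightarrow> U 0 x) (at 0 within {0..})" by simp
    then have "continuous (at 0 within {0..}) (\<lambda>s. U s x)" by (simp add: continuous_within)
    then have "(\<lambda>n. U (t n) x) \<longlonglongrightarrow> U 0 x"
      by (rule continuous_within_tendsto_compose'[OF _ _ t0]) (use t(1) in auto)
    then show ?thesis by (rule convergent_imp_bounded)
  qed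
  then show False
    using uniform_boundedness_seq[of "\<lambda>n. U (t n)"] t c0_sgD(1)[OF U] by auto
qed

lemma c0_sg_growth:
  assumes U: "c0_sg U"
  shows "\<exists>K\<ge>1. \<exists>w\<ge>0. \<forall>t\<ge>0. \<forall>x\<in>E. norm (U t x) \<le> K * exp (w * t) * norm x"
proof -
  obtain d C where d: "d > 0" and C: "\<And>t x. t \<in> {0..d} \<Longrightarrow> x \<in> E \<Longrightarrow> norm (U t x) \<le> C * norm x"
    using c0_sg_local_bound[OF U] by meson
  define K where "K = max C 1"
  have K: "norm (U t x) \<le> K * norm x" if "t \<in> {0..d}" "x \<in> E" for t x
    using C[OF that] mult_right_mono[of C K "norm x"] by (simp add: K_def)
  have K1: "K \<ge> 1" by (simp add: K_def)
  define w where "w = ln K / d"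
  have iter: "norm (U (real n * d) x) \<le> K ^ n * norm x" if x: "x \<in> E" for n x
  proof (induction n)
    case 0 show ?case using c0_sgD(2)[OF U x] by simp
  next
    case (Suc n)
    have "U (real (Suc n) * d) x = U (d + real n * d) x" by (simp add: algebra_simps)
    also have "\<dots> = U d (U (real n * d) x)" using d x by (intro c0_sgD(3)[OF U]) auto
    also have "norm \<dots> \<le> K * norm (U (real n * d) x)"
      using d x by (intro K c0_sgD(5)[OF U]) auto
    also have "\<dots> \<le> K * (K ^ n * norm x)" using Suc K1 by (intro mult_left_mono) auto
    finally show ?case by simp
  qed
  have "norm (U t x) \<le> K * exp (w * t) * norm x" if t: "t \<ge> 0" and x: "x \<in> E" for t x
  proof -
    define n where "n = nat \<lfloor>t / d\<rfloor>"
    have n: "real n = of_int \<lfloor>t / d\<rfloor>" using t d by (simp add: n_def)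
    have n1: "real n * d \<le> t" "t - real n * d \<le> d"
    proof -
      have "real n \<le> t / d" "t / d \<le> real n + 1" unfolding n by linarith+
      then show "real n * d \<le> t" "t - real n * d \<le> d" using d by (simp_all add: field_simps)
    qed
    have "U t x = U ((t - real n * d) + real n * d) x" by simp
    also have "\<dots> = U (t - real n * d) (U (real n * d) x)"
      using n1 d x by (intro c0_sgD(3)[OF U]) auto
    also have "norm \<dots> \<le> K * norm (U (real n * d) x)"
      using d x n1 by (intro K c0_sgD(5)[OF U]) auto
    also have "\<dots> \<le> K * (K ^ n * norm x)" using iter[OF x] K1 by (intro mult_left_mono) auto
    also have "K ^ n = exp (real n * ln K)" using K1 by (simp add: exp_of_nat_mult)
    also have "\<dots> \<le> exp (w * t)"
      using n1(1) K1 d mult_left_mono[of "real n * d" t "ln K"] by (simp add: w_def field_simps)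
    finally show ?thesis using K1 by (simp add: mult_left_mono mult_right_mono mult.assoc)
  qed
  moreover have "w \<ge> 0" using K1 d by (simp add: w_def)
  ultimately show ?thesis using K1 by blast
qed

lemma c0_sg_bound_interval:
  assumes U: "c0_sg U"
  shows "\<exists>C\<ge>0. \<forall>t\<in>{0..r}. \<forall>x\<in>E. norm (U t x) \<le> C * norm x"
proof -
  obtain K w where K: "K \<ge> 1" "w \<ge> 0" "\<And>t x. t \<ge> 0 \<Longrightarrow> x \<in> E \<Longrightarrow> norm (U t x) \<le> K * exp (w * t) * norm x"
    using c0_sg_growth[OF U] by blast
  have "norm (U t x) \<le> K * exp (w * r) * norm x" if "t \<in> {0..r}" "x \<in> E" for t x
  proof -
    have "K * exp (w * t) * norm x \<le> K * exp (w * r) * norm x"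
      using K that by (intro mult_right_mono mult_left_mono) (auto simp: mult_left_mono)
    then show ?thesis using K(3)[of t x] that by auto
  qed
  then show ?thesis using K(1) by (intro exI[of _ "K * exp (w * r)"]) auto
qed

text \<open>
  Continuity from the left does not follow from continuity at \<open>0\<close> alone; it needs the bound on compact intervals,
  through \<open>U(t)x - U(s)x = U(s)(U(t - s)x - x)\<close>.
\<close>

lemma c0_sg_orbit_uniform:
  assumes U: "c0_sg U" and x: "x \<in> E" and e: "e > 0"
  shows "\<exists>d>0. \<forall>s\<in>{0..r}. \<forall>t\<in>{0..r}. \<bar>s - t\<bar> < d \<longrightarrow> norm (U s x - U t x) < e"
proof -
  obtain C where C: "C \<ge> 0" "\<And>t x. t \<in> {0..r} \<Longrightarrow> x \<in> E \<Longrightarrow> norm (U t x) \<le> C * norm x"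
    using c0_sg_bound_interval[OF U] by blast
  have "eventually (\<lambda>h. norm (U h x - x) < e / (C + 1)) (at_right 0)"
    using tendstoD[OF c0_sgD(4)[OF U x], of "e / (C+1)"] e C(1) by (simp add: dist_norm)
  then obtain d where d: "d > 0" "\<And>h. 0 < h \<Longrightarrow> h < d \<Longrightarrow> norm (U h x - x) < e / (C + 1)"
    unfolding eventually_at_right_field by blast
  have main: "norm (U t x - U s x) < e" if "0 \<le> s" "s \<le> t" "t \<le> r" "t - s < d" for s t
  proof -
    have h: "norm (U (t - s) x - x) < e / (C + 1)"
    proof (cases "t = s")
      case True then show ?thesis using c0_sgD(2)[OF U x] e C(1) by simp
    qed (use d that in auto)
    have xE: "U (t - s) x \<in> E" using c0_sgD(5)[OF U _ x] that by simp
    have "U t x = U s (U (t - s) x)" using c0_sgD(3)[OF U, of s "t - s" x] that x by simp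
    then have "U t x - U s x = U s (U (t - s) x - x)"
      using that x xE by (simp add: bounded_op_diff[OF c0_sgD(1)[OF U]])
    also have "norm \<dots> \<le> C * norm (U (t - s) x - x)"
      using that x xE by (intro C) auto
    also have "\<dots> \<le> C * (e / (C + 1))" using h C(1) by (intro mult_left_mono) auto
    also have "\<dots> < e" using C(1) e by (simp add: field_simps)
    finally show ?thesis .
  qed
  show ?thesis
  proof (intro exI[of _ d] conjI ballI impI d(1))
    fix s t assume *: "s \<in> {0..r}" "t \<in> {0..r}" "\<bar>s - t\<bar> < d"
    show "norm (U s x - U t x) < e"
    proof (cases "s \<le> t")
      case True then show ?thesis using main[of s t] * by (auto simp: norm_minus_commute)
    next
      case False then show ?thesis using main[of t s] * by auto
    qed
  qed
qed

lemma c0_sg_jointly_continuous: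
  assumes U: "c0_sg U"
  shows "continuous_on ({0..} \<times> E) (\<lambda>(t, x). U t x)"
  unfolding continuous_on_iff
proof (intro ballI allI impI)
  fix z :: "real \<times> 'b" and e :: real
  assume z: "z \<in> {0..} \<times> E" and e: "e > 0"
  obtain t x where tx: "z = (t, x)" "t \<ge> 0" "x \<in> E" using z by auto
  obtain C where C: "C \<ge> 0" "\<And>s x. s \<in> {0..t+1} \<Longrightarrow> x \<in> E \<Longrightarrow> norm (U s x) \<le> C * norm x"
    using c0_sg_bound_interval[OF U] by blast
  obtain d where d: "d > 0" "\<And>s r. s \<in> {0..t+1} \<Longrightarrow> r \<in> {0..t+1} \<Longrightarrow> \<bar>s - r\<bar> < d \<Longrightarrow> norm (U s x - U r x) < e/2"
    using c0_sg_orbit_uniform[OF U tx(3), of "e/2" "t+1"] e by auto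
  define d' where "d' = min (min d 1) (e / 2 / (C + 1))"
  have d': "d' > 0" using d e C by (simp add: d'_def)
  show "\<exists>d>0. \<forall>z'\<in>{0..} \<times> E. dist z' z < d \<longrightarrow>
      dist (case z' of (t, x) \<Rightarrow> U t x) (case z of (t, x) \<Rightarrow> U t x) < e"
  proof (intro exI[of _ d'] conjI d' ballI impI)
    fix z' assume z': "z' \<in> {0..} \<times> E" "dist z' z < d'"
    obtain s y where sy: "z' = (s, y)" "s \<ge> 0" "y \<in> E" using z' by auto
    have "dist s t < d'" "dist y x < d'"
      using z'(2) dist_fst_le[of z' z] dist_snd_le[of z' z] by (auto simp: sy tx)
    then have st: "\<bar>s - t\<bar> < d" "s \<le> t + 1" and yx: "norm (y - x) \<le> e / 2 / (C + 1)"
      by (auto simp: d'_def dist_norm)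
    have "norm (U s y - U s x) = norm (U s (y - x))"
      using sy tx by (simp add: bounded_op_diff[OF c0_sgD(1)[OF U]])
    also have "\<dots> \<le> C * norm (y - x)" using sy tx st by (intro C) auto
    also have "\<dots> \<le> C * (e / 2 / (C + 1))" using yx C by (intro mult_left_mono) auto
    also have "\<dots> \<le> e / 2" using C e by (simp add: field_simps)
    finally have a: "norm (U s y - U s x) \<le> e / 2" .
    have b: "norm (U s x - U t x) < e/2" using d sy tx st by auto
    show "dist (case z' of (t, x) \<Rightarrow> U t x) (case z of (t, x) \<Rightarrow> U t x) < e"
      using a b norm_triangle_ineq[of "U s y - U s x" "U s x - U t x"] by (simp add: sy tx dist_norm)
  qed
qed

lemma c0_sg_continuous_on:
  assumes "c0_sg U" "continuous_on X r" "continuous_on X u"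
    "\<And>z. z \<in> X \<Longrightarrow> r z \<ge> 0" "\<And>z. z \<in> X \<Longrightarrow> u z \<in> E"
  shows "continuous_on X (\<lambda>z. U (r z) (u z))"
  using continuous_on_compose2[OF c0_sg_jointly_continuous[OF assms(1)], of X "\<lambda>z. (r z, u z)"] assms
  by (auto intro!: continuous_on_Pair)

lemma c0_sg_continuous_orbit:
  assumes "c0_sg U" "x \<in> E" shows "continuous_on {0..} (\<lambda>t. U t x)"
  by (rule c0_sg_continuous_on[OF assms(1)]) (use assms(2) in \<open>auto intro: continuous_intros\<close>)

lemma average_bound:
  fixes u :: "real \<Rightarrow> 'b"
  assumes c: "continuous_on {0..h} u" and h: "h > 0"
    and e: "\<And>s. s \<in> {0..h} \<Longrightarrow> norm (u s - y) \<le> e"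
  shows "norm (integral {0..h} u /\<^sub>R h - y) \<le> e"
proof -
  have i: "u integrable_on {0..h}" by (intro integrable_continuous_real c)
  have "integral {0..h} (\<lambda>s. u s - y) = integral {0..h} u - h *\<^sub>R y"
    using h by (subst integral_diff[OF i]) auto
  moreover have "norm (integral {0..h} (\<lambda>s. u s - y)) \<le> e * (h - 0)"
    using h e by (intro integral_bound continuous_intros c) auto
  ultimately have b: "norm (integral {0..h} u - h *\<^sub>R y) \<le> e * h" by simp
  have "integral {0..h} u /\<^sub>R h - y = (integral {0..h} u - h *\<^sub>R y) /\<^sub>R h"
    using h by (simp add: algebra_simps)
  then have "norm (integral {0..h} u /\<^sub>R h - y) = norm (integral {0..h} u - h *\<^sub>R y) / h"
    using h by (simp add: divide_inverse mult.commute)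
  then show ?thesis using h b by (simp add: pos_divide_le_eq)
qed

lemma average_tendsto:
  fixes u :: "real \<Rightarrow> 'b"
  assumes c: "continuous_on {0..r} u" and r: "r > 0"
  shows "((\<lambda>h. integral {0..h} u /\<^sub>R h) \<longlongrightarrow> u 0) (at_right 0)"
proof (rule tendstoI)
  fix e :: real assume e: "e > 0"
  have "0 \<in> {0..r}" "e/2 > 0" using r e by auto
  then have "\<exists>d>0. \<forall>s\<in>{0..r}. dist s 0 < d \<longrightarrow> dist (u s) (u 0) < e/2"
    using c unfolding continuous_on_iff by blast
  then obtain d where d: "d > 0" "\<And>s. s \<in> {0..r} \<Longrightarrow> dist s 0 < d \<Longrightarrow> dist (u s) (u 0) < e/2"
    by blast
  have "dist (integral {0..h} u /\<^sub>R h) (u 0) < e" if h: "h \<in> {0<..<min d r}" for h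
  proof -
    have "norm (integral {0..h} u /\<^sub>R h - u 0) \<le> e/2"
    proof (rule average_bound)
      show "continuous_on {0..h} u" using h by (intro continuous_on_subset[OF c]) auto
      show "norm (u s - u 0) \<le> e/2" if "s \<in> {0..h}" for s
        using d(2)[of s] h that by (auto simp: dist_norm)
    qed (use h in auto)
    then show ?thesis using e by (simp add: dist_norm)
  qed
  moreover have "eventually (\<lambda>h. h \<in> {0<..<min d r}) (at_right 0)"
    using d r by (intro eventually_at_right_real) auto
  ultimately show "eventually (\<lambda>h. dist (integral {0..h} u /\<^sub>R h) (u 0) < e) (at_right 0)"
    by (auto elim: eventually_mono)
qed

text \<open>
  This is the link to generators: the generator of \<open>S\<close> is that of \<open>U\<close> plus \<open>B\<close>, on the same domain.
\<close>

lemma tangent_gen: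
  assumes T: "tangent U B S"
  shows "(x, y) \<in> gen_graph S \<longleftrightarrow> x \<in> E \<and> (x, y - B x) \<in> gen_graph U"
proof (cases "x \<in> E")
  case True
  have t: "((\<lambda>h. (S h x - U h x) /\<^sub>R h) \<longlongrightarrow> B x) (at_right 0)"
    using T True by (auto simp: tangent_def)
  have "((\<lambda>h. (S h x - x) /\<^sub>R h) \<longlongrightarrow> y) (at_right 0) \<longleftrightarrow> ((\<lambda>h. (U h x - x) /\<^sub>R h) \<longlongrightarrow> y - B x) (at_right 0)"
  proof
    assume "((\<lambda>h. (S h x - x) /\<^sub>R h) \<longlongrightarrow> y) (at_right 0)"
    from tendsto_diff[OF this t] show "((\<lambda>h. (U h x - x) /\<^sub>R h) \<longlongrightarrow> y - B x) (at_right 0)"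
      by (simp add: algebra_simps)
  next
    assume "((\<lambda>h. (U h x - x) /\<^sub>R h) \<longlongrightarrow> y - B x) (at_right 0)"
    from tendsto_add[OF this t] show "((\<lambda>h. (S h x - x) /\<^sub>R h) \<longlongrightarrow> y) (at_right 0)"
      by (simp add: algebra_simps)
  qed
  then show ?thesis using True by (simp add: gen_graph_def)
qed (simp add: gen_graph_def)

lemma tangent_trans: "tangent U B S \<Longrightarrow> tangent S B' S' \<Longrightarrow> tangent U (\<lambda>x. B x + B' x) S'"
  unfolding tangent_def
proof (intro ballI)
  fix x assume "\<forall>x\<in>E. ((\<lambda>h. (S h x - U h x) /\<^sub>R h) \<longlongrightarrow> B x) (at_right 0)"
    "\<forall>x\<in>E. ((\<lambda>h. (S' h x - S h x) /\<^sub>R h) \<longlongrightarrow> B' x) (at_right 0)" "x \<in> E"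
  then have "((\<lambda>h. (S h x - U h x) /\<^sub>R h) \<longlongrightarrow> B x) (at_right 0)"
    "((\<lambda>h. (S' h x - S h x) /\<^sub>R h) \<longlongrightarrow> B' x) (at_right 0)" by auto
  from tendsto_add[OF this] show "((\<lambda>h. (S' h x - U h x) /\<^sub>R h) \<longlongrightarrow> B x + B' x) (at_right 0)"
    by (simp add: algebra_simps)
qed

lemma tangent_sym: "tangent U B S \<Longrightarrow> tangent S (\<lambda>x. - B x) U"
  unfolding tangent_def
proof (intro ballI)
  fix x assume "\<forall>x\<in>E. ((\<lambda>h. (S h x - U h x) /\<^sub>R h) \<longlongrightarrow> B x) (at_right 0)" "x \<in> E"
  then have "((\<lambda>h. (S h x - U h x) /\<^sub>R h) \<longlongrightarrow> B x) (at_right 0)" by auto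
  from tendsto_minus[OF this] show "((\<lambda>h. (U h x - S h x) /\<^sub>R h) \<longlongrightarrow> - B x) (at_right 0)"
    by (simp add: algebra_simps)
qed

lemma tangent_cong: "tangent U B S \<Longrightarrow> (\<And>x. x \<in> E \<Longrightarrow> B x = B' x) \<Longrightarrow> tangent U B' S"
  by (simp add: tangent_def)

end

section \<open>Uniqueness from the generator and Duhamel's formula\<close>

context closed_subspace begin

lemma gen_E: assumes U: "c0_sg U" and g: "(x, y) \<in> gen_graph U" shows "x \<in> E" "y \<in> E"
proof -
  show x: "x \<in> E" using g by (simp add: gen_graph_def)
  have "((\<lambda>h. (U h x - x) /\<^sub>R h) \<longlongrightarrow> y) (at_right 0)" using g by (simp add: gen_graph_def)
  then show "y \<in> E"
    by (rule E_lim) (use c0_sgD(5)[OF U] x in \<open>auto simp: eventually_at_filter intro!: always_eventually\<close>)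
qed

lemma c0_sg_integral:
  fixes u :: "real \<Rightarrow> 'b"
  assumes U: "c0_sg U" and c: "continuous_on {a..b} u" and uE: "\<And>s. s \<in> {a..b} \<Longrightarrow> u s \<in> E" and t: "t \<ge> 0"
  shows "U t (integral {a..b} u) = integral {a..b} (\<lambda>s. U t (u s))"
proof (rule bounded_op_integral[OF c0_sgD(1)[OF U t]])
  show "u integrable_on {a..b}" by (intro integrable_continuous_real c)
  show "(\<lambda>s. U t (u s)) integrable_on {a..b}"
    by (intro integrable_continuous_real bounded_op_continuous_on2[OF c0_sgD(1)[OF U t] c] uE)
qed (rule uE)

lemma integral_shift_real: "integral {a..b} (\<lambda>s. u (s + h)) = integral {a+h..b+h} (u :: real \<Rightarrow> 'b)"
  using integral_shift_Icc_real[of a b u h] by (simp add: o_def add.commute)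

text \<open>
  For small \<open>h\<close> the difference \<open>U(h)y - y\<close> is the integral of the orbit over \<open>[t, t+h]\<close> minus that over \<open>[0, h]\<close>.
  Averages of orbits thus lie in the domain of the generator, which makes the domain dense.
\<close>

lemma gen_integral:
  assumes U: "c0_sg U" and x: "x \<in> E" and t: "t > 0"
  shows "(integral {0..t} (\<lambda>s. U s x), U t x - x) \<in> gen_graph U"
proof -
  let ?u = "\<lambda>s. U s x"
  have cu: "continuous_on {0..} ?u" by (rule c0_sg_continuous_orbit[OF U x])
  have cab: "continuous_on {a..b} ?u" if "a \<ge> 0" for a b
    by (rule continuous_on_subset[OF cu]) (use that in auto)
  have uE: "?u s \<in> E" if "s \<ge> 0" for s using c0_sgD(5)[OF U that x] .
  define y where "y = integral {0..t} ?u"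
  have yE: "y \<in> E" unfolding y_def
    by (intro integral_in_E integrable_continuous_real cab uE) auto
  have eq: "U h y - y = integral {0..h} (\<lambda>s. U (s + t) x) - integral {0..h} ?u" if h: "h \<in> {0<..<t}" for h
  proof -
    have h0: "h > 0" "h < t" using h by auto
    have "U h y = integral {0..t} (\<lambda>s. U h (U s x))"
      unfolding y_def using h by (intro c0_sg_integral[OF U] cab uE) auto
    also have "\<dots> = integral {0..t} (\<lambda>s. U (s + h) x)"
      using h x by (intro hk_cong)
        (auto simp: add.commute c0_sgD(3)[OF U, of h, symmetric])
    also have "\<dots> = integral {h..t+h} ?u"
      using integral_shift_real[of 0 t ?u h] by simp
    finally have 1: "U h y = integral {h..t+h} ?u" .
    have 2: "integral {0..h} ?u + integral {h..t+h} ?u = integral {0..t+h} ?u"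
      using h t by (intro hk_combine integrable_continuous_real cab) auto
    have 3: "integral {0..t} ?u + integral {t..t+h} ?u = integral {0..t+h} ?u"
      using h t by (intro hk_combine integrable_continuous_real cab) auto
    have 4: "integral {0..h} (\<lambda>s. U (s + t) x) = integral {t..t+h} ?u"
      using integral_shift_real[of 0 h ?u t] by (simp add: add.commute)
    show ?thesis using 1 2 3 4 by (simp add: y_def algebra_simps)
  qed
  have c1: "continuous_on {0..1} (\<lambda>s. U (s + t) x)"
    by (rule c0_sg_continuous_on[OF U]) (use t x in \<open>auto intro!: continuous_intros\<close>)
  have "((\<lambda>h. integral {0..h} (\<lambda>s. U (s + t) x) /\<^sub>R h - integral {0..h} ?u /\<^sub>R h) \<longlongrightarrow> U (0 + t) x - U 0 x) (at_right 0)"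
    by (intro tendsto_diff average_tendsto[where r=1] c1 cab) auto
  then have "((\<lambda>h. integral {0..h} (\<lambda>s. U (s + t) x) /\<^sub>R h - integral {0..h} ?u /\<^sub>R h) \<longlongrightarrow> U t x - x) (at_right 0)"
    using c0_sgD(2)[OF U x] by simp
  moreover have "eventually (\<lambda>h. h \<in> {0<..<t}) (at_right 0)"
    using t by (rule eventually_at_right_real)
  then have "eventually (\<lambda>h. integral {0..h} (\<lambda>s. U (s + t) x) /\<^sub>R h - integral {0..h} ?u /\<^sub>R h = (U h y - y) /\<^sub>R h) (at_right 0)"
    by eventually_elim (simp add: eq scaleR_diff_right)
  ultimately have "((\<lambda>h. (U h y - y) /\<^sub>R h) \<longlongrightarrow> U t x - x) (at_right 0)"
    using tendsto_cong by force
  then show ?thesis using yE by (simp add: gen_graph_def y_def)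
qed

lemma gen_invariant:
  assumes U: "c0_sg U" and g: "(x, y) \<in> gen_graph U" and t: "t \<ge> 0"
  shows "(U t x, U t y) \<in> gen_graph U"
proof -
  have E: "x \<in> E" "y \<in> E" using gen_E[OF U g] by auto
  have ev: "eventually (\<lambda>h::real. h > 0) (at_right 0)" by (auto simp: eventually_at_filter)
  have "((\<lambda>h. (U h x - x) /\<^sub>R h) \<longlongrightarrow> y) (at_right 0)" using g by (simp add: gen_graph_def)
  then have "((\<lambda>h. U t ((U h x - x) /\<^sub>R h)) \<longlongrightarrow> U t y) (at_right 0)"
    by (rule bounded_op_tendsto[OF c0_sgD(1)[OF U t]]) (use E ev c0_sgD(5)[OF U] in \<open>auto elim: eventually_mono\<close>)
  moreover have "eventually (\<lambda>h. U t ((U h x - x) /\<^sub>R h) = (U h (U t x) - U t x) /\<^sub>R h) (at_right 0)"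
    using ev
  proof eventually_elim
    case (elim h)
    have "U t (U h x) = U h (U t x)"
      using c0_sgD(3)[OF U, of t h x] c0_sgD(3)[OF U, of h t x] elim t E by (simp add: add.commute)
    then show ?case using elim E t c0_sgD(5)[OF U]
      by (simp add: bounded_op_scale[OF c0_sgD(1)[OF U t]] bounded_op_diff[OF c0_sgD(1)[OF U t]])
  qed
  ultimately have "((\<lambda>h. (U h (U t x) - U t x) /\<^sub>R h) \<longlongrightarrow> U t y) (at_right 0)"
    by (rule Lim_transform_eventually)
  then show ?thesis using c0_sgD(5)[OF U t E(1)] by (simp add: gen_graph_def)
qed

text \<open>
  With \<open>q(h) = (S(h)y - U(h)y)/h\<close> and \<open>y = S(s)x\<close> the difference quotient equals \<open>U(t - s - h) q(h)\<close>, so joint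
  continuity of \<open>(r, z) \<mapsto> U(r)z\<close> gives the limit.
\<close>

lemma interpolation_right_derivative:
  assumes U: "c0_sg U" and S: "c0_sg S" and x: "x \<in> E" and s: "s \<in> {0..<t}"
    and d: "((\<lambda>h. (S h (S s x) - U h (S s x)) /\<^sub>R h) \<longlongrightarrow> z) (at_right 0)" and z: "z \<in> E"
  shows "((\<lambda>h. (U (t - (s + h)) (S (s + h) x) - U (t - s) (S s x)) /\<^sub>R h) \<longlongrightarrow> U (t - s) z) (at_right 0)"
proof -
  define y where "y = S s x"
  have yE: "y \<in> E" using c0_sgD(5)[OF S _ x] s by (auto simp: y_def)
  define q where "q h = (S h y - U h y) /\<^sub>R h" for h
  have qE: "q h \<in> E" if "h \<ge> 0" for h
    using that yE c0_sgD(5)[OF S] c0_sgD(5)[OF U] by (auto simp: q_def)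
  have ev: "eventually (\<lambda>h::real. h \<in> {0<..<t-s}) (at_right 0)"
    using s by (intro eventually_at_right_real) auto
  have c: "continuous (at (t - s, z) within {0..} \<times> E) (\<lambda>(t, x). U t x)"
    using c0_sg_jointly_continuous[OF U] s z by (auto simp: continuous_on_eq_continuous_within)
  have l: "((\<lambda>h. (t - s - h, q h)) \<longlongrightarrow> (t - s, z)) (at_right 0)"
    using d by (intro tendsto_Pair) (auto intro!: tendsto_eq_intros simp: q_def y_def)
  have "eventually (\<lambda>h. (t - s - h, q h) \<in> {0..} \<times> E) (at_right 0)"
    using ev by eventually_elim (use qE in auto)
  from continuous_within_tendsto_compose[OF c this l]
  have "((\<lambda>h. U (t - s - h) (q h)) \<longlongrightarrow> U (t - s) z) (at_right 0)" by simp
  moreover have "eventually (\<lambda>h. U (t - s - h) (q h) = (U (t - (s + h)) (S (s + h) x) - U (t - s) (S s x)) /\<^sub>R h) (at_right 0)"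
    using ev
  proof eventually_elim
    case (elim h)
    have h: "h > 0" "t - s - h \<ge> 0" using elim by auto
    have 1: "S (s + h) x = S h y" using c0_sgD(3)[OF S, of h s x] h s x by (simp add: y_def add.commute)
    have 2: "U (t - s) y = U (t - s - h) (U h y)" using c0_sgD(3)[OF U, of "t - s - h" h y] h yE by simp
    have "U (t - s - h) (q h) = (U (t - s - h) (S h y) - U (t - s - h) (U h y)) /\<^sub>R h"
      using h yE c0_sgD(5)[OF S] c0_sgD(5)[OF U] unfolding q_def
      by (simp add: bounded_op_scale[OF c0_sgD(1)[OF U h(2)]] bounded_op_diff[OF c0_sgD(1)[OF U h(2)]])
    then show ?case using 1 2 by (simp add: y_def[symmetric] algebra_simps)
  qed
  ultimately show ?thesis by (rule Lim_transform_eventually)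
qed

lemma interpolation_continuous:
  assumes U: "c0_sg U" and S: "c0_sg S" and x: "x \<in> E"
  shows "continuous_on {0..t} (\<lambda>s. U (t - s) (S s x))"
  by (rule c0_sg_continuous_on[OF U])
    (use c0_sgD(5)[OF S _ x] in \<open>auto intro!: continuous_on_op_minus continuous_on_subset[OF c0_sg_continuous_orbit[OF S x], of "{0..t}"]\<close>)

lemma gen_dense:
  assumes U: "c0_sg U" and x: "x \<in> E"
  shows "\<exists>X Y. (\<forall>n::nat. (X n, Y n) \<in> gen_graph U) \<and> X \<longlonglongrightarrow> x"
proof -
  define X where "X n = integral {0..1 / Suc n} (\<lambda>s. U s x) /\<^sub>R (1 / Suc n)" for n
  have "(X n, (U (1 / Suc n) x - x) /\<^sub>R (1 / Suc n)) \<in> gen_graph U" for n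
  proof -
    let ?t = "1 / real (Suc n)" let ?y = "integral {0..?t} (\<lambda>s. U s x)"
    have g: "(?y, U ?t x - x) \<in> gen_graph U" by (rule gen_integral[OF U x]) simp
    have yE: "?y \<in> E" using gen_E[OF U g] by simp
    have "((\<lambda>h. (U h ?y - ?y) /\<^sub>R h /\<^sub>R ?t) \<longlongrightarrow> (U ?t x - x) /\<^sub>R ?t) (at_right 0)"
      using g unfolding gen_graph_def by (intro tendsto_scaleR tendsto_const) simp
    moreover have "eventually (\<lambda>h::real. h > 0) (at_right 0)" by (auto simp: eventually_at_filter)
    then have "eventually (\<lambda>h. (U h ?y - ?y) /\<^sub>R h /\<^sub>R ?t = (U h (X n) - X n) /\<^sub>R h) (at_right 0)"
      by eventually_elim (use yE in \<open>simp add: X_def bounded_op_scale[OF c0_sgD(1)[OF U]] scaleR_diff_right mult.commute\<close>)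
    ultimately have "((\<lambda>h. (U h (X n) - X n) /\<^sub>R h) \<longlongrightarrow> (U ?t x - x) /\<^sub>R ?t) (at_right 0)"
      by (rule Lim_transform_eventually)
    moreover have "X n \<in> E" using yE unfolding X_def by (rule E_simps(5))
    ultimately show ?thesis by (simp add: gen_graph_def)
  qed
  moreover have "X \<longlonglongrightarrow> x"
  proof -
    have "((\<lambda>h. integral {0..h} (\<lambda>s. U s x) /\<^sub>R h) \<longlongrightarrow> U 0 x) (at_right 0)"
      by (rule average_tendsto[where r=1]) (auto intro: continuous_on_subset[OF c0_sg_continuous_orbit[OF U x], of "{0..1}"])
    then have l: "((\<lambda>h. integral {0..h} (\<lambda>s. U s x) /\<^sub>R h) \<longlongrightarrow> x) (at_right 0)"
      using c0_sgD(2)[OF U x] by simp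
    have "filterlim (\<lambda>n. 1 / real (Suc n)) (at_right 0) sequentially"
      unfolding filterlim_at using LIMSEQ_inverse_real_of_nat
      by (auto simp: inverse_eq_divide intro!: always_eventually)
    from filterlim_compose[OF l this] show ?thesis by (simp add: X_def[abs_def])
  qed
  ultimately show ?thesis
    by (intro exI[of _ X] exI[of _ "\<lambda>n. (U (1 / Suc n) x - x) /\<^sub>R (1 / Suc n)"]) auto
qed

text \<open>
  For \<open>x\<close> in the domain, \<open>s \<mapsto> U(t - s)S(s)x\<close> has right derivative \<open>0\<close> and so equal values at \<open>0\<close> and \<open>t\<close>.
\<close>

lemma gen_unique:
  assumes U: "c0_sg U" and S: "c0_sg S" and g: "gen_graph U = gen_graph S" and x: "x \<in> E" and t: "t \<ge> 0"
  shows "U t x = S t x"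
proof -
  have D: "U t x = S t x" if xy: "(x, y) \<in> gen_graph U" for x y
  proof -
    have x: "x \<in> E" using gen_E[OF U xy] by simp
    have "U (t - t) (S t x) = U (t - 0) (S 0 x)"
    proof (rule zero_right_derivative_imp_const[OF interpolation_continuous[OF U S x] t])
      fix s assume s: "s \<in> {0..<t}"
      have "(S s x, S s y) \<in> gen_graph S" using gen_invariant[OF S] xy s by (simp add: g)
      moreover from this have "(S s x, S s y) \<in> gen_graph U" by (simp add: g)
      ultimately have "((\<lambda>h. (S h (S s x) - S s x) /\<^sub>R h) \<longlongrightarrow> S s y) (at_right 0)"
        "((\<lambda>h. (U h (S s x) - S s x) /\<^sub>R h) \<longlongrightarrow> S s y) (at_right 0)"
        by (auto simp: gen_graph_def)
      from tendsto_diff[OF this] have "((\<lambda>h. (S h (S s x) - U h (S s x)) /\<^sub>R h) \<longlongrightarrow> 0) (at_right 0)"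
        by (simp add: algebra_simps)
      from interpolation_right_derivative[OF U S x s this]
      have "((\<lambda>h. (U (t - (s + h)) (S (s + h) x) - U (t - s) (S s x)) /\<^sub>R h) \<longlongrightarrow> U (t - s) 0) (at_right 0)" by simp
      then show "((\<lambda>h. (U (t - (s + h)) (S (s + h) x) - U (t - s) (S s x)) /\<^sub>R h) \<longlongrightarrow> 0) (at_right 0)"
        using s bounded_op_0[OF c0_sgD(1)[OF U, of "t - s"]] by simp
    qed
    then show ?thesis using c0_sgD(2)[OF S x] c0_sgD(2)[OF U] c0_sgD(5)[OF S t x] by simp
  qed
  obtain X Y where X: "\<And>n. (X n, Y n) \<in> gen_graph U" "X \<longlonglongrightarrow> x" using gen_dense[OF U x] by blast
  have XE: "X n \<in> E" for n using gen_E[OF U X(1)] by simp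
  have "(\<lambda>n. U t (X n)) \<longlonglongrightarrow> U t x" "(\<lambda>n. S t (X n)) \<longlonglongrightarrow> S t x"
    using XE by (intro bounded_op_tendsto[OF _ X(2) x] c0_sgD(1)[OF U t] c0_sgD(1)[OF S t]; simp)+
  then show ?thesis using D[OF X(1)] LIMSEQ_unique by simp
qed

lemma tangent_unique:
  assumes "c0_sg S" "c0_sg S'" "tangent U B S" "tangent U B S'" "x \<in> E" "t \<ge> 0"
  shows "S t x = S' t x"
proof (rule gen_unique[OF assms(1,2) _ assms(5,6)])
  show "gen_graph S = gen_graph S'" using tangent_gen[OF assms(3)] tangent_gen[OF assms(4)] by auto
qed

lemma duhamel_continuous:
  assumes U: "c0_sg U" and B: "bounded_op B" and c: "continuous_on {0..t} u" and uE: "\<And>s. s \<in> {0..t} \<Longrightarrow> u s \<in> E"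
  shows "continuous_on {0..t} (\<lambda>s. U (t - s) (B (u s)))"
  by (rule c0_sg_continuous_on[OF U])
    (use uE in \<open>auto intro!: continuous_intros bounded_op_continuous_on2[OF B c] bounded_op_in[OF B]\<close>)

text \<open>
  Subtracting the integral from \<open>s \<mapsto> U(t - s)S(s)x\<close> leaves a function with right derivative \<open>0\<close>, since
  tangency holds at the vector \<open>S(s)x\<close>.
\<close>

lemma duhamel:
  assumes U: "c0_sg U" and S: "c0_sg S" and B: "bounded_op B" and T: "tangent U B S" and x: "x \<in> E" and t: "t \<ge> 0"
  shows "S t x = U t x + integral {0..t} (\<lambda>s. U (t - s) (B (S s x)))"
proof -
  let ?k = "\<lambda>s. U (t - s) (B (S s x))"
  have SE: "S s x \<in> E" if "s \<ge> 0" for s using c0_sgD(5)[OF S that x] .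
  have ck: "continuous_on {0..t} ?k"
    by (rule duhamel_continuous[OF U B])
      (use SE in \<open>auto intro!: continuous_on_subset[OF c0_sg_continuous_orbit[OF S x], of "{0..t}"]\<close>)
  define f where "f s = U (t - s) (S s x) - integral {0..s} ?k" for s
  have "f t = f 0"
  proof (rule zero_right_derivative_imp_const[OF _ t])
    show "continuous_on {0..t} f" unfolding f_def
      by (intro continuous_on_diff interpolation_continuous[OF U S x] indefinite_integral_continuous_1
          integrable_continuous_real ck)
    fix s assume s: "s \<in> {0..<t}"
    have "((\<lambda>h. (S h (S s x) - U h (S s x)) /\<^sub>R h) \<longlongrightarrow> B (S s x)) (at_right 0)"
      using T SE s by (auto simp: tangent_def)
    from interpolation_right_derivative[OF U S x s this bounded_op_in[OF B SE]] s
    have 1: "((\<lambda>h. (U (t - (s + h)) (S (s + h) x) - U (t - s) (S s x)) /\<^sub>R h) \<longlongrightarrow> ?k s) (at_right 0)" by simp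
    have cs: "continuous_on {0..t-s} (\<lambda>r. ?k (r + s))"
      by (rule continuous_on_compose2[OF ck]) (use s in \<open>auto intro!: continuous_intros\<close>)
    have "((\<lambda>h. integral {0..h} (\<lambda>r. ?k (r + s)) /\<^sub>R h) \<longlongrightarrow> ?k (0 + s)) (at_right 0)"
      by (rule average_tendsto[OF cs]) (use s in auto)
    from tendsto_diff[OF 1 this]
    have 2: "((\<lambda>h. (U (t - (s + h)) (S (s + h) x) - U (t - s) (S s x)) /\<^sub>R h
        - integral {0..h} (\<lambda>r. ?k (r + s)) /\<^sub>R h) \<longlongrightarrow> 0) (at_right 0)"
      unfolding add_0_left diff_self .
    have "eventually (\<lambda>h::real. h \<in> {0<..<t-s}) (at_right 0)"
      using s by (intro eventually_at_right_real) auto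
    then have "eventually (\<lambda>h. (U (t - (s + h)) (S (s + h) x) - U (t - s) (S s x)) /\<^sub>R h
        - integral {0..h} (\<lambda>r. ?k (r + s)) /\<^sub>R h = (f (s + h) - f s) /\<^sub>R h) (at_right 0)"
    proof eventually_elim
      case (elim h)
      have "integral {0..h} (\<lambda>r. ?k (r + s)) = integral {s..h+s} ?k"
        using integral_shift_real[of 0 h ?k s] by simp
      moreover have "integral {0..s} ?k + integral {s..h+s} ?k = integral {0..h+s} ?k"
        using elim s by (intro hk_combine integrable_continuous_real
            continuous_on_subset[OF ck]) auto
      ultimately have I: "integral {0..h} (\<lambda>r. ?k (r + s)) = integral {0..s+h} ?k - integral {0..s} ?k"
        by (simp add: add.commute eq_diff_eq)
      show ?case unfolding I f_def by (simp add: scaleR_diff_right)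
    qed
    with 2 show "((\<lambda>h. (f (s + h) - f s) /\<^sub>R h) \<longlongrightarrow> 0) (at_right 0)"
      by (rule Lim_transform_eventually)
  qed
  then show ?thesis using c0_sgD(2)[OF S x] c0_sgD(2)[OF U] SE[OF t] by (simp add: f_def algebra_simps)
qed

end

section \<open>Bounded perturbations\<close>

definition closed_cone :: "'b::real_normed_vector set \<Rightarrow> bool" where
  "closed_cone C \<longleftrightarrow> closed C \<and> 0 \<in> C \<and> (\<forall>x\<in>C. \<forall>y\<in>C. x + y \<in> C) \<and> (\<forall>c\<ge>0. \<forall>x\<in>C. c *\<^sub>R x \<in> C)"

lemma integral_closed_cone:
  fixes f :: "real \<Rightarrow> 'b::banach"
  assumes "closed_cone C" "continuous_on {a..b} f" "\<And>s. s \<in> {a..b} \<Longrightarrow> f s \<in> C"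
  shows "integral {a..b} f \<in> C"
  by (rule integral_in_cone) (use assms in \<open>auto simp: closed_cone_def integrable_continuous_real\<close>)

lemma continuous_on_Ici_if_Icc:
  fixes f :: "real \<Rightarrow> 'b::metric_space"
  assumes "\<And>r. continuous_on {a..r} f"
  shows "continuous_on {a..} f"
  unfolding continuous_on_iff
proof (intro ballI allI impI)
  fix t e :: real assume t: "t \<in> {a..}" and e: "e > 0"
  have "t \<in> {a..t+1}" using t by auto
  then obtain d where d: "d > 0" "\<And>s. s \<in> {a..t+1} \<Longrightarrow> dist s t < d \<Longrightarrow> dist (f s) (f t) < e"
    using assms[of "t+1"] e unfolding continuous_on_iff by meson
  have "dist (f s) (f t) < e" if "s \<in> {a..}" "dist s t < min d 1" for s
    using d(2)[of s] that t by (auto simp: dist_real_def)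
  then show "\<exists>d>0. \<forall>s\<in>{a..}. dist s t < d \<longrightarrow> dist (f s) (f t) < e"
    using d(1) by (intro exI[of _ "min d 1"]) auto
qed

text \<open>
  With an exponential weight of large rate \<open>l\<close> the convolution with a semigroup of growth rate \<open>w\<close> gains the
  factor \<open>1/(l - w)\<close>; this makes Volterra operators contractions on intervals of any length.
\<close>

lemma exp_convolution_integral:
  fixes w l t :: real
  assumes l: "l > w" and t: "t \<ge> 0"
  shows "((\<lambda>s. exp (w * (t - s)) * exp (l * s)) has_integral (exp (l * t) - exp (w * t)) / (l - w)) {0..t}"
proof -
  have "((\<lambda>s. exp (w * t + (l - w) * s)) has_integral
      exp (w * t + (l - w) * t) / (l - w) - exp (w * t + (l - w) * 0) / (l - w)) {0..t}"
    using l by (intro fundamental_theorem_of_calculus t)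
      (auto intro!: derivative_eq_intros simp: has_real_derivative_iff_has_vector_derivative[symmetric])
  moreover have "exp (w * t + (l - w) * s) = exp (w * (t - s)) * exp (l * s)" for s
    by (simp add: exp_add[symmetric] algebra_simps)
  moreover have "exp (w * t + (l - w) * t) / (l - w) - exp (w * t + (l - w) * 0) / (l - w)
      = (exp (l * t) - exp (w * t)) / (l - w)"
    by (simp add: algebra_simps diff_divide_distrib)
  ultimately show ?thesis by simp
qed

context closed_subspace begin

lemma closed_cone_E: "closed_cone E"
  using closed_E by (auto simp: closed_cone_def)

definition conv :: "(real \<Rightarrow> 'b \<Rightarrow> 'b) \<Rightarrow> (real \<Rightarrow> 'b) \<Rightarrow> real \<Rightarrow> 'b" where
  "conv U g t = integral {0..t} (\<lambda>s. U (t - s) (g s))"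

lemma conv_integrand_continuous:
  assumes U: "c0_sg U" and c: "continuous_on {0..t} g" and gE: "\<And>s. s \<in> {0..t} \<Longrightarrow> g s \<in> E"
  shows "continuous_on {0..t} (\<lambda>s. U (t - s) (g s))"
  by (rule c0_sg_continuous_on[OF U]) (use gE c in \<open>auto intro!: continuous_on_op_minus\<close>)

lemma conv_bound:
  assumes U: "c0_sg U" and c: "continuous_on {0..t} g" and gE: "\<And>s. s \<in> {0..t} \<Longrightarrow> g s \<in> E"
    and K: "K \<ge> 0" "\<And>t x. t \<ge> 0 \<Longrightarrow> x \<in> E \<Longrightarrow> norm (U t x) \<le> K * exp (w * t) * norm x"
    and g: "\<And>s. s \<in> {0..t} \<Longrightarrow> norm (g s) \<le> m * exp (l * s)" and m: "m \<ge> 0" and l: "l > w" and t: "t \<ge> 0"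
  shows "norm (conv U g t) \<le> K * m * exp (l * t) / (l - w)"
proof -
  have i: "((\<lambda>s. K * m * (exp (w * (t - s)) * exp (l * s))) has_integral K * m * ((exp (l * t) - exp (w * t)) / (l - w))) {0..t}"
    by (intro has_integral_mult_right exp_convolution_integral l t)
  have "norm (conv U g t) \<le> integral {0..t} (\<lambda>s. K * m * (exp (w * (t - s)) * exp (l * s)))"
    unfolding conv_def
  proof (rule hk_norm_bound)
    show "(\<lambda>s. U (t - s) (g s)) integrable_on {0..t}"
      by (intro integrable_continuous_real conv_integrand_continuous[OF U] c gE)
    show "(\<lambda>s. K * m * (exp (w * (t - s)) * exp (l * s))) integrable_on {0..t}" using i by blast
    fix s assume s: "s \<in> {0..t}"
    have "norm (U (t - s) (g s)) \<le> K * exp (w * (t - s)) * norm (g s)" using s gE by (intro K) auto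
    also have "\<dots> \<le> K * exp (w * (t - s)) * (m * exp (l * s))" using K(1) g[OF s] by (intro mult_left_mono) auto
    finally show "norm (U (t - s) (g s)) \<le> K * m * (exp (w * (t - s)) * exp (l * s))" by (simp add: mult_ac)
  qed
  also have "\<dots> = K * m * (exp (l * t) - exp (w * t)) / (l - w)"
    unfolding integral_unique[OF i] by simp
  also have "\<dots> \<le> K * m * exp (l * t) / (l - w)"
    using K(1) m l by (intro divide_right_mono mult_left_mono) auto
  finally show ?thesis .
qed

lemma conv_in_cone:
  assumes U: "c0_sg U" and c: "continuous_on {0..t} g" and C: "closed_cone C" "C \<subseteq> E"
    and inv: "\<And>t x. t \<ge> 0 \<Longrightarrow> x \<in> C \<Longrightarrow> U t x \<in> C" and g: "\<And>s. s \<in> {0..t} \<Longrightarrow> g s \<in> C"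
  shows "conv U g t \<in> C"
  unfolding conv_def using g C(2)
  by (intro integral_closed_cone[OF C(1)] conv_integrand_continuous[OF U c] inv) auto

lemma conv_in_E:
  assumes U: "c0_sg U" and c: "continuous_on {0..t} g" and g: "\<And>s. s \<in> {0..t} \<Longrightarrow> g s \<in> E"
  shows "conv U g t \<in> E"
  using conv_in_cone[OF U c closed_cone_E _ c0_sgD(5)[OF U] g] by simp

lemma conv_lin:
  assumes U: "c0_sg U" and c: "continuous_on {0..t} g" and g: "\<And>s. s \<in> {0..t} \<Longrightarrow> g s \<in> E"
    and c': "continuous_on {0..t} g'" and g': "\<And>s. s \<in> {0..t} \<Longrightarrow> g' s \<in> E"
  shows "conv U (\<lambda>s. a *\<^sub>R g s + b *\<^sub>R g' s) t = a *\<^sub>R conv U g t + b *\<^sub>R conv U g' t"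
proof -
  have i: "(\<lambda>s. U (t - s) (g s)) integrable_on {0..t}" "(\<lambda>s. U (t - s) (g' s)) integrable_on {0..t}"
    by (intro integrable_continuous_real conv_integrand_continuous[OF U] c c' g g'; assumption)+
  have "conv U (\<lambda>s. a *\<^sub>R g s + b *\<^sub>R g' s) t
      = integral {0..t} (\<lambda>s. a *\<^sub>R U (t - s) (g s) + b *\<^sub>R U (t - s) (g' s))"
    unfolding conv_def using g g' c0_sgD(1)[OF U]
    by (intro hk_cong bounded_op_lin) auto
  also have "\<dots> = a *\<^sub>R conv U g t + b *\<^sub>R conv U g' t"
    unfolding conv_def using i
    by (simp add: Henstock_Kurzweil_Integration.integral_add integrable_cmul Henstock_Kurzweil_Integration.integral_cmul)
  finally show ?thesis .
qed

lemma conv_cong: "(\<And>s. s \<in> {0..t} \<Longrightarrow> g s = g' s) \<Longrightarrow> conv U g t = conv U g' t"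
  unfolding conv_def by (intro hk_cong) auto

text \<open>
  To have a fixed domain of integration, the kernel is continued by \<open>U(max 0 (t - s))\<close> to \<open>s > t\<close>, where it is the
  identity; the surplus is the integral of \<open>g\<close> over \<open>[t, r]\<close>.
\<close>

lemma conv_continuous:
  assumes U: "c0_sg U" and c: "continuous_on {0..} g" and gE: "\<And>s. s \<ge> 0 \<Longrightarrow> g s \<in> E"
  shows "continuous_on {0..} (conv U g)"
proof (rule continuous_on_Ici_if_Icc)
  fix r :: real
  have cg: "continuous_on {a..b} g" if "a \<ge> 0" for a b
    by (rule continuous_on_subset[OF c]) (use that in auto)
  have jc: "continuous_on ({0..r} \<times> cbox 0 r) (\<lambda>(t, s). U (max 0 (t - s)) (g s))"
    unfolding case_prod_beta
    by (rule c0_sg_continuous_on[OF U])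
      (auto intro!: continuous_intros gE continuous_on_compose2[OF c])
  have "continuous_on {0..r} (\<lambda>t. integral (cbox 0 r) (\<lambda>s. U (max 0 (t - s)) (g s)) - integral {0..r} g + integral {0..t} g)"
    by (intro continuous_on_add continuous_on_diff continuous_on_const integral_continuous_on_param jc
      indefinite_integral_continuous_1 integrable_continuous_real cg) auto
  moreover have "integral (cbox 0 r) (\<lambda>s. U (max 0 (t - s)) (g s)) - integral {0..r} g + integral {0..t} g = conv U g t"
    if t: "t \<in> {0..r}" for t
  proof -
    have ct: "continuous_on {0..r} (\<lambda>s. U (max 0 (t - s)) (g s))"
      by (rule c0_sg_continuous_on[OF U]) (auto intro!: continuous_intros gE cg)
    have "integral {0..t} (\<lambda>s. U (max 0 (t - s)) (g s)) + integral {t..r} (\<lambda>s. U (max 0 (t - s)) (g s))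
        = integral {0..r} (\<lambda>s. U (max 0 (t - s)) (g s))"
      using t by (intro hk_combine integrable_continuous_real ct) auto
    moreover have "integral {0..t} (\<lambda>s. U (max 0 (t - s)) (g s)) = conv U g t"
      unfolding conv_def by (intro hk_cong) (auto simp: max_def)
    moreover have "integral {t..r} (\<lambda>s. U (max 0 (t - s)) (g s)) = integral {t..r} g"
      using t gE c0_sgD(2)[OF U] by (intro hk_cong) (auto simp: max_def)
    ultimately have "integral {0..r} (\<lambda>s. U (max 0 (t - s)) (g s)) = conv U g t + integral {t..r} g" by simp
    moreover have "integral {0..t} g + integral {t..r} g = integral {0..r} g"
      using t by (intro hk_combine integrable_continuous_real cg) auto
    then have "integral {t..r} g = integral {0..r} g - integral {0..t} g"
      by (simp add: eq_diff_eq add.commute)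
    ultimately show ?thesis by simp
  qed
  ultimately show "continuous_on {0..r} (conv U g)"
    by (subst continuous_on_cong[OF refl]) auto
qed

lemma conv_split:
  assumes U: "c0_sg U" and c: "continuous_on {0..} g" and gE: "\<And>s. s \<ge> 0 \<Longrightarrow> g s \<in> E" and st: "s \<ge> 0" "t \<ge> 0"
  shows "conv U g (t + s) = U t (conv U g s) + conv U (\<lambda>r. g (r + s)) t"
proof -
  have cg: "continuous_on {a..b} g" if "a \<ge> 0" for a b
    by (rule continuous_on_subset[OF c]) (use that in auto)
  let ?k = "\<lambda>r. U (t + s - r) (g r)"
  have "integral {0..s} ?k + integral {s..t+s} ?k = integral {0..t+s} ?k"
    using st by (intro hk_combine integrable_continuous_real
      conv_integrand_continuous[OF U] cg gE) auto
  moreover have "integral {s..t+s} ?k = conv U (\<lambda>r. g (r + s)) t"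
    using integral_shift_real[of 0 t ?k s] by (simp add: conv_def)
  moreover have "U t (conv U g s) = integral {0..s} (\<lambda>r. U t (U (s - r) (g r)))"
    unfolding conv_def using gE c0_sgD(5)[OF U] st
    by (intro c0_sg_integral[OF U] conv_integrand_continuous[OF U] cg) auto
  moreover have "\<dots> = integral {0..s} ?k"
    using st gE c0_sgD(3)[OF U, of t] by (intro hk_cong) (simp add: add_diff_eq[symmetric])
  ultimately show ?thesis by (simp add: conv_def)
qed

text \<open>
  The Volterra operator \<open>u \<mapsto> conv U (B u)\<close> has norm at most \<open>1/2\<close> with respect to \<open>sup\<^sub>s \<parallel>u s\<parallel> exp (- l s)\<close>.
\<close>

definition contracts :: "(real \<Rightarrow> 'b \<Rightarrow> 'b) \<Rightarrow> ('b \<Rightarrow> 'b) \<Rightarrow> real \<Rightarrow> bool" where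
  "contracts U B l \<longleftrightarrow> (\<forall>t\<ge>0. \<forall>m\<ge>0. \<forall>u. continuous_on {0..t} u \<longrightarrow> (\<forall>s\<in>{0..t}. u s \<in> E) \<longrightarrow>
     (\<forall>s\<in>{0..t}. norm (u s) \<le> m * exp (l * s)) \<longrightarrow>
     norm (conv U (\<lambda>s. B (u s)) t) \<le> m / 2 * exp (l * t))"

lemma contractsD:
  assumes "contracts U B l" "t \<ge> 0" "m \<ge> 0" "continuous_on {0..t} u" "\<And>s. s \<in> {0..t} \<Longrightarrow> u s \<in> E"
    "\<And>s. s \<in> {0..t} \<Longrightarrow> norm (u s) \<le> m * exp (l * s)"
  shows "norm (conv U (\<lambda>s. B (u s)) t) \<le> m / 2 * exp (l * t)"
  using assms unfolding contracts_def by blast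

lemma ex_contracts:
  assumes U: "c0_sg U" and B: "bounded_op B"
  shows "\<exists>K\<ge>1. \<exists>l\<ge>0. (\<forall>t\<ge>0. \<forall>x\<in>E. norm (U t x) \<le> K * exp (l * t) * norm x) \<and> contracts U B l"
proof -
  obtain K w where K: "K \<ge> 1" "w \<ge> 0" "\<And>t x. t \<ge> 0 \<Longrightarrow> x \<in> E \<Longrightarrow> norm (U t x) \<le> K * exp (w * t) * norm x"
    using c0_sg_growth[OF U] by blast
  obtain b where b: "b \<ge> 0" "\<And>x. x \<in> E \<Longrightarrow> norm (B x) \<le> b * norm x"
    using bounded_op_bound[OF B] by blast
  \<comment> \<open>\<open>l\<close> is large enough for \<open>K b / (l - w) \<le> 1/2\<close>.\<close>
  define l where "l = w + 2 * (K * b) + 1"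
  have Kb: "K * b \<ge> 0" using K b by simp
  have l: "l > w" "l \<ge> 0" using K(2) Kb unfolding l_def by linarith+
  show ?thesis
    unfolding contracts_def
  proof (rule exI[of _ K], rule conjI[OF K(1)], rule exI[of _ l], rule conjI[OF l(2)], intro conjI allI ballI impI)
    fix t :: real and x assume tx: "t \<ge> 0" "x \<in> E"
    have "K * exp (w * t) * norm x \<le> K * exp (l * t) * norm x"
      using tx l K by (intro mult_right_mono mult_left_mono) (auto simp: mult_right_mono)
    then show "norm (U t x) \<le> K * exp (l * t) * norm x" using K(3)[OF tx] by simp
  next
    fix t m :: real and u
    assume t: "t \<ge> 0" and m: "m \<ge> 0" and u: "continuous_on {0..t} u" "\<forall>s\<in>{0..t}. u s \<in> E"
      "\<forall>s\<in>{0..t}. norm (u s) \<le> m * exp (l * s)"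
    have "norm (conv U (\<lambda>s. B (u s)) t) \<le> K * (b * m) * exp (l * t) / (l - w)"
    proof (rule conv_bound[OF U bounded_op_continuous_on2[OF B u(1)] _ _ K(3)])
      show "norm (B (u s)) \<le> b * m * exp (l * s)" if "s \<in> {0..t}" for s
        using b(2)[OF u(2)[rule_format, OF that]] mult_left_mono[OF u(3)[rule_format, OF that] b(1)] by simp
    qed (use K b m l t u B in auto)
    also have "\<dots> = (K * b / (l - w)) * (m * exp (l * t))" by simp
    also have "\<dots> \<le> (1/2) * (m * exp (l * t))"
      using Kb m by (intro mult_right_mono) (auto simp: l_def field_simps)
    finally show "norm (conv U (\<lambda>s. B (u s)) t) \<le> m / 2 * exp (l * t)" by simp
  qed
qed

lemma volterra_unique:
  assumes U: "c0_sg U" and B: "bounded_op B" and c: "continuous_on {0..r} u" and uE: "\<And>s. s \<in> {0..r} \<Longrightarrow> u s \<in> E"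
    and eq: "\<And>t. t \<in> {0..r} \<Longrightarrow> u t = conv U (\<lambda>s. B (u s)) t" and t: "t \<in> {0..r}"
  shows "u t = 0"
proof -
  obtain l where l: "l \<ge> 0"
    "contracts U B l"
    using ex_contracts[OF U B] by blast
  have "continuous_on {0..r} (\<lambda>t. norm (u t) * exp (- l * t))" by (intro continuous_intros c)
  then obtain t0 where t0: "t0 \<in> {0..r}" "\<And>s. s \<in> {0..r} \<Longrightarrow> norm (u s) * exp (- l * s) \<le> norm (u t0) * exp (- l * t0)"
    using continuous_attains_sup[of "{0..r}" "\<lambda>t. norm (u t) * exp (- l * t)"] t by auto
  define m where "m = norm (u t0) * exp (- l * t0)"
  have ub: "norm (u s) \<le> m * exp (l * s)" if "s \<in> {0..r}" for s
    using mult_right_mono[OF t0(2)[OF that], of "exp (l * s)"]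
    by (simp add: m_def mult.assoc flip: exp_add)
  have m0: "m \<ge> 0" by (simp add: m_def)
  have "norm (u t0) \<le> m / 2 * exp (l * t0)"
    unfolding eq[OF t0(1)] using t0 uE ub m0
    by (intro contractsD[OF l(2)] continuous_on_subset[OF c]) auto
  then have "m \<le> m / 2" by (simp add: m_def exp_minus field_simps)
  then have "m = 0" using m0 by simp
  then show ?thesis using ub[OF t] by simp
qed

text \<open>
  Picard iteration for \<open>u(t) = U(t)x + \<integral>\<^sub>0\<^sup>t U(t - s) B u(s) ds\<close>. Starting from \<open>0\<close> rather than from the orbit \<open>U(t)x\<close>
  makes the estimate for consecutive iterates uniform, including the first step.
\<close>

primrec picard :: "(real \<Rightarrow> 'b \<Rightarrow> 'b) \<Rightarrow> ('b \<Rightarrow> 'b) \<Rightarrow> 'b \<Rightarrow> nat \<Rightarrow> real \<Rightarrow> 'b" where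
  "picard U B x 0 = (\<lambda>t. 0)"
| "picard U B x (Suc n) = (\<lambda>t. U t x + conv U (\<lambda>s. B (picard U B x n s)) t)"

definition perturb :: "(real \<Rightarrow> 'b \<Rightarrow> 'b) \<Rightarrow> ('b \<Rightarrow> 'b) \<Rightarrow> real \<Rightarrow> 'b \<Rightarrow> 'b" where
  "perturb U B t x = lim (\<lambda>n. picard U B x n t)"

lemma picard_regular:
  assumes U: "c0_sg U" and B: "bounded_op B" and x: "x \<in> E"
  shows "continuous_on {0..} (picard U B x n) \<and> (\<forall>t\<ge>0. picard U B x n t \<in> E)"
proof (induction n)
  case (Suc n)
  have c: "continuous_on {0..} (\<lambda>s. B (picard U B x n s))"
    using Suc by (intro bounded_op_continuous_on2[OF B]) auto
  have "continuous_on {0..} (\<lambda>t. U t x + conv U (\<lambda>s. B (picard U B x n s)) t)"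
    using Suc by (intro continuous_on_add c0_sg_continuous_orbit[OF U x] conv_continuous[OF U] c bounded_op_in[OF B]) auto
  moreover have "U t x + conv U (\<lambda>s. B (picard U B x n s)) t \<in> E" if "t \<ge> 0" for t
    using Suc that c0_sgD(5)[OF U] x
    by (intro E_simps(2) conv_in_E[OF U continuous_on_subset[OF c]] bounded_op_in[OF B]) auto
  ultimately show ?case by simp
qed auto

lemma picard_continuous: "c0_sg U \<Longrightarrow> bounded_op B \<Longrightarrow> x \<in> E \<Longrightarrow> continuous_on {0..t} (picard U B x n)"
  using picard_regular[of U B x n] continuous_on_subset[of "{0..}" _ "{0..t}"] by auto

lemma picard_in_E: "c0_sg U \<Longrightarrow> bounded_op B \<Longrightarrow> x \<in> E \<Longrightarrow> t \<ge> 0 \<Longrightarrow> picard U B x n t \<in> E"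
  using picard_regular by blast

lemma picard_in_cone:
  assumes U: "c0_sg U" and B: "bounded_op B" and C: "closed_cone C" "C \<subseteq> E"
    and Uinv: "\<And>t x. t \<ge> 0 \<Longrightarrow> x \<in> C \<Longrightarrow> U t x \<in> C" and Binv: "\<And>x. x \<in> C \<Longrightarrow> B x \<in> C"
    and x: "x \<in> C" and t: "t \<ge> 0"
  shows "picard U B x n t \<in> C"
  using t
proof (induction n arbitrary: t)
  case (Suc n)
  have xE: "x \<in> E" using x C by auto
  have "conv U (\<lambda>s. B (picard U B x n s)) t \<in> C"
    using Suc picard_in_E[OF U B xE]
    by (intro conv_in_cone[OF U _ C Uinv] Binv bounded_op_continuous_on2[OF B] picard_continuous[OF U B xE]) auto
  then show ?case using Uinv[OF Suc(2) x] C(1) by (auto simp: closed_cone_def)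
qed (use C(1) in \<open>auto simp: closed_cone_def\<close>)

lemma picard_lin:
  assumes U: "c0_sg U" and B: "bounded_op B" and x: "x \<in> E" and y: "y \<in> E" and t: "t \<ge> 0"
  shows "picard U B (a *\<^sub>R x + b *\<^sub>R y) n t = a *\<^sub>R picard U B x n t + b *\<^sub>R picard U B y n t"
  using t
proof (induction n arbitrary: t)
  case (Suc n)
  have "conv U (\<lambda>s. B (picard U B (a *\<^sub>R x + b *\<^sub>R y) n s)) t
      = conv U (\<lambda>s. a *\<^sub>R B (picard U B x n s) + b *\<^sub>R B (picard U B y n s)) t"
    using Suc picard_in_E[OF U B x] picard_in_E[OF U B y] by (intro conv_cong) (auto simp: bounded_op_lin[OF B])
  also have "\<dots> = a *\<^sub>R conv U (\<lambda>s. B (picard U B x n s)) t + b *\<^sub>R conv U (\<lambda>s. B (picard U B y n s)) t"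
    using picard_in_E[OF U B x] picard_in_E[OF U B y]
    by (intro conv_lin[OF U] bounded_op_continuous_on2[OF B] picard_continuous[OF U B] x y bounded_op_in[OF B]) auto
  finally show ?case using Suc(2) by (simp add: bounded_op_lin[OF c0_sgD(1)[OF U]] x y algebra_simps)
qed simp

lemma picard_uniform_limit:
  assumes U: "c0_sg U" and B: "bounded_op B" and x: "x \<in> E"
  shows "uniform_limit {0..r} (\<lambda>n t. picard U B x n t) (\<lambda>t. perturb U B t x) sequentially"
proof -
  let ?p = "picard U B x"
  obtain K l where K: "K \<ge> 1" and l: "l \<ge> 0"
    "\<And>t x. t \<ge> 0 \<Longrightarrow> x \<in> E \<Longrightarrow> norm (U t x) \<le> K * exp (l * t) * norm x"
    "contracts U B l"
    using ex_contracts[OF U B] by blast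
  have step: "norm (?p (Suc n) t - ?p n t) \<le> (1/2) ^ n * (K * norm x) * exp (l * t)" if "t \<ge> 0" for n t
    using that
  proof (induction n arbitrary: t)
    case 0
    have "conv U (\<lambda>s. B 0) t = 0"
      unfolding bounded_op_0[OF B] conv_def using 0
      by (subst hk_cong[where g="\<lambda>_. 0"]) (auto simp: bounded_op_0[OF c0_sgD(1)[OF U]])
    then show ?case using l(2)[OF 0 x] by (simp add: mult_ac)
  next
    case (Suc n)
    have "conv U (\<lambda>s. B (?p (Suc n) s - ?p n s)) t
        = conv U (\<lambda>s. 1 *\<^sub>R B (?p (Suc n) s) + (-1) *\<^sub>R B (?p n s)) t"
      using picard_in_E[OF U B x] by (intro conv_cong) (auto simp: bounded_op_diff[OF B] simp del: picard.simps)
    also have "\<dots> = 1 *\<^sub>R conv U (\<lambda>s. B (?p (Suc n) s)) t + (-1) *\<^sub>R conv U (\<lambda>s. B (?p n s)) t"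
      using picard_in_E[OF U B x]
      by (intro conv_lin[OF U] bounded_op_continuous_on2[OF B] picard_continuous[OF U B] x bounded_op_in[OF B])
        (auto simp del: picard.simps)
    finally have "?p (Suc (Suc n)) t - ?p (Suc n) t = conv U (\<lambda>s. B (?p (Suc n) s - ?p n s)) t"
      by simp
    also have "norm \<dots> \<le> ((1/2) ^ n * (K * norm x)) / 2 * exp (l * t)"
      using K picard_in_E[OF U B x] Suc
      by (intro contractsD[OF l(3)] continuous_on_diff picard_continuous[OF U B x] E_simps)
        (auto simp del: picard.simps)
    finally show ?case by simp
  qed
  have "uniformly_convergent_on {0..r} (\<lambda>n t. \<Sum>i<n. ?p (Suc i) t - ?p i t)"
  proof (rule Weierstrass_m_test')
    show "norm (?p (Suc n) t - ?p n t) \<le> (1/2) ^ n * ((K * norm x) * exp (l * r))" if "t \<in> {0..r}" for n t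
    proof -
      have "(1/2) ^ n * (K * norm x) * exp (l * t) \<le> (1/2) ^ n * (K * norm x) * exp (l * r)"
        using that K l(1) by (intro mult_left_mono) (auto simp: mult_left_mono)
      then show ?thesis using step[of t n] that by (simp add: mult_ac)
    qed
    show "summable (\<lambda>n. (1/2::real) ^ n * ((K * norm x) * exp (l * r)))"
      by (intro summable_mult2 summable_geometric) simp
  qed
  moreover have "(\<Sum>i<n. ?p (Suc i) t - ?p i t) = ?p n t" for n t
    using sum_lessThan_telescope[of "\<lambda>i. ?p i t" n] by simp
  ultimately have "uniformly_convergent_on {0..r} (\<lambda>n t. ?p n t)" by (simp only:)
  then show ?thesis unfolding uniformly_convergent_uniform_limit_iff perturb_def .
qed

lemma picard_tendsto:
  assumes "c0_sg U" "bounded_op B" "x \<in> E" "t \<ge> 0"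
  shows "(\<lambda>n. picard U B x n t) \<longlonglongrightarrow> perturb U B t x"
  using tendsto_uniform_limitI[OF picard_uniform_limit[OF assms(1-3), of t]] assms(4) by simp

text \<open>
  Every cone invariant under \<open>U\<close> and \<open>B\<close> stays invariant. With the cone \<open>E\<close> this is well-definedness, with the positive
  cone it is positivity of the perturbed semigroup.
\<close>

lemma perturb_in_cone:
  assumes U: "c0_sg U" and B: "bounded_op B" and C: "closed_cone C" "C \<subseteq> E"
    and Uinv: "\<And>t x. t \<ge> 0 \<Longrightarrow> x \<in> C \<Longrightarrow> U t x \<in> C" and Binv: "\<And>x. x \<in> C \<Longrightarrow> B x \<in> C"
    and x: "x \<in> C" and t: "t \<ge> 0"
  shows "perturb U B t x \<in> C"
proof (rule Lim_in_closed_set)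
  show "closed C" using C(1) by (simp add: closed_cone_def)
  show "(\<lambda>n. picard U B x n t) \<longlonglongrightarrow> perturb U B t x"
    using x C t by (intro picard_tendsto U B) auto
qed (use picard_in_cone[OF U B C Uinv Binv x t] in auto)

lemma perturb_in_E: "c0_sg U \<Longrightarrow> bounded_op B \<Longrightarrow> x \<in> E \<Longrightarrow> t \<ge> 0 \<Longrightarrow> perturb U B t x \<in> E"
  by (rule perturb_in_cone[OF _ _ closed_cone_E]) (auto dest: c0_sgD)

lemma perturb_continuous:
  assumes U: "c0_sg U" and B: "bounded_op B" and x: "x \<in> E"
  shows "continuous_on {0..} (\<lambda>t. perturb U B t x)"
  by (rule continuous_on_Ici_if_Icc, rule uniform_limit_theorem[OF _ picard_uniform_limit[OF U B x]])
    (auto intro!: always_eventually picard_continuous U B x)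

lemma perturb_volterra:
  assumes U: "c0_sg U" and B: "bounded_op B" and x: "x \<in> E" and t: "t \<ge> 0"
  shows "perturb U B t x = U t x + conv U (\<lambda>s. B (perturb U B s x)) t"
proof -
  let ?p = "picard U B x" let ?q = "\<lambda>s. perturb U B s x"
  obtain l where l: "l \<ge> 0"
    "contracts U B l"
    using ex_contracts[OF U B] by blast
  have cq: "continuous_on {0..t} ?q"
    by (rule continuous_on_subset[OF perturb_continuous[OF U B x]]) auto
  have qE: "?q s \<in> E" if "s \<in> {0..t}" for s using perturb_in_E[OF U B x] that by auto
  have pE: "?p n s \<in> E" if "s \<in> {0..t}" for n s using picard_in_E[OF U B x] that by auto
  have "(\<lambda>n. conv U (\<lambda>s. B (?p n s)) t) \<longlonglongrightarrow> conv U (\<lambda>s. B (?q s)) t"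
  proof (rule tendstoI)
    fix e :: real assume e: "e > 0"
    define m where "m = e / exp (l * t)"
    have m: "m > 0" using e by (simp add: m_def)
    have "eventually (\<lambda>n. \<forall>s\<in>{0..t}. dist (?p n s) (?q s) < m) sequentially"
      using uniform_limitD[OF picard_uniform_limit[OF U B x, of t] m] .
    then show "eventually (\<lambda>n. dist (conv U (\<lambda>s. B (?p n s)) t) (conv U (\<lambda>s. B (?q s)) t) < e) sequentially"
    proof eventually_elim
      case (elim n)
      have "conv U (\<lambda>s. B (?p n s - ?q s)) t = conv U (\<lambda>s. 1 *\<^sub>R B (?p n s) + (-1) *\<^sub>R B (?q s)) t"
        using pE qE by (intro conv_cong) (auto simp: bounded_op_diff[OF B])
      also have "\<dots> = 1 *\<^sub>R conv U (\<lambda>s. B (?p n s)) t + (-1) *\<^sub>R conv U (\<lambda>s. B (?q s)) t"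
        using pE qE
        by (intro conv_lin[OF U] bounded_op_continuous_on2[OF B] picard_continuous[OF U B] cq x bounded_op_in[OF B]) auto
      finally have "conv U (\<lambda>s. B (?p n s)) t - conv U (\<lambda>s. B (?q s)) t = conv U (\<lambda>s. B (?p n s - ?q s)) t"
        by simp
      also have "norm \<dots> \<le> m / 2 * exp (l * t)"
      proof (rule contractsD[OF l(2) t])
        show "norm (?p n s - ?q s) \<le> m * exp (l * s)" if "s \<in> {0..t}" for s
        proof -
          have "1 \<le> exp (l * s)" using l(1) that by simp
          then have "m * 1 \<le> m * exp (l * s)" using m by (intro mult_left_mono) auto
          then show ?thesis using elim that by (force simp: dist_norm)
        qed
      qed (use m pE qE in \<open>auto intro!: continuous_on_diff picard_continuous[OF U B x] cq\<close>)
      also have "\<dots> < e" using e by (simp add: m_def)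
      finally show ?case by (simp add: dist_norm)
    qed
  qed
  then have "(\<lambda>n. U t x + conv U (\<lambda>s. B (?p n s)) t) \<longlonglongrightarrow> U t x + conv U (\<lambda>s. B (?q s)) t"
    by (intro tendsto_add tendsto_const)
  moreover have "(\<lambda>n. ?p (Suc n) t) \<longlonglongrightarrow> perturb U B t x"
    by (intro LIMSEQ_Suc picard_tendsto U B x t)
  ultimately show ?thesis using LIMSEQ_unique by simp
qed

lemma perturb_bound:
  assumes U: "c0_sg U" and B: "bounded_op B" and t: "t \<ge> 0"
  shows "\<exists>C. \<forall>x\<in>E. norm (perturb U B t x) \<le> C * norm x"
proof -
  obtain K l where K: "K \<ge> 1" and l: "l \<ge> 0"
    "\<And>t x. t \<ge> 0 \<Longrightarrow> x \<in> E \<Longrightarrow> norm (U t x) \<le> K * exp (l * t) * norm x"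
    "contracts U B l"
    using ex_contracts[OF U B] by blast
  have pb: "norm (picard U B x n t) \<le> 2 * K * norm x * exp (l * t)" if "x \<in> E" "t \<ge> 0" for x n t
    using that(2)
  proof (induction n arbitrary: t)
    case (Suc n)
    have "norm (conv U (\<lambda>s. B (picard U B x n s)) t) \<le> (2 * K * norm x) / 2 * exp (l * t)"
      using Suc K picard_in_E[OF U B that(1)]
      by (intro contractsD[OF l(3)] picard_continuous[OF U B that(1)]) auto
    moreover have "norm (U t x) \<le> K * exp (l * t) * norm x" using l(2) Suc that by simp
    ultimately have "norm (U t x + conv U (\<lambda>s. B (picard U B x n s)) t)
        \<le> K * exp (l * t) * norm x + (2 * K * norm x) / 2 * exp (l * t)"
      by (rule norm_triangle_mono[rotated])
    then show ?case by (simp add: algebra_simps)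
  qed (use K in auto)
  have "norm (perturb U B t x) \<le> (2 * K * exp (l * t)) * norm x" if "x \<in> E" for x
    using Lim_norm_ubound[OF _ picard_tendsto[OF U B that t]] pb[OF that t] by (simp add: mult_ac)
  then show ?thesis by blast
qed

text \<open>
  The semigroup law: as functions of \<open>s\<close>, both \<open>S(s + t)x\<close> and \<open>S(s)S(t)x\<close> solve the Volterra equation with initial
  value \<open>S(t)x\<close>, so their difference solves the homogeneous equation.
\<close>

lemma c0_sg_perturb:
  assumes U: "c0_sg U" and B: "bounded_op B"
  shows "c0_sg (perturb U B)"
proof -
  let ?S = "perturb U B"
  have SE: "?S t x \<in> E" if "t \<ge> 0" "x \<in> E" for t x using perturb_in_E[OF U B] that by blast
  have cS: "continuous_on {0..} (\<lambda>s. ?S s x)" if "x \<in> E" for x using perturb_continuous[OF U B that] .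
  have S0: "?S 0 x = x" if x: "x \<in> E" for x
    using perturb_volterra[OF U B x, of 0] c0_sgD(2)[OF U x] by (simp add: conv_def)
  have "bounded_op (?S t)" if t: "t \<ge> 0" for t
  proof -
    obtain C where C: "\<And>x. x \<in> E \<Longrightarrow> norm (?S t x) \<le> C * norm x" using perturb_bound[OF U B t] by blast
    show ?thesis
    proof (rule bopI[OF SE[OF t] _ C])
      fix x y a b assume xy: "x \<in> E" "y \<in> E"
      have "(\<lambda>n. a *\<^sub>R picard U B x n t + b *\<^sub>R picard U B y n t) \<longlonglongrightarrow> a *\<^sub>R ?S t x + b *\<^sub>R ?S t y"
        by (intro tendsto_intros picard_tendsto U B xy t)
      moreover have "(\<lambda>n. picard U B (a *\<^sub>R x + b *\<^sub>R y) n t) \<longlonglongrightarrow> ?S t (a *\<^sub>R x + b *\<^sub>R y)"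
        using xy by (intro picard_tendsto U B t) auto
      ultimately show "?S t (a *\<^sub>R x + b *\<^sub>R y) = a *\<^sub>R ?S t x + b *\<^sub>R ?S t y"
        using LIMSEQ_unique picard_lin[OF U B xy t] by simp
    qed
  qed
  moreover have "?S (s + t) x = ?S s (?S t x)" if st: "s \<ge> 0" "t \<ge> 0" and x: "x \<in> E" for s t x
  proof -
    define y where "y = ?S t x"
    have yE: "y \<in> E" using SE st x by (simp add: y_def)
    have csh: "continuous_on {0..} (\<lambda>r. ?S (r + t) x)"
      by (rule continuous_on_compose2[OF cS[OF x]]) (use st in \<open>auto intro!: continuous_intros\<close>)
    have shE: "?S (r + t) x \<in> E" if "r \<ge> 0" for r using SE st x that by simp
    have "?S (s + t) x - ?S s y = 0"
    proof (rule volterra_unique[OF U B, of s])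
      show "continuous_on {0..s} (\<lambda>r. ?S (r + t) x - ?S r y)"
        by (rule continuous_on_subset[OF continuous_on_diff[OF csh cS[OF yE]]]) auto
      show "?S (r + t) x - ?S r y \<in> E" if "r \<in> {0..s}" for r using shE SE yE that by auto
      show "?S (r + t) x - ?S r y = conv U (\<lambda>q. B (?S (q + t) x - ?S q y)) r" if r: "r \<in> {0..s}" for r
      proof -
        have r0: "r \<ge> 0" using r by auto
        have cB: "continuous_on {0..} (\<lambda>q. B (?S q x))" using SE x by (intro bounded_op_continuous_on2[OF B] cS) auto
        have "?S (r + t) x = U (r + t) x + conv U (\<lambda>q. B (?S q x)) (r + t)"
          using perturb_volterra[OF U B x, of "r + t"] r0 st by simp
        also have "conv U (\<lambda>q. B (?S q x)) (r + t) = U r (conv U (\<lambda>q. B (?S q x)) t) + conv U (\<lambda>q. B (?S (q + t) x)) r"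
          using SE x by (intro conv_split[OF U cB] st r0 bounded_op_in[OF B]) auto
        also have "U (r + t) x = U r (U t x)" using c0_sgD(3)[OF U r0 st(2) x] .
        finally have "?S (r + t) x = U r (U t x) + U r (conv U (\<lambda>q. B (?S q x)) t) + conv U (\<lambda>q. B (?S (q + t) x)) r"
          by simp
        also have "U r (U t x) + U r (conv U (\<lambda>q. B (?S q x)) t) = U r y"
        proof -
          have "conv U (\<lambda>q. B (?S q x)) t \<in> E"
            using SE x by (intro conv_in_E[OF U continuous_on_subset[OF cB]] bounded_op_in[OF B]) auto
          then show ?thesis
            using bounded_op_add[OF c0_sgD(1)[OF U r0], of "U t x"] c0_sgD(5)[OF U st(2) x] perturb_volterra[OF U B x st(2)]
            by (simp add: y_def)
        qed
        finally have 1: "?S (r + t) x = U r y + conv U (\<lambda>q. B (?S (q + t) x)) r" .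
        have "conv U (\<lambda>q. B (?S (q + t) x - ?S q y)) r
            = conv U (\<lambda>q. 1 *\<^sub>R B (?S (q + t) x) + (-1) *\<^sub>R B (?S q y)) r"
          using shE SE yE by (intro conv_cong) (auto simp: bounded_op_diff[OF B])
        also have "\<dots> = 1 *\<^sub>R conv U (\<lambda>q. B (?S (q + t) x)) r + (-1) *\<^sub>R conv U (\<lambda>q. B (?S q y)) r"
          using shE SE yE
          by (intro conv_lin[OF U] bounded_op_continuous_on2[OF B] bounded_op_in[OF B]
            continuous_on_subset[OF csh] continuous_on_subset[OF cS[OF yE]]) auto
        finally show ?thesis using 1 perturb_volterra[OF U B yE r0] by simp
      qed
    qed (use st in auto)
    then show ?thesis by (simp add: y_def)
  qed
  moreover have "((\<lambda>t. ?S t x) \<longlongrightarrow> x) (at_right 0)" if x: "x \<in> E" for x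
  proof -
    have "((\<lambda>t. ?S t x) \<longlongrightarrow> ?S 0 x) (at 0 within {0..})"
      using cS[OF x] by (auto simp: continuous_on_def)
    then show ?thesis by (simp add: S0[OF x] at_within_Ici_at_right)
  qed
  ultimately show ?thesis using S0 unfolding c0_sg_def by blast
qed

text \<open>
  The quotient is the average over \<open>[0, h]\<close> of \<open>U(h - s) B S(s)x\<close>, and \<open>(r, s) \<mapsto> U(r) B S(s)x\<close> is jointly continuous with
  value \<open>Bx\<close> at \<open>(0, 0)\<close>.
\<close>

lemma tangent_perturb:
  assumes U: "c0_sg U" and B: "bounded_op B"
  shows "tangent U B (perturb U B)"
  unfolding tangent_def
proof (intro ballI tendstoI)
  fix x and e :: real assume x: "x \<in> E" and e: "e > 0"
  let ?S = "perturb U B"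
  have S: "c0_sg ?S" by (rule c0_sg_perturb[OF U B])
  have SE: "?S s x \<in> E" if "s \<ge> 0" for s using c0_sgD(5)[OF S that x] .
  have "continuous_on ({0..} \<times> {0..}) (\<lambda>z. U (fst z) (B (?S (snd z) x)))"
  proof (rule c0_sg_continuous_on[OF U])
    show "continuous_on ({0..} \<times> {0..}) (\<lambda>z. B (?S (snd z) x))"
    proof (rule bounded_op_continuous_on2[OF B])
      show "continuous_on ({0..} \<times> {0..}) (\<lambda>z. ?S (snd z) x)"
        by (rule continuous_on_compose2[OF c0_sg_continuous_orbit[OF S x]]) (auto intro!: continuous_intros)
    qed (use SE in auto)
  qed (use SE B in \<open>auto intro!: continuous_intros\<close>)
  moreover have "(0::real, 0::real) \<in> {0..} \<times> {0..}" "e/2 > 0" using e by auto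
  ultimately have "\<exists>d>0. \<forall>z\<in>{0..} \<times> {0..}. dist z (0, 0) < d \<longrightarrow>
      dist (U (fst z) (B (?S (snd z) x))) (U (fst (0::real,0::real)) (B (?S (snd (0::real,0::real)) x))) < e/2"
    unfolding continuous_on_iff by blast
  then obtain d where d: "d > 0" "\<And>r s. r \<ge> 0 \<Longrightarrow> s \<ge> 0 \<Longrightarrow> dist (r, s) (0, 0) < d \<Longrightarrow>
      dist (U r (B (?S s x))) (U 0 (B (?S 0 x))) < e/2"
    by auto
  have e0: "U 0 (B (?S 0 x)) = B x" using c0_sgD(2)[OF S x] c0_sgD(2)[OF U bounded_op_in[OF B x]] by simp
  have "dist ((?S h x - U h x) /\<^sub>R h) (B x) < e" if h: "h \<in> {0<..<d/2}" for h
  proof -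
    have "norm (integral {0..h} (\<lambda>s. U (h - s) (B (?S s x))) /\<^sub>R h - B x) \<le> e / 2"
    proof (rule average_bound)
      show "continuous_on {0..h} (\<lambda>s. U (h - s) (B (?S s x)))"
        using SE by (intro duhamel_continuous[OF U B] continuous_on_subset[OF c0_sg_continuous_orbit[OF S x]]) auto
      fix s assume s: "s \<in> {0..h}"
      have "dist (h - s, s) (0, 0) \<le> \<bar>h - s\<bar> + \<bar>s\<bar>"
        using sqrt_sum_squares_le_sum_abs[of "h - s" s] by (simp add: dist_Pair_Pair)
      also have "\<dots> < d" using s h by auto
      finally show "norm (U (h - s) (B (?S s x)) - B x) \<le> e/2"
        using d(2)[of "h - s" s] s h e0 by (simp add: dist_norm)
    qed (use h in auto)
    moreover have "?S h x - U h x = integral {0..h} (\<lambda>s. U (h - s) (B (?S s x)))"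
      using perturb_volterra[OF U B x, of h] h by (simp add: conv_def)
    ultimately show ?thesis using e by (simp add: dist_norm)
  qed
  moreover have "eventually (\<lambda>h. h \<in> {0<..<d/2}) (at_right 0)"
    using d by (intro eventually_at_right_real) auto
  ultimately show "eventually (\<lambda>h. dist ((?S h x - U h x) /\<^sub>R h) (B x) < e) (at_right 0)"
    by (auto elim: eventually_mono)
qed

end

section \<open>Positive semigroups\<close>

text \<open>
  The order properties of \<open>L\<^sub>p\<close> that the argument uses, for \<open>P\<close> the cone of positive elements.
\<close>

locale ordered_closed_subspace = closed_subspace E for E :: "'b::banach set" +
  fixes P :: "'b set"
  assumes cone_P: "closed_cone P" and P_E: "P \<subseteq> E"
    and decompose: "x \<in> E \<Longrightarrow> \<exists>y\<in>P. \<exists>z\<in>P. x = y - z \<and> norm y \<le> norm x \<and> norm z \<le> norm x"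
    and norm_mono: "x \<in> P \<Longrightarrow> y - x \<in> P \<Longrightarrow> norm x \<le> norm y"
    and decreasing_convergent: "(\<And>n::nat. X n \<in> P) \<Longrightarrow> (\<And>n. X n - X (Suc n) \<in> P) \<Longrightarrow> convergent X"
begin

lemma P_in_E [simp, intro]: "x \<in> P \<Longrightarrow> x \<in> E" using P_E by auto

lemma P_simps [simp, intro]:
  "0 \<in> P" "x \<in> P \<Longrightarrow> y \<in> P \<Longrightarrow> x + y \<in> P" "x \<in> P \<Longrightarrow> c \<ge> 0 \<Longrightarrow> c *\<^sub>R x \<in> P"
  using cone_P by (auto simp: closed_cone_def)

lemma P_lim: "(f \<longlongrightarrow> x) F \<Longrightarrow> F \<noteq> bot \<Longrightarrow> eventually (\<lambda>i. f i \<in> P) F \<Longrightarrow> x \<in> P"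
  using Lim_in_closed_set[of P] cone_P unfolding closed_cone_def by blast

definition le :: "'b \<Rightarrow> 'b \<Rightarrow> bool" (infix "\<preceq>" 50) where "x \<preceq> y \<longleftrightarrow> y - x \<in> P"

lemma le_refl [simp, intro]: "x \<preceq> x" by (simp add: le_def)

lemma le_trans [trans]: "x \<preceq> y \<Longrightarrow> y \<preceq> z \<Longrightarrow> x \<preceq> z"
  using P_simps(2)[of "y - x" "z - y"] by (simp add: le_def)

lemma le_antisym: "x \<preceq> y \<Longrightarrow> y \<preceq> x \<Longrightarrow> x = y"
  using norm_mono[of "y - x" 0] by (simp add: le_def)

lemma le_add: "x \<preceq> y \<Longrightarrow> x' \<preceq> y' \<Longrightarrow> x + x' \<preceq> y + y'"
  using P_simps(2)[of "y - x" "y' - x'"] by (simp add: le_def algebra_simps)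

lemma le_scale: "x \<preceq> y \<Longrightarrow> c \<ge> 0 \<Longrightarrow> c *\<^sub>R x \<preceq> c *\<^sub>R y"
  by (simp add: le_def flip: scaleR_diff_right)

lemma le_lim:
  assumes "(f \<longlongrightarrow> x) F" "(g \<longlongrightarrow> y) F" "F \<noteq> bot" "eventually (\<lambda>i. f i \<preceq> g i) F"
  shows "x \<preceq> y"
  using P_lim[OF tendsto_diff[OF assms(2,1)] assms(3)] assms(4) by (simp add: le_def)

lemma le_norm_diff: "x \<preceq> y \<Longrightarrow> y \<preceq> z \<Longrightarrow> norm (y - x) \<le> norm (z - x)"
  using norm_mono[of "y - x" "z - x"] by (simp add: le_def)

lemma le_norm_diff': "x \<preceq> y \<Longrightarrow> y \<preceq> z \<Longrightarrow> norm (z - y) \<le> norm (z - x)"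
  using norm_mono[of "z - y" "z - x"] by (simp add: le_def)

lemma dec_limit:
  assumes "\<And>n::nat. y \<preceq> X n" "\<And>n. X (Suc n) \<preceq> X n"
  shows "\<exists>L. X \<longlonglongrightarrow> L \<and> y \<preceq> L \<and> (\<forall>n. L \<preceq> X n)"
proof -
  have "convergent (\<lambda>n. X n - y)"
    by (rule decreasing_convergent) (use assms in \<open>simp_all add: le_def\<close>)
  then obtain L' where "(\<lambda>n. X n - y) \<longlonglongrightarrow> L'" by (auto simp: convergent_def)
  from tendsto_add[OF this tendsto_const[of y]] obtain L where L: "X \<longlonglongrightarrow> L" by auto
  have dec: "X m \<preceq> X n" if "n \<le> m" for n m
    using that by (induction m rule: dec_induct) (auto intro: le_trans assms)
  have "y \<preceq> L" by (rule le_lim[OF tendsto_const L]) (use assms in auto)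
  moreover have "L \<preceq> X n" for n
    by (rule le_lim[OF L tendsto_const]) (use dec in \<open>auto intro: eventually_sequentiallyI[of n]\<close>)
  ultimately show ?thesis using L by blast
qed

lemma inc_limit:
  assumes "\<And>n::nat. X n \<preceq> y" "\<And>n. X n \<preceq> X (Suc n)"
  shows "\<exists>L. X \<longlonglongrightarrow> L \<and> L \<preceq> y \<and> (\<forall>n. X n \<preceq> L)"
proof -
  have "- y \<preceq> - X n" "- X (Suc n) \<preceq> - X n" for n using assms by (auto simp: le_def)
  then obtain L where L: "(\<lambda>n. - X n) \<longlonglongrightarrow> L" "- y \<preceq> L" "\<And>n. L \<preceq> - X n"
    using dec_limit[of "- y" "\<lambda>n. - X n"] by auto
  have "X \<longlonglongrightarrow> - L" using tendsto_minus[OF L(1)] by simp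
  moreover have "- L \<preceq> y" using L(2) by (simp add: le_def add.commute)
  moreover have "X n \<preceq> - L" for n
  proof -
    have "- X n - L = - L - X n" by simp
    then show ?thesis using L(3)[of n] by (simp only: le_def)
  qed
  ultimately show ?thesis by blast
qed

definition pos_op :: "('b \<Rightarrow> 'b) \<Rightarrow> bool" where "pos_op B \<longleftrightarrow> (\<forall>x\<in>P. B x \<in> P)"
definition pos_family :: "(real \<Rightarrow> 'b \<Rightarrow> 'b) \<Rightarrow> bool" where "pos_family U \<longleftrightarrow> (\<forall>t\<ge>0. pos_op (U t))"

lemma pos_opD: "pos_op B \<Longrightarrow> x \<in> P \<Longrightarrow> B x \<in> P" by (simp add: pos_op_def)
lemma pos_familyD: "pos_family U \<Longrightarrow> t \<ge> 0 \<Longrightarrow> x \<in> P \<Longrightarrow> U t x \<in> P" by (simp add: pos_family_def pos_op_def)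

text \<open>
  By uniqueness \<open>S\<close> is the semigroup obtained by Picard iteration, all of whose iterates are positive.
\<close>

lemma pos_family_tangent:
  assumes U: "c0_sg U" "pos_family U" and S: "c0_sg S" and B: "bounded_op B" "pos_op B" and T: "tangent U B S"
  shows "pos_family S"
  unfolding pos_family_def pos_op_def
proof (intro allI ballI impI)
  fix t :: real and x assume t: "t \<ge> 0" and x: "x \<in> P"
  have "S t x = perturb U B t x"
    using tangent_unique[OF S c0_sg_perturb[OF U(1) B(1)] T tangent_perturb[OF U(1) B(1)]] x t by simp
  also have "\<dots> \<in> P"
    by (rule perturb_in_cone[OF U(1) B(1) cone_P P_E]) (use x t in \<open>auto intro: pos_familyD[OF U(2)] pos_opD[OF B(2)]\<close>)
  finally show "S t x \<in> P" .
qed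

lemma c0_sg_exp:
  assumes S: "c0_sg S" shows "c0_sg (\<lambda>t x. exp (c * t) *\<^sub>R S t x)"
  unfolding c0_sg_def
proof (intro conjI allI ballI impI)
  fix t :: real assume t: "t \<ge> 0"
  obtain C where C: "\<And>x. x \<in> E \<Longrightarrow> norm (S t x) \<le> C * norm x" using bounded_op_bound[OF c0_sgD(1)[OF S t]] by blast
  show "bounded_op (\<lambda>x. exp (c * t) *\<^sub>R S t x)"
  proof (rule bopI)
    show "norm (exp (c * t) *\<^sub>R S t x) \<le> (exp (c * t) * C) * norm x" if "x \<in> E" for x
      using C[OF that] by simp
  qed (use c0_sgD(5)[OF S t] in \<open>auto simp: bounded_op_lin[OF c0_sgD(1)[OF S t]] algebra_simps\<close>)
next
  fix x assume x: "x \<in> E"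
  show "exp (c * 0) *\<^sub>R S 0 x = x" using c0_sgD(2)[OF S x] by simp
  have "((\<lambda>t. exp (c * t) *\<^sub>R S t x) \<longlongrightarrow> exp (c * 0) *\<^sub>R x) (at_right 0)"
    by (intro tendsto_intros c0_sgD(4)[OF S x])
  then show "((\<lambda>t. exp (c * t) *\<^sub>R S t x) \<longlongrightarrow> x) (at_right 0)" by simp
next
  fix s t :: real and x assume *: "s \<ge> 0" "t \<ge> 0" "x \<in> E"
  then show "exp (c * (s + t)) *\<^sub>R S (s + t) x = exp (c * s) *\<^sub>R S s (exp (c * t) *\<^sub>R S t x)"
    using c0_sgD(3)[OF S *] c0_sgD(5)[OF S *(2,3)]
    by (simp add: bounded_op_scale[OF c0_sgD(1)[OF S]] distrib_left exp_add)
qed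

lemma tangent_exp:
  assumes S: "c0_sg S" and T: "tangent U B S"
  shows "tangent U (\<lambda>x. B x + c *\<^sub>R x) (\<lambda>t x. exp (c * t) *\<^sub>R S t x)"
proof (rule tangent_trans[OF T])
  show "tangent S (\<lambda>x. c *\<^sub>R x) (\<lambda>t x. exp (c * t) *\<^sub>R S t x)"
    unfolding tangent_def
  proof
    fix x assume x: "x \<in> E"
    have "((\<lambda>h. exp (c * h)) has_field_derivative c) (at 0)"
      by (auto intro!: derivative_eq_intros)
    then have "((\<lambda>h. (exp (c * h) - 1) / h) \<longlongrightarrow> c) (at 0)" by (simp add: has_field_derivative_iff)
    then have "((\<lambda>h. (exp (c * h) - 1) / h) \<longlongrightarrow> c) (at_right 0)"
      by (rule tendsto_mono[rotated]) (simp add: at_le)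
    from tendsto_scaleR[OF this c0_sgD(4)[OF S x]]
    show "((\<lambda>h. (exp (c * h) *\<^sub>R S h x - S h x) /\<^sub>R h) \<longlongrightarrow> c *\<^sub>R x) (at_right 0)"
      by (simp add: algebra_simps divide_inverse)
  qed
qed

text \<open>
  A perturbation \<open>B\<close> that is not positive, such as \<open>-W\<close>, becomes positive after adding a constant \<open>c\<close>, which only
  multiplies the semigroup by \<open>exp (c t)\<close>.
\<close>

lemma pos_family_tangent_shift:
  assumes U: "c0_sg U" "pos_family U" and S: "c0_sg S" and B: "bounded_op B" and T: "tangent U B S"
    and c: "\<And>x. x \<in> P \<Longrightarrow> B x + c *\<^sub>R x \<in> P"
  shows "pos_family S"
proof -
  obtain C where C: "\<And>x. x \<in> E \<Longrightarrow> norm (B x) \<le> C * norm x" using bounded_op_bound[OF B] by blast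
  have "bounded_op (\<lambda>x. B x + c *\<^sub>R x)"
  proof (rule bopI)
    show "norm (B x + c *\<^sub>R x) \<le> (C + \<bar>c\<bar>) * norm x" if "x \<in> E" for x
      using norm_triangle_ineq[of "B x" "c *\<^sub>R x"] C[OF that] by (simp add: algebra_simps)
  qed (use B in \<open>auto simp: bounded_op_lin algebra_simps\<close>)
  moreover have "pos_op (\<lambda>x. B x + c *\<^sub>R x)" using c by (simp add: pos_op_def)
  ultimately have p: "pos_family (\<lambda>t x. exp (c * t) *\<^sub>R S t x)"
    by (rule pos_family_tangent[OF U c0_sg_exp[OF S] _ _ tangent_exp[OF S T]])
  show ?thesis unfolding pos_family_def pos_op_def
  proof (intro allI ballI impI)
    fix t :: real and x assume *: "t \<ge> 0" "x \<in> P"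
    have "exp (- (c * t)) *\<^sub>R exp (c * t) *\<^sub>R S t x \<in> P"
      using pos_familyD[OF p *] by (rule P_simps(3)) simp
    moreover have "exp (- (c * t)) *\<^sub>R exp (c * t) *\<^sub>R S t x = S t x" by (simp flip: exp_add)
    ultimately show "S t x \<in> P" by (simp only:)
  qed
qed

text \<open>
  The difference is the Duhamel integral, whose integrand is positive.
\<close>

lemma tangent_mono:
  assumes U: "c0_sg U" "pos_family U" and S: "c0_sg S" "pos_family S" and B: "bounded_op B" "pos_op B" and T: "tangent U B S"
    and t: "t \<ge> 0" and x: "x \<in> P"
  shows "U t x \<preceq> S t x"
proof -
  have xE: "x \<in> E" using x by simp
  have "integral {0..t} (\<lambda>s. U (t - s) (B (S s x))) \<in> P"
  proof (rule integral_closed_cone[OF cone_P])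
    show "continuous_on {0..t} (\<lambda>s. U (t - s) (B (S s x)))"
      using c0_sgD(5)[OF S(1) _ xE]
      by (intro duhamel_continuous[OF U(1) B(1)] continuous_on_subset[OF c0_sg_continuous_orbit[OF S(1) xE]]) auto
  qed (use x in \<open>auto intro!: pos_familyD[OF U(2)] pos_opD[OF B(2)] pos_familyD[OF S(2)]\<close>)
  then show ?thesis using duhamel[OF U(1) S(1) B(1) T _ t, of x] x by (simp add: le_def)
qed

lemma bounded_op_scaled: "bounded_op B \<Longrightarrow> bounded_op (\<lambda>x. c *\<^sub>R B x)"
proof -
  assume B: "bounded_op B"
  obtain C where C: "\<And>x. x \<in> E \<Longrightarrow> norm (B x) \<le> C * norm x" using bounded_op_bound[OF B] by blast
  show ?thesis
  proof (rule bopI)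
    show "norm (c *\<^sub>R B x) \<le> (\<bar>c\<bar> * C) * norm x" if "x \<in> E" for x
      using C[OF that] by (simp add: mult.assoc mult_left_mono)
  qed (use B in \<open>auto simp: bounded_op_lin algebra_simps\<close>)
qed

text \<open>
  Here \<open>S0\<close>, \<open>Sh\<close>, \<open>S1\<close> play the roles of \<open>T\<^sub>W\<close>, \<open>T\<^bsub>W + hD\<^esub>\<close>, \<open>T\<^bsub>W + D\<^esub>\<close>. Expressing \<open>Sh\<close> and \<open>S1\<close> by Duhamel's formula relative to
  \<open>S0\<close>, the defect \<open>(1 - h) S0 + h S1 - Sh\<close> at time \<open>t\<close> is \<open>h \<integral>\<^sub>0\<^sup>t S0(t - s) D (Sh(s) - S1(s)) ds\<close>, which is positive
  because \<open>S1 \<le> Sh\<close>. The sign of \<open>D\<close> enters twice.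
\<close>

lemma convexity:
  assumes S0: "c0_sg S0" "pos_family S0" and S1: "c0_sg S1" "pos_family S1" and Sh: "c0_sg Sh" "pos_family Sh"
    and D: "bounded_op D" "pos_op D" and T1: "tangent S0 (\<lambda>x. - D x) S1" and Th: "tangent S0 (\<lambda>x. - (h *\<^sub>R D x)) Sh"
    and h: "0 \<le> h" "h \<le> 1" and t: "t \<ge> 0" and x: "x \<in> P"
  shows "Sh t x \<preceq> (1 - h) *\<^sub>R S0 t x + h *\<^sub>R S1 t x"
proof -
  have xE: "x \<in> E" using x by simp
  have "tangent S1 (\<lambda>x. - (- D x) + - (h *\<^sub>R D x)) Sh" by (rule tangent_trans[OF tangent_sym[OF T1] Th])
  then have T1h: "tangent S1 (\<lambda>x. (1 - h) *\<^sub>R D x) Sh" by (rule tangent_cong) (simp add: algebra_simps)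
  have le: "S1 s x \<preceq> Sh s x" if "s \<ge> 0" for s
    by (rule tangent_mono[OF S1 Sh bounded_op_scaled[OF D(1)] _ T1h that x]) (use h D(2) in \<open>auto simp: pos_op_def\<close>)
  let ?k1 = "\<lambda>s. S0 (t - s) (- D (S1 s x))" and ?kh = "\<lambda>s. S0 (t - s) (- (h *\<^sub>R D (Sh s x)))"
  have b1: "bounded_op (\<lambda>x. - D x)" using bounded_op_scaled[OF D(1), of "-1"] by simp
  have bh: "bounded_op (\<lambda>x. - (h *\<^sub>R D x))" using bounded_op_scaled[OF D(1), of "-h"] by simp
  have c1: "continuous_on {0..t} ?k1"
    using c0_sgD(5)[OF S1(1) _ xE]
    by (intro duhamel_continuous[OF S0(1) b1] continuous_on_subset[OF c0_sg_continuous_orbit[OF S1(1) xE]]) auto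
  have ch: "continuous_on {0..t} ?kh"
    using c0_sgD(5)[OF Sh(1) _ xE]
    by (intro duhamel_continuous[OF S0(1) bh] continuous_on_subset[OF c0_sg_continuous_orbit[OF Sh(1) xE]]) auto
  have d1: "S1 t x = S0 t x + integral {0..t} ?k1" by (rule duhamel[OF S0(1) S1(1) b1 T1 xE t])
  have dh: "Sh t x = S0 t x + integral {0..t} ?kh" by (rule duhamel[OF S0(1) Sh(1) bh Th xE t])
  have "integral {0..t} (\<lambda>s. h *\<^sub>R ?k1 s - ?kh s) \<in> P"
  proof (rule integral_closed_cone[OF cone_P])
    show "continuous_on {0..t} (\<lambda>s. h *\<^sub>R ?k1 s - ?kh s)" by (intro continuous_intros c1 ch)
    fix s assume s: "s \<in> {0..t}"
    have E: "S1 s x \<in> E" "Sh s x \<in> E" using c0_sgD(5)[OF S1(1) _ xE] c0_sgD(5)[OF Sh(1) _ xE] s by auto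
    have DE: "D (S1 s x) \<in> E" "D (Sh s x) \<in> E" using E D(1) by auto
    have b: "bounded_op (S0 (t - s))" using c0_sgD(1)[OF S0(1)] s by auto
    have "h *\<^sub>R ?k1 s - ?kh s = S0 (t - s) (h *\<^sub>R - D (S1 s x) - - (h *\<^sub>R D (Sh s x)))"
    proof -
      have *: "h *\<^sub>R S0 (t - s) u - S0 (t - s) v = S0 (t - s) (h *\<^sub>R u - v)" if "u \<in> E" "v \<in> E" for u v
        using that b by (simp add: bounded_op_diff bounded_op_scale)
      show ?thesis by (rule *) (use DE in auto)
    qed
    also have "h *\<^sub>R - D (S1 s x) - - (h *\<^sub>R D (Sh s x)) = h *\<^sub>R D (Sh s x - S1 s x)"
      using E by (simp add: bounded_op_diff[OF D(1)] scaleR_diff_right)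
    also have "S0 (t - s) (h *\<^sub>R D (Sh s x - S1 s x)) \<in> P"
    proof (intro pos_familyD[OF S0(2)] P_simps(3) pos_opD[OF D(2)])
      show "Sh s x - S1 s x \<in> P" using le[of s] s by (simp add: le_def)
    qed (use s h in auto)
    finally show "h *\<^sub>R ?k1 s - ?kh s \<in> P" .
  qed
  moreover have "integral {0..t} (\<lambda>s. h *\<^sub>R ?k1 s - ?kh s) = h *\<^sub>R integral {0..t} ?k1 - integral {0..t} ?kh"
  proof -
    have "(\<lambda>s. h *\<^sub>R ?k1 s) integrable_on {0..t}" "?kh integrable_on {0..t}"
      by (intro integrable_continuous_real continuous_on_scaleR continuous_on_const c1)
         (intro integrable_continuous_real ch)
    from Henstock_Kurzweil_Integration.integral_diff[OF this] show ?thesis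
      by (simp add: Henstock_Kurzweil_Integration.integral_cmul)
  qed
  moreover have "(1 - h) *\<^sub>R S0 t x + h *\<^sub>R S1 t x - Sh t x = h *\<^sub>R integral {0..t} ?k1 - integral {0..t} ?kh"
    unfolding d1 dh by (simp add: algebra_simps)
  ultimately show ?thesis by (simp add: le_def)
qed

text \<open>
  Domination on positive elements passes to norms at the cost of a factor \<open>2\<close>, from splitting \<open>x\<close> into its positive and
  negative parts.
\<close>

lemma dominated_bound:
  assumes B: "bounded_op B" "pos_op B" and A: "\<And>x. x \<in> P \<Longrightarrow> B x \<preceq> A x"
    and C: "C \<ge> 0" "\<And>x. x \<in> E \<Longrightarrow> norm (A x) \<le> C * norm x" and x: "x \<in> E"
  shows "norm (B x) \<le> 2 * C * norm x"
proof -
  obtain y z where yz: "y \<in> P" "z \<in> P" "x = y - z" "norm y \<le> norm x" "norm z \<le> norm x"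
    using decompose[OF x] by blast
  have b: "norm (B v) \<le> C * norm x" if v: "v \<in> P" "norm v \<le> norm x" for v
  proof -
    have "norm (B v) \<le> norm (A v)" using norm_mono[OF pos_opD[OF B(2) v(1)]] A[OF v(1)] by (simp add: le_def)
    also have "\<dots> \<le> C * norm v" using C(2) v by simp
    also have "\<dots> \<le> C * norm x" using C(1) v by (intro mult_left_mono) auto
    finally show ?thesis .
  qed
  have "norm (B x) \<le> norm (B y) + norm (B z)"
    unfolding yz(3) using yz(1,2) by (simp add: bounded_op_diff[OF B(1)] norm_triangle_ineq4)
  then show ?thesis using b[OF yz(1,4)] b[OF yz(2,5)] by simp
qed

text \<open>
  All \<open>T k\<close> and \<open>S k\<close> lie between \<open>V\<close> and \<open>U\<close>. Hence on positive \<open>x\<close> both \<open>\<parallel>S k s x - x\<parallel>\<close> and \<open>\<parallel>T k s x - x\<parallel>\<close> are at most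
  \<open>\<eta> x s = \<parallel>U s x - V s x\<parallel> + \<parallel>V s x - x\<parallel>\<close>, which does not depend on \<open>k\<close> and tends to \<open>0\<close> with \<open>s\<close>. Applied to the Duhamel
  integral for \<open>S k h x - T k h x\<close>, this makes the convergence in the tangency relation uniform in \<open>k\<close>. The same bound
  gives strong continuity of the limit.
\<close>

lemma tangent_limit:
  assumes V: "c0_sg V" "pos_family V" and U: "c0_sg U" "pos_family U"
    and T: "\<And>k::nat. c0_sg (T k)" "\<And>k. pos_family (T k)" and S: "\<And>k. c0_sg (S k)" "\<And>k. pos_family (S k)"
    and B: "bounded_op B" "pos_op B" and tangent: "\<And>k. tangent (T k) B (S k)"
    and VT: "\<And>k t x. t \<ge> 0 \<Longrightarrow> x \<in> P \<Longrightarrow> V t x \<preceq> T k t x"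
    and SU: "\<And>k t x. t \<ge> 0 \<Longrightarrow> x \<in> P \<Longrightarrow> S k t x \<preceq> U t x"
    and Tlim: "\<And>t x. t \<ge> 0 \<Longrightarrow> x \<in> E \<Longrightarrow> (\<lambda>k. T k t x) \<longlonglongrightarrow> V t x"
    and Slim: "\<And>t x. t \<ge> 0 \<Longrightarrow> x \<in> E \<Longrightarrow> (\<lambda>k. S k t x) \<longlonglongrightarrow> R t x"
  shows "c0_sg R" "tangent V B R"
proof -
  have TS: "T k t x \<preceq> S k t x" if "t \<ge> 0" "x \<in> P" for k t x
    by (rule tangent_mono[OF T S B tangent that])
  have TU: "T k t x \<preceq> U t x" if "t \<ge> 0" "x \<in> P" for k t x
    using TS[OF that] SU[OF that] by (rule le_trans)
  have VS: "V t x \<preceq> S k t x" if "t \<ge> 0" "x \<in> P" for k t x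
    using VT[OF that] TS[OF that] by (rule le_trans)
  have RE: "R t x \<in> E" if "t \<ge> 0" "x \<in> E" for t x
    using E_lim[OF Slim[OF that]] c0_sgD(5)[OF S(1) that] by simp
  have bS: "\<exists>C\<ge>0. \<forall>k. \<forall>t\<in>{0..r}. \<forall>x\<in>E. norm (S k t x) \<le> C * norm x \<and> norm (T k t x) \<le> C * norm x" for r
  proof -
    obtain C where C: "C \<ge> 0" "\<And>t x. t \<in> {0..r} \<Longrightarrow> x \<in> E \<Longrightarrow> norm (U t x) \<le> C * norm x"
      using c0_sg_bound_interval[OF U(1)] by blast
    have "norm (S k t x) \<le> 2 * C * norm x \<and> norm (T k t x) \<le> 2 * C * norm x" if t: "t \<in> {0..r}" and x: "x \<in> E" for k t x
    proof
      show "norm (S k t x) \<le> 2 * C * norm x"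
        by (rule dominated_bound[of _ "U t"]) (use t x C c0_sgD(1)[OF S(1)] S(2) SU in \<open>auto simp: pos_family_def\<close>)
      show "norm (T k t x) \<le> 2 * C * norm x"
        by (rule dominated_bound[of _ "U t"]) (use t x C c0_sgD(1)[OF T(1)] T(2) TU in \<open>auto simp: pos_family_def\<close>)
    qed
    then show ?thesis using C(1) by (intro exI[of _ "2 * C"]) auto
  qed
  have bopR: "bounded_op (R t)" if t: "t \<ge> 0" for t
  proof -
    obtain C where C: "\<And>k s x. s \<in> {0..t} \<Longrightarrow> x \<in> E \<Longrightarrow> norm (S k s x) \<le> C * norm x" using bS[of t] by blast
    show ?thesis
    proof (rule bopI[OF RE[OF t]])
      fix x assume x: "x \<in> E"
      show "norm (R t x) \<le> C * norm x"
        by (rule Lim_norm_ubound[OF _ Slim[OF t x]]) (use C t x in auto)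
    next
      fix x y a b assume xy: "x \<in> E" "y \<in> E"
      have "(\<lambda>k. a *\<^sub>R S k t x + b *\<^sub>R S k t y) \<longlonglongrightarrow> a *\<^sub>R R t x + b *\<^sub>R R t y"
        by (intro tendsto_intros Slim t xy)
      moreover have "(\<lambda>k. S k t (a *\<^sub>R x + b *\<^sub>R y)) \<longlonglongrightarrow> R t (a *\<^sub>R x + b *\<^sub>R y)"
        using xy t by (intro Slim) auto
      ultimately show "R t (a *\<^sub>R x + b *\<^sub>R y) = a *\<^sub>R R t x + b *\<^sub>R R t y"
        using LIMSEQ_unique bounded_op_lin[OF c0_sgD(1)[OF S(1) t] xy] by simp
    qed
  qed
  define \<eta> where "\<eta> x s = norm (U s x - V s x) + norm (V s x - x)" for x s
  have \<eta>0: "(\<eta> x \<longlongrightarrow> 0) (at_right 0)" if x: "x \<in> E" for x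
  proof -
    have "((\<lambda>s. norm (U s x - V s x) + norm (V s x - x)) \<longlongrightarrow> norm (x - x) + norm (x - x)) (at_right 0)"
      by (intro tendsto_intros c0_sgD(4)[OF U(1) x] c0_sgD(4)[OF V(1) x])
    then show ?thesis by (simp add: \<eta>_def[abs_def])
  qed
  have \<eta>S: "norm (S k s x - x) \<le> \<eta> x s" and \<eta>T: "norm (T k s x - x) \<le> \<eta> x s" if "s \<ge> 0" "x \<in> P" for k s x
    using norm_triangle_ineq[of "S k s x - V s x" "V s x - x"] le_norm_diff[OF VS[OF that] SU[OF that]]
      norm_triangle_ineq[of "T k s x - V s x" "V s x - x"] le_norm_diff[OF VT[OF that] TU[OF that]]
    by (auto simp: \<eta>_def intro: order_trans)
  have Rcont: "((\<lambda>t. R t x) \<longlongrightarrow> x) (at_right 0)" if x: "x \<in> E" for x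
  proof -
    have pos: "((\<lambda>t. R t x) \<longlongrightarrow> x) (at_right 0)" if x: "x \<in> P" for x
    proof -
      have "norm (R s x - x) \<le> \<eta> x s" if "s \<ge> 0" for s
        using Lim_norm_ubound[OF _ tendsto_diff[OF Slim[OF that] tendsto_const]] \<eta>S[OF that x] x by auto
      then have "eventually (\<lambda>s. norm (R s x - x) \<le> \<eta> x s) (at_right 0)"
        by (auto simp: eventually_at_filter)
      from Lim_null_comparison[OF this \<eta>0] x show ?thesis by (auto intro: LIM_zero_cancel)
    qed
    obtain y z where yz: "y \<in> P" "z \<in> P" "x = y - z" using decompose[OF x] by blast
    have "((\<lambda>t. R t y - R t z) \<longlongrightarrow> y - z) (at_right 0)" by (intro tendsto_diff pos yz)
    moreover have "eventually (\<lambda>t. R t y - R t z = R t x) (at_right 0)"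
      using yz by (auto simp: eventually_at_filter bounded_op_diff[OF bopR])
    ultimately show ?thesis using Lim_transform_eventually yz(3) by fastforce
  qed
  show csgR: "c0_sg R"
    unfolding c0_sg_def
  proof (intro conjI allI ballI impI bopR Rcont)
    fix x assume x: "x \<in> E"
    show "R 0 x = x" using LIMSEQ_unique[OF Slim[of 0 x]] c0_sgD(2)[OF S(1) x] x by simp
  next
    fix s t :: real and x assume st: "s \<ge> 0" "t \<ge> 0" and x: "x \<in> E"
    obtain C where C: "\<And>k r x. r \<in> {0..s} \<Longrightarrow> x \<in> E \<Longrightarrow> norm (S k r x) \<le> C * norm x" using bS[of s] by blast
    have SE: "S k t x \<in> E" for k using c0_sgD(5)[OF S(1) st(2) x] .
    have "((\<lambda>k. C * norm (S k t x - R t x)) \<longlongrightarrow> C * 0) sequentially"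
      by (intro tendsto_mult tendsto_const tendsto_norm_zero LIM_zero Slim st x)
    moreover have "norm (S k s (S k t x) - S k s (R t x)) \<le> C * norm (S k t x - R t x)" for k
      using C[of s "S k t x - R t x" k] SE RE[OF st(2) x] st bounded_op_diff[OF c0_sgD(1)[OF S(1) st(1)]] by simp
    ultimately have "(\<lambda>k. S k s (S k t x) - S k s (R t x)) \<longlonglongrightarrow> 0"
      by (rule_tac Lim_null_comparison[where g="\<lambda>k. C * norm (S k t x - R t x)"]) auto
    from tendsto_add[OF this Slim[OF st(1) RE[OF st(2) x]]]
    have "(\<lambda>k. S k s (S k t x)) \<longlonglongrightarrow> R s (R t x)" by simp
    moreover have "(\<lambda>k. S k (s + t) x) \<longlonglongrightarrow> R (s + t) x" using st x by (intro Slim) auto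
    ultimately show "R (s + t) x = R s (R t x)" using LIMSEQ_unique c0_sgD(3)[OF S(1) st x] by simp
  qed
  show "tangent V B R"
    unfolding tangent_def
  proof
    fix x assume x: "x \<in> E"
    have pos: "((\<lambda>h. (R h x - V h x) /\<^sub>R h) \<longlongrightarrow> B x) (at_right 0)" if x: "x \<in> P" for x
    proof (rule tendstoI)
      fix e :: real assume e: "e > 0"
      have BP: "B x \<in> P" using pos_opD[OF B(2) x] .
      obtain C where C: "C \<ge> 0" "\<And>k r x. r \<in> {0..1} \<Longrightarrow> x \<in> E \<Longrightarrow> norm (T k r x) \<le> C * norm x" using bS[of 1] by blast
      obtain b where b: "b \<ge> 0" "\<And>x. x \<in> E \<Longrightarrow> norm (B x) \<le> b * norm x" using bounded_op_bound[OF B(1)] by blast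
      \<comment> \<open>\<open>q s\<close> bounds the error from \<open>S k s x\<close> in place of \<open>x\<close>, and \<open>\<eta> (B x)\<close> the one from \<open>T k\<close>, each by \<open>e/4\<close>.\<close>
      define q where "q s = C * b * \<eta> x s" for s
      have "((\<lambda>s. C * b * \<eta> x s) \<longlongrightarrow> C * b * 0) (at_right 0)"
        using x by (intro tendsto_intros \<eta>0) auto
      then have ql: "(q \<longlongrightarrow> 0) (at_right 0)" by (simp add: q_def[abs_def])
      have "eventually (\<lambda>s. q s < e/4) (at_right 0)" "eventually (\<lambda>s. \<eta> (B x) s < e/4) (at_right 0)"
        using order_tendstoD(2)[OF \<eta>0[of "B x"], of "e/4"] order_tendstoD(2)[OF ql, of "e/4"] BP e by auto
      then have "eventually (\<lambda>s. q s < e/4 \<and> \<eta> (B x) s < e/4) (at_right 0)" by eventually_elim auto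
      then obtain d where d: "d > 0" "\<And>s. 0 < s \<Longrightarrow> s < d \<Longrightarrow> q s < e/4 \<and> \<eta> (B x) s < e/4"
        unfolding eventually_at_right_field by blast
      have \<eta>00: "\<eta> y 0 = 0" if "y \<in> E" for y using c0_sgD(2)[OF U(1) that] c0_sgD(2)[OF V(1) that] by (simp add: \<eta>_def)
      have d': "q s \<le> e/4" "\<eta> (B x) s \<le> e/4" if "0 \<le> s" "s < d" for s
        using d(2)[of s] that \<eta>00[of x] \<eta>00[of "B x"] x BP e by (cases "s = 0"; auto simp: q_def)+
      have main: "norm ((S k h x - T k h x) /\<^sub>R h - B x) \<le> e / 2" if h: "h \<in> {0<..<min d 1}" for k h
      proof -
        have xE: "x \<in> E" and BE: "B x \<in> E" using x BP by auto
        have SE: "S k s x \<in> E" if "s \<ge> 0" for s using c0_sgD(5)[OF S(1) that xE] .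
        have "norm (integral {0..h} (\<lambda>s. T k (h - s) (B (S k s x))) /\<^sub>R h - B x) \<le> e / 2"
        proof (rule average_bound)
          show "continuous_on {0..h} (\<lambda>s. T k (h - s) (B (S k s x)))"
            using SE by (intro duhamel_continuous[OF T(1) B(1)]
                continuous_on_subset[OF c0_sg_continuous_orbit[OF S(1) xE]]) auto
          fix s assume s: "s \<in> {0..h}"
          have hs: "h - s \<ge> 0" "h - s \<in> {0..1}" "s \<ge> 0" using s h by auto
          have "T k (h - s) (B (S k s x)) - B x = T k (h - s) (B (S k s x - x)) + (T k (h - s) (B x) - B x)"
            using SE[OF hs(3)] xE BE B(1) by (simp add: bounded_op_diff[OF B(1)] bounded_op_diff[OF c0_sgD(1)[OF T(1) hs(1)]])
          also have "norm \<dots> \<le> norm (T k (h - s) (B (S k s x - x))) + norm (T k (h - s) (B x) - B x)"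
            by (rule norm_triangle_ineq)
          also have "norm (T k (h - s) (B (S k s x - x))) \<le> C * norm (B (S k s x - x))"
            using SE[OF hs(3)] xE B(1) by (intro C hs) auto
          also have "\<dots> \<le> C * (b * norm (S k s x - x))"
            using SE[OF hs(3)] xE C(1) by (intro mult_left_mono b) auto
          also have "\<dots> \<le> C * (b * \<eta> x s)"
            using C(1) b(1) by (intro mult_left_mono \<eta>S hs x) auto
          also have "\<dots> = q s" by (simp add: q_def)
          also have "q s \<le> e/4" using d'(1)[of s] s h by auto
          also have "norm (T k (h - s) (B x) - B x) \<le> \<eta> (B x) (h - s)" by (rule \<eta>T[OF hs(1) BP])
          also have "\<dots> \<le> e/4" using d'(2)[of "h - s"] s h by auto
          finally show "norm (T k (h - s) (B (S k s x)) - B x) \<le> e / 2" by simp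
        qed (use h in auto)
        moreover have "S k h x - T k h x = integral {0..h} (\<lambda>s. T k (h - s) (B (S k s x)))"
          using duhamel[OF T(1) S(1) B(1) tangent xE, of h k] h by simp
        ultimately show ?thesis by simp
      qed
      have "dist ((R h x - V h x) /\<^sub>R h) (B x) < e" if h: "h \<in> {0<..<min d 1}" for h
      proof -
        have "(\<lambda>k. (S k h x - T k h x) /\<^sub>R h - B x) \<longlonglongrightarrow> (R h x - V h x) /\<^sub>R h - B x"
          using h x by (intro tendsto_intros Slim Tlim) auto
        then have "norm ((R h x - V h x) /\<^sub>R h - B x) \<le> e / 2"
          by (rule Lim_norm_ubound[rotated]) (use main[OF h] in auto)
        then show ?thesis using e by (simp add: dist_norm)
      qed
      moreover have "eventually (\<lambda>h. h \<in> {0<..<min d 1}) (at_right 0)"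
        using d by (intro eventually_at_right_real) auto
      ultimately show "eventually (\<lambda>h. dist ((R h x - V h x) /\<^sub>R h) (B x) < e) (at_right 0)"
        by (auto elim: eventually_mono)
    qed
    obtain y z where yz: "y \<in> P" "z \<in> P" "x = y - z" using decompose[OF x] by blast
    have l: "((\<lambda>h. (R h y - V h y) /\<^sub>R h - (R h z - V h z) /\<^sub>R h) \<longlongrightarrow> B y - B z) (at_right 0)"
      by (intro tendsto_diff pos yz)
    have "(R h y - V h y) /\<^sub>R h - (R h z - V h z) /\<^sub>R h = (R h x - V h x) /\<^sub>R h" if h: "h > 0" for h
    proof -
      have "R h x = R h y - R h z" "V h x = V h y - V h z"
        using yz h by (simp_all add: bounded_op_diff[OF bopR] bounded_op_diff[OF c0_sgD(1)[OF V(1)]])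
      then show ?thesis by (simp add: scaleR_diff_right)
    qed
    then have ev: "eventually (\<lambda>h. (R h y - V h y) /\<^sub>R h - (R h z - V h z) /\<^sub>R h = (R h x - V h x) /\<^sub>R h) (at_right 0)"
      by (auto simp: eventually_at_filter)
    have "B x = B y - B z" using yz by (simp add: bounded_op_diff[OF B(1)])
    with Lim_transform_eventually[OF l ev] show "((\<lambda>h. (R h x - V h x) /\<^sub>R h) \<longlongrightarrow> B x) (at_right 0)"
      by (simp only:)
  qed
qed

end

section \<open>\<open>L\<^sub>p\<close> as a closed subspace of a space of bounded functions\<close>

lemma young_powr:
  fixes a b p :: real
  assumes p: "1 \<le> p" and ab: "0 \<le> a" "0 \<le> b"
  shows "a * b powr (p - 1) \<le> (1 / p) * a powr p + (1 - 1 / p) * b powr p"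
proof (cases "a = 0 \<or> b = 0")
  case True
  moreover have "0 \<le> (1 / p) * a powr p + (1 - 1 / p) * b powr p"
    using p by (intro add_nonneg_nonneg mult_nonneg_nonneg) auto
  ultimately show ?thesis by auto
next
  case False
  then have pos: "a powr p > 0" "b powr p > 0" "a > 0" "b > 0" using ab by auto
  have "(a powr p) powr (1 / p) * (b powr p) powr (1 - 1 / p) \<le> (1 / p) * a powr p + (1 - 1 / p) * b powr p"
    using p pos by (intro Youngs_inequality_0) auto
  moreover have "p * (1 - 1 / p) = p - 1" using p by (simp add: field_simps)
  ultimately show ?thesis using p pos by (simp add: powr_powr)
qed

type_synonym 'a ambient = "('a \<Rightarrow> real) discrete \<Rightarrow>\<^sub>C real"

locale lp_space =
  fixes M :: "'a measure" and p :: real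
  assumes p: "1 \<le> p"
begin

abbreviation "L \<equiv> Lp_set M p"
abbreviation "N \<equiv> Lp_norm M p"

lemma L_measurable [measurable_dest]: "f \<in> L \<Longrightarrow> f \<in> borel_measurable M" by (simp add: Lp_set_def)
lemma L_integrable: "f \<in> L \<Longrightarrow> integrable M (\<lambda>x. \<bar>f x\<bar> powr p)" by (simp add: Lp_set_def)

lemma L_dominated:
  assumes "f \<in> borel_measurable M" "g \<in> L" "AE x in M. \<bar>f x\<bar> \<le> \<bar>g x\<bar>"
  shows "f \<in> L"
proof -
  have "integrable M (\<lambda>x. \<bar>f x\<bar> powr p)"
  proof (rule Bochner_Integration.integrable_bound[OF L_integrable[OF assms(2)]])
    show "(\<lambda>x. \<bar>f x\<bar> powr p) \<in> borel_measurable M" using assms(1) by measurable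
    show "AE x in M. norm (\<bar>f x\<bar> powr p) \<le> norm (\<bar>g x\<bar> powr p)"
      using assms(3) by eventually_elim (use p in \<open>auto intro: powr_mono2\<close>)
  qed
  then show ?thesis using assms(1) by (simp add: Lp_set_def)
qed

lemma L_scale: assumes f: "f \<in> L" shows "(\<lambda>x. a * f x) \<in> L"
proof -
  have [measurable]: "f \<in> borel_measurable M" using f by (rule L_measurable)
  have "integrable M (\<lambda>x. \<bar>a\<bar> powr p * \<bar>f x\<bar> powr p)" using L_integrable[OF f] by simp
  then have "integrable M (\<lambda>x. \<bar>a * f x\<bar> powr p)" by (simp add: abs_mult powr_mult)
  then show ?thesis by (simp add: Lp_set_def)
qed

lemma L_add:
  assumes f: "f \<in> L" and g: "g \<in> L"
  shows "(\<lambda>x. f x + g x) \<in> L"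
proof -
  have [measurable]: "f \<in> borel_measurable M" "g \<in> borel_measurable M" using f g by (auto intro: L_measurable)
  have "integrable M (\<lambda>x. \<bar>f x + g x\<bar> powr p)"
  proof (rule Bochner_Integration.integrable_bound)
    show "integrable M (\<lambda>x. 2 powr p * (\<bar>f x\<bar> powr p + \<bar>g x\<bar> powr p))"
      using L_integrable[OF f] L_integrable[OF g] by auto
    show "AE x in M. norm (\<bar>f x + g x\<bar> powr p) \<le> norm (2 powr p * (\<bar>f x\<bar> powr p + \<bar>g x\<bar> powr p))"
    proof (rule AE_I2)
      fix x
      have "\<bar>f x + g x\<bar> powr p \<le> (2 * max \<bar>f x\<bar> \<bar>g x\<bar>) powr p" using p by (intro powr_mono2) auto
      also have "\<dots> = 2 powr p * max \<bar>f x\<bar> \<bar>g x\<bar> powr p" by (simp add: powr_mult)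
      also have "\<dots> \<le> 2 powr p * (\<bar>f x\<bar> powr p + \<bar>g x\<bar> powr p)" by (intro mult_left_mono) (auto simp: max_def)
      finally show "norm (\<bar>f x + g x\<bar> powr p) \<le> norm (2 powr p * (\<bar>f x\<bar> powr p + \<bar>g x\<bar> powr p))" by simp
    qed
  qed measurable
  then show ?thesis by (simp add: Lp_set_def)
qed

lemma L_zero: "(\<lambda>x. 0) \<in> L" by (simp add: Lp_set_def)
lemma L_lincomb: "f \<in> L \<Longrightarrow> g \<in> L \<Longrightarrow> (\<lambda>x. a * f x + b * g x) \<in> L" by (intro L_add L_scale)
lemma L_diff: "f \<in> L \<Longrightarrow> g \<in> L \<Longrightarrow> (\<lambda>x. f x - g x) \<in> L" using L_lincomb[of f g 1 "-1"] by simp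
lemma L_abs: "f \<in> L \<Longrightarrow> (\<lambda>x. \<bar>f x\<bar>) \<in> L" by (auto simp: Lp_set_def)
lemma L_sum: "finite I \<Longrightarrow> (\<And>i. i \<in> I \<Longrightarrow> f i \<in> L) \<Longrightarrow> (\<lambda>x. \<Sum>i\<in>I. f i x) \<in> L"
  by (induction I rule: finite_induct) (auto intro: L_zero L_add)

lemma N_nonneg: "N f \<ge> 0" by (simp add: Lp_norm_def)
lemma N_powr: "f \<in> L \<Longrightarrow> N f powr p = (\<integral>x. \<bar>f x\<bar> powr p \<partial>M)"
  using p by (simp add: Lp_norm_def powr_powr)
lemma N_zero_iff: "f \<in> L \<Longrightarrow> N f = 0 \<longleftrightarrow> (AE x in M. f x = 0)"
  using integral_nonneg_eq_0_iff_AE[OF L_integrable[of f]] by (simp add: Lp_norm_def)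
lemma N_mono:
  assumes f: "f \<in> L" and g: "g \<in> L" and le: "AE x in M. \<bar>f x\<bar> \<le> \<bar>g x\<bar>"
  shows "N f \<le> N g"
  unfolding Lp_norm_def
proof (rule powr_mono2)
  have "AE x in M. \<bar>f x\<bar> powr p \<le> \<bar>g x\<bar> powr p"
    using le by eventually_elim (use p in \<open>auto intro: powr_mono2\<close>)
  then show "(\<integral>x. \<bar>f x\<bar> powr p \<partial>M) \<le> (\<integral>x. \<bar>g x\<bar> powr p \<partial>M)"
    by (intro integral_mono_AE L_integrable f g)
qed (use p in auto)

text \<open>
  The unit ball of the dual space, described by its action on \<open>L\<^sub>p\<close> so that \<open>p = 1\<close> and \<open>p > 1\<close> are
  treated alike.
\<close>

definition dual_ball :: "('a \<Rightarrow> real) set" where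
  "dual_ball = {g \<in> borel_measurable M.
     \<forall>f\<in>L. integrable M (\<lambda>x. f x * g x) \<and> \<bar>\<integral>x. f x * g x \<partial>M\<bar> \<le> N f}"

text \<open>
  An element \<open>f\<close> of \<open>L\<^sub>p\<close> is viewed as the bounded function \<open>g \<mapsto> \<integral> f g\<close> on the dual unit ball, continued by \<open>0\<close>.
  The discrete copy of \<open>'a \<Rightarrow> real\<close> turns bounded functions into bounded continuous ones.
\<close>

definition emb :: "('a \<Rightarrow> real) \<Rightarrow> 'a ambient" where
  "emb f = Bcontfun (\<lambda>d. if of_discrete d \<in> dual_ball then \<integral>x. f x * of_discrete d x \<partial>M else 0)"

lemma apply_emb:
  assumes f: "f \<in> L"
  shows "apply_bcontfun (emb f) d = (if of_discrete d \<in> dual_ball then \<integral>x. f x * of_discrete d x \<partial>M else 0)"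
proof -
  have "(\<lambda>d. if of_discrete d \<in> dual_ball then \<integral>x. f x * of_discrete d x \<partial>M else 0) \<in> bcontfun"
    by (rule bcontfun_normI[where b="N f"])
      (use f in \<open>auto simp: continuous_on_open_invariant open_discrete dual_ball_def N_nonneg\<close>)
  then show ?thesis by (simp add: emb_def Bcontfun_inverse)
qed

lemma emb_lincomb:
  assumes f: "f \<in> L" and g: "g \<in> L"
  shows "emb (\<lambda>x. a * f x + b * g x) = a *\<^sub>R emb f + b *\<^sub>R emb g"
proof (rule bcontfun_eqI)
  fix d
  show "apply_bcontfun (emb (\<lambda>x. a * f x + b * g x)) d = apply_bcontfun (a *\<^sub>R emb f + b *\<^sub>R emb g) d"
  proof (cases "of_discrete d \<in> dual_ball")
    case True
    then have i: "integrable M (\<lambda>x. f x * of_discrete d x)" "integrable M (\<lambda>x. g x * of_discrete d x)"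
      using f g by (auto simp: dual_ball_def)
    have "(\<integral>x. (a * f x + b * g x) * of_discrete d x \<partial>M)
        = (\<integral>x. a * (f x * of_discrete d x) + b * (g x * of_discrete d x) \<partial>M)"
      by (simp add: algebra_simps)
    also have "\<dots> = a * (\<integral>x. f x * of_discrete d x \<partial>M) + b * (\<integral>x. g x * of_discrete d x \<partial>M)"
      using i by simp
    finally show ?thesis using True by (simp add: apply_emb f g L_lincomb)
  qed (simp add: apply_emb f g L_lincomb)
qed

text \<open>
  The functional that attains the norm of \<open>f\<close>. It belongs to the dual ball by Hoelder's inequality, obtained from
  Young's inequality for \<open>|h|/\<parallel>h\<parallel>\<close> and \<open>|f|/\<parallel>f\<parallel>\<close>. For \<open>p = 1\<close> the exponent \<open>p - 1\<close> is \<open>0\<close> and \<open>g\<close> is the sign of \<open>f\<close>, with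
  \<open>0 powr 0 = 0\<close> as it should be.
\<close>

lemma extremal_in_dual_ball:
  assumes f: "f \<in> L" and N0: "N f > 0"
  defines "g \<equiv> \<lambda>x. sgn (f x) * (\<bar>f x\<bar> / N f) powr (p - 1)"
  shows "g \<in> dual_ball" "(\<integral>x. f x * g x \<partial>M) = N f"
proof -
  have [measurable]: "f \<in> borel_measurable M" using f by (rule L_measurable)
  have gm [measurable]: "g \<in> borel_measurable M" unfolding g_def by measurable
  have fN: "(\<integral>x. (\<bar>f x\<bar> / N f) powr p \<partial>M) = 1" if "f \<in> L" "N f > 0" for f
  proof -
    have "(\<integral>x. (\<bar>f x\<bar> / N f) powr p \<partial>M) = (\<integral>x. \<bar>f x\<bar> powr p / N f powr p \<partial>M)"
      using that by (simp add: powr_divide)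
    also have "\<dots> = N f powr p / N f powr p" using N_powr[OF that(1)] by simp
    also have "\<dots> = 1" using that by simp
    finally show ?thesis .
  qed
  have fi: "integrable M (\<lambda>x. (\<bar>f x\<bar> / N f) powr p)" if "f \<in> L" "N f > 0" for f
    using that L_integrable[of f] by (simp add: powr_divide)
  have "integrable M (\<lambda>x. h x * g x) \<and> \<bar>\<integral>x. h x * g x \<partial>M\<bar> \<le> N h" if h: "h \<in> L" for h
  proof (cases "N h = 0")
    case True
    then have "AE x in M. h x * g x = 0" using N_zero_iff[OF h] by auto
    moreover have [measurable]: "h \<in> borel_measurable M" using h by (rule L_measurable)
    ultimately have "integrable M (\<lambda>x. h x * g x)" "(\<integral>x. h x * g x \<partial>M) = 0"
      using integrable_cong_AE[of "\<lambda>x. h x * g x" M "\<lambda>x. 0"] integral_cong_AE[of "\<lambda>x. h x * g x" M "\<lambda>x. 0"] by auto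
    then show ?thesis using True by simp
  next
    case False
    then have H: "N h > 0" using N_nonneg[of h] by simp
    have [measurable]: "h \<in> borel_measurable M" using h by (rule L_measurable)
    define w where "w x = N h * ((1 / p) * (\<bar>h x\<bar> / N h) powr p + (1 - 1 / p) * (\<bar>f x\<bar> / N f) powr p)" for x
    have wi: "integrable M w" unfolding w_def using fi[OF h H] fi[OF f N0] by auto
    have wI: "(\<integral>x. w x \<partial>M) = N h"
      unfolding w_def using fi[OF h H] fi[OF f N0] fN[OF h H] fN[OF f N0] by simp
    have bd: "\<bar>h x * g x\<bar> \<le> w x" for x
    proof -
      have "\<bar>h x * g x\<bar> \<le> \<bar>h x\<bar> * (\<bar>f x\<bar> / N f) powr (p - 1)"
        by (auto simp: g_def abs_mult sgn_if)
      also have "\<dots> = N h * ((\<bar>h x\<bar> / N h) * (\<bar>f x\<bar> / N f) powr (p - 1))" using H by simp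
      also have "\<dots> \<le> w x" unfolding w_def
        using H N0 p by (intro mult_left_mono young_powr) auto
      finally show ?thesis .
    qed
    have i: "integrable M (\<lambda>x. h x * g x)"
    proof (rule Bochner_Integration.integrable_bound[OF wi])
      show "AE x in M. norm (h x * g x) \<le> norm (w x)"
        by (rule AE_I2) (simp only: real_norm_def order_trans[OF bd abs_ge_self])
    qed measurable
    have "\<bar>\<integral>x. h x * g x \<partial>M\<bar> \<le> (\<integral>x. \<bar>h x * g x\<bar> \<partial>M)" by (rule integral_abs_bound)
    also have "\<dots> \<le> (\<integral>x. w x \<partial>M)" using i wi bd by (intro integral_mono) auto
    finally show ?thesis using i wI by simp
  qed
  then show "g \<in> dual_ball" using gm by (auto simp: dual_ball_def)
  have "f x * g x = \<bar>f x\<bar> powr p * N f powr (1 - p)" for x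
  proof (cases "f x = 0")
    case False
    have "f x * g x = \<bar>f x\<bar> * \<bar>f x\<bar> powr (p - 1) / N f powr (p - 1)"
      using N0 by (simp add: g_def powr_divide abs_sgn mult_ac)
    also have "\<bar>f x\<bar> * \<bar>f x\<bar> powr (p - 1) = \<bar>f x\<bar> powr p"
      using False powr_add[of "\<bar>f x\<bar>" 1 "p - 1"] by simp
    also have "\<bar>f x\<bar> powr p / N f powr (p - 1) = \<bar>f x\<bar> powr p * N f powr (1 - p)"
      using powr_minus_divide[of "N f" "p - 1"] by simp
    finally show ?thesis .
  qed simp
  then have "(\<integral>x. f x * g x \<partial>M) = N f powr p * N f powr (1 - p)"
    using N_powr[OF f] by simp
  also have "\<dots> = N f" using N0 by (simp flip: powr_add)
  finally show "(\<integral>x. f x * g x \<partial>M) = N f" .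
qed

lemma norm_emb:
  assumes f: "f \<in> L" shows "norm (emb f) = N f"
proof (rule antisym)
  show "norm (emb f) \<le> N f"
    by (rule norm_bound) (use f in \<open>auto simp: apply_emb dual_ball_def N_nonneg\<close>)
  show "N f \<le> norm (emb f)"
  proof (cases "N f = 0")
    case False
    then have N0: "N f > 0" using N_nonneg[of f] by simp
    let ?g = "\<lambda>x. sgn (f x) * (\<bar>f x\<bar> / N f) powr (p - 1)"
    have "apply_bcontfun (emb f) (discrete ?g) = N f"
      using extremal_in_dual_ball[OF f N0] by (simp add: apply_emb f discrete_inverse)
    then show ?thesis using norm_bounded[of "emb f" "discrete ?g"] by simp
  qed simp
qed

lemma emb_add: "f \<in> L \<Longrightarrow> g \<in> L \<Longrightarrow> emb (\<lambda>x. f x + g x) = emb f + emb g"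
  using emb_lincomb[of f g 1 1] by simp
lemma emb_diff: "f \<in> L \<Longrightarrow> g \<in> L \<Longrightarrow> emb (\<lambda>x. f x - g x) = emb f - emb g"
  using emb_lincomb[of f g 1 "-1"] by simp
lemma emb_scale: "f \<in> L \<Longrightarrow> emb (\<lambda>x. a * f x) = a *\<^sub>R emb f"
  using emb_lincomb[of f f a 0] by simp
lemma emb_zero: "emb (\<lambda>x. 0) = 0"
  using emb_scale[OF L_zero, of 0] by simp
lemma emb_eq_iff:
  assumes f: "f \<in> L" and g: "g \<in> L"
  shows "emb f = emb g \<longleftrightarrow> (AE x in M. f x = g x)"
proof -
  have "emb f = emb g \<longleftrightarrow> norm (emb (\<lambda>x. f x - g x)) = 0" by (simp add: emb_diff f g)
  also have "\<dots> \<longleftrightarrow> (AE x in M. f x - g x = 0)" by (simp only: norm_emb[OF L_diff[OF f g]] N_zero_iff[OF L_diff[OF f g]])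
  finally show ?thesis by simp
qed

definition E :: "'a ambient set" where "E = emb ` L"
definition P :: "'a ambient set" where "P = emb ` {f \<in> L. AE x in M. 0 \<le> f x}"
definition rep :: "'a ambient \<Rightarrow> 'a \<Rightarrow> real" where
  "rep y = (SOME f. f \<in> L \<and> emb f = y)"

lemma emb_in_E [simp, intro]: "f \<in> L \<Longrightarrow> emb f \<in> E" by (simp add: E_def)
lemma rep: assumes "y \<in> E" shows "rep y \<in> L" "emb (rep y) = y"
proof -
  have "\<exists>f. f \<in> L \<and> emb f = y" using assms by (auto simp: E_def)
  from someI_ex[OF this] show "rep y \<in> L" "emb (rep y) = y" by (auto simp: rep_def)
qed
lemma rep_emb_AE: "f \<in> L \<Longrightarrow> AE x in M. rep (emb f) x = f x"
  using rep[of "emb f"] emb_eq_iff[of "rep (emb f)" f] by auto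

lemma emb_in_P_iff: assumes f: "f \<in> L" shows "emb f \<in> P \<longleftrightarrow> (AE x in M. 0 \<le> f x)"
proof
  assume "emb f \<in> P"
  then obtain g where g: "g \<in> L" "AE x in M. 0 \<le> g x" "emb f = emb g" by (auto simp: P_def)
  have "AE x in M. f x = g x" using emb_eq_iff[OF f g(1)] g(3) by simp
  then show "AE x in M. 0 \<le> f x" using g(2) by eventually_elim simp
qed (use f in \<open>auto simp: P_def\<close>)

lemma P_subset_E: "P \<subseteq> E" by (auto simp: P_def)

lemma tendsto_emb_dominated:
  assumes f: "\<And>n. f n \<in> L" and g: "g \<in> L" and h: "h \<in> borel_measurable M"
    and dom: "\<And>n. AE x in M. \<bar>f n x\<bar> \<le> g x" and lim: "AE x in M. (\<lambda>n. f n x) \<longlonglongrightarrow> h x"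
  shows "h \<in> L" "(\<lambda>n. emb (f n)) \<longlonglongrightarrow> emb h"
proof -
  have [measurable]: "h \<in> borel_measurable M" "g \<in> borel_measurable M" by (auto intro: L_measurable h g)
  have [measurable]: "f n \<in> borel_measurable M" for n using f by (rule L_measurable)
  have domA: "AE x in M. \<forall>n. \<bar>f n x\<bar> \<le> g x" using dom by (simp add: AE_all_countable)
  have hg: "AE x in M. \<bar>h x\<bar> \<le> g x"
    using domA lim
  proof eventually_elim
    case (elim x)
    show ?case by (rule LIMSEQ_le_const2[OF tendsto_rabs[OF elim(2)]]) (use elim(1) in auto)
  qed
  then have "AE x in M. \<bar>h x\<bar> \<le> \<bar>g x\<bar>" by eventually_elim auto
  then show hL: "h \<in> L" by (rule L_dominated[OF h g])
  have "(\<lambda>n. \<integral>x. \<bar>f n x - h x\<bar> powr p \<partial>M) \<longlonglongrightarrow> (\<integral>x. 0 \<partial>M)"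
  proof (rule integral_dominated_convergence)
    show "integrable M (\<lambda>x. \<bar>2 * g x\<bar> powr p)" by (rule L_integrable[OF L_scale[OF g]])
    show "AE x in M. (\<lambda>n. \<bar>f n x - h x\<bar> powr p) \<longlonglongrightarrow> 0"
      using lim
    proof eventually_elim
      case (elim x)
      have "(\<lambda>n. \<bar>f n x - h x\<bar>) \<longlonglongrightarrow> 0" using elim by (intro tendsto_rabs_zero LIM_zero)
      then show ?case using p by (intro tendsto_zero_powrI[where b=p]) auto
    qed
    show "AE x in M. norm (\<bar>f n x - h x\<bar> powr p) \<le> \<bar>2 * g x\<bar> powr p" for n
      using hg domA
    proof eventually_elim
      case (elim x)
      have "\<bar>f n x - h x\<bar> \<le> \<bar>2 * g x\<bar>" using elim(1) elim(2)[rule_format, of n] by linarith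
      then show ?case using p by (auto intro: powr_mono2)
    qed
  qed measurable
  then have "(\<lambda>n. N (\<lambda>x. f n x - h x)) \<longlonglongrightarrow> 0"
    unfolding Lp_norm_def using p by (intro tendsto_zero_powrI[where b="1/p"]) auto
  then have "(\<lambda>n. norm (emb (f n) - emb h)) \<longlonglongrightarrow> 0"
    using f hL by (simp add: norm_emb L_diff flip: emb_diff)
  then show "(\<lambda>n. emb (f n)) \<longlonglongrightarrow> emb h" by (rule LIM_zero_cancel[OF tendsto_norm_zero_cancel])
qed

lemma norm_emb_sum: "finite I \<Longrightarrow> (\<And>i. i \<in> I \<Longrightarrow> f i \<in> L) \<Longrightarrow> N (\<lambda>x. \<Sum>i\<in>I. f i x) \<le> (\<Sum>i\<in>I. N (f i))"
proof (induction I rule: finite_induct)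
  case (insert i I)
  have s: "(\<lambda>x. \<Sum>i\<in>I. f i x) \<in> L" using insert by (intro L_sum) auto
  have "N (\<lambda>x. f i x + (\<Sum>i\<in>I. f i x)) = norm (emb (f i) + emb (\<lambda>x. \<Sum>i\<in>I. f i x))"
    using insert s by (simp add: L_add flip: emb_add norm_emb)
  also have "\<dots> \<le> N (f i) + N (\<lambda>x. \<Sum>i\<in>I. f i x)"
    using norm_triangle_ineq[of "emb (f i)" "emb (\<lambda>x. \<Sum>i\<in>I. f i x)"] insert s by (simp add: norm_emb)
  finally show ?case using insert by force
qed (use N_zero_iff[OF L_zero] in simp)

text \<open>
  By Minkowski's inequality, here the triangle inequality in the ambient space, the partial sums of \<open>\<Sum> |d\<^sub>n|\<close> have bounded
  norm; monotone convergence for their \<open>p\<close>-th powers makes the sum finite almost everywhere and \<open>p\<close>-integrable.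
\<close>

lemma summable_in_L:
  assumes d: "\<And>n. d n \<in> L" and s: "summable (\<lambda>n. N (d n))"
  shows "AE x in M. summable (\<lambda>n. \<bar>d n x\<bar>)" "(\<lambda>x. \<Sum>n. \<bar>d n x\<bar>) \<in> L"
proof -
  have [measurable]: "d n \<in> borel_measurable M" for n using d by (rule L_measurable)
  define G where "G k x = (\<Sum>n<k. \<bar>d n x\<bar>)" for k x
  have GL: "G k \<in> L" for k unfolding G_def by (intro L_sum L_abs d) auto
  have [measurable]: "G k \<in> borel_measurable M" for k using GL by (rule L_measurable)
  have G0: "G k x \<ge> 0" for k x by (simp add: G_def sum_nonneg)
  have Gmono: "G k x \<le> G (Suc k) x" for k x by (simp add: G_def)
  define c where "c = (\<Sum>n. N (d n))"
  have Nabs: "N (\<lambda>x. \<bar>d n x\<bar>) = N (d n)" for n by (simp add: Lp_norm_def)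
  have NG: "N (G k) \<le> c" for k
  proof -
    have "N (G k) \<le> (\<Sum>n<k. N (\<lambda>x. \<bar>d n x\<bar>))" unfolding G_def by (intro norm_emb_sum L_abs d) auto
    also have "\<dots> \<le> c" unfolding c_def Nabs using N_nonneg by (intro sum_le_suminf s) auto
    finally show ?thesis .
  qed
  have nn: "(\<integral>\<^sup>+x. ennreal (G k x powr p) \<partial>M) \<le> ennreal (c powr p)" for k
  proof -
    have "(\<integral>\<^sup>+x. ennreal (G k x powr p) \<partial>M) = ennreal (\<integral>x. \<bar>G k x\<bar> powr p \<partial>M)"
      using nn_integral_eq_integral[OF L_integrable[OF GL]] G0 by simp
    also have "\<dots> = ennreal (N (G k) powr p)" using N_powr[OF GL] by simp
    also have "\<dots> \<le> ennreal (c powr p)" using NG N_nonneg p by (intro ennreal_leI powr_mono2) auto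
    finally show ?thesis .
  qed
  have inc: "incseq (\<lambda>k x. ennreal (G k x powr p))"
    by (intro incseq_SucI le_funI ennreal_leI powr_mono2 Gmono) (use p G0 in auto)
  have SUPle: "(\<integral>\<^sup>+x. (SUP k. ennreal (G k x powr p)) \<partial>M) \<le> ennreal (c powr p)"
    by (subst nn_integral_monotone_convergence_SUP[OF inc]) (auto intro: SUP_least nn)
  then have "(\<integral>\<^sup>+x. (SUP k. ennreal (G k x powr p)) \<partial>M) \<noteq> \<infinity>" by (auto simp: top_unique)
  then have fin: "AE x in M. (SUP k. ennreal (G k x powr p)) \<noteq> \<infinity>"
    by (intro nn_integral_PInf_AE) auto
  show sm: "AE x in M. summable (\<lambda>n. \<bar>d n x\<bar>)"
    using fin
  proof eventually_elim
    case (elim x)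
    then obtain r where r: "r \<ge> 0" "(SUP k. ennreal (G k x powr p)) = ennreal r"
      by (cases "SUP k. ennreal (G k x powr p)") auto
    have "G k x \<le> r powr (1 / p)" for k
    proof -
      have "ennreal (G k x powr p) \<le> ennreal r" unfolding r(2)[symmetric] by (rule SUP_upper) simp
      then have "G k x powr p \<le> r" using r(1) by simp
      then have "(G k x powr p) powr (1 / p) \<le> r powr (1 / p)" using p by (intro powr_mono2) auto
      then show ?thesis using G0[of k x] p by (simp add: powr_powr)
    qed
    then show ?case by (intro summableI_nonneg_bounded[where x="r powr (1 / p)"]) (auto simp: G_def)
  qed
  let ?s = "\<lambda>x. \<Sum>n. \<bar>d n x\<bar>"
  have [measurable]: "?s \<in> borel_measurable M" by measurable
  have "(\<integral>\<^sup>+x. ennreal (norm (\<bar>?s x\<bar> powr p)) \<partial>M) \<le> (\<integral>\<^sup>+x. (SUP k. ennreal (G k x powr p)) \<partial>M)"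
  proof (rule nn_integral_mono_AE)
    show "AE x in M. ennreal (norm (\<bar>?s x\<bar> powr p)) \<le> (SUP k. ennreal (G k x powr p))"
      using sm
    proof eventually_elim
      case (elim x)
      have s0: "?s x \<ge> 0" using elim by (intro suminf_nonneg) auto
      have "(\<lambda>k. G k x) \<longlonglongrightarrow> ?s x" unfolding G_def by (rule summable_LIMSEQ[OF elim])
      then have "(\<lambda>k. G k x powr p) \<longlonglongrightarrow> ?s x powr p"
        using p G0 by (intro tendsto_powr2) auto
      then have "(\<lambda>k. ennreal (G k x powr p)) \<longlonglongrightarrow> ennreal (?s x powr p)" by (rule tendsto_ennrealI)
      then have "ennreal (?s x powr p) \<le> (SUP k. ennreal (G k x powr p))"
        by (rule LIMSEQ_le_const2) (rule exI[of _ 0], intro allI impI SUP_upper UNIV_I)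
      then show ?case using s0 by simp
    qed
  qed
  also have "\<dots> < \<infinity>" using SUPle by (rule le_less_trans) simp
  finally have "integrable M (\<lambda>x. \<bar>?s x\<bar> powr p)" by (intro integrableI_bounded) auto
  then show "?s \<in> L" by (simp add: Lp_set_def)
qed

text \<open>
  Completeness of \<open>L\<^sub>p\<close>: a rapidly converging subsequence is a telescoping series that converges absolutely almost
  everywhere and is dominated in \<open>L\<^sub>p\<close>.
\<close>

lemma closed_E': "closed E"
  unfolding closed_sequential_limits
proof (intro allI impI, elim conjE)
  fix X x assume XE: "\<forall>n. X n \<in> E" and X: "X \<longlonglongrightarrow> x"
  have C: "Cauchy X" using X by (intro LIMSEQ_imp_Cauchy)
  have "\<exists>r. strict_mono r \<and> (\<forall>n. norm (X (r (Suc n)) - X (r n)) < (1/2) ^ n)"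
  proof -
    have "\<forall>n. \<exists>K. \<forall>m\<ge>K. \<forall>k\<ge>K. norm (X m - X k) < (1/2) ^ n"
      using C unfolding Cauchy_iff by simp
    then obtain K where K: "\<And>n m k. m \<ge> K n \<Longrightarrow> k \<ge> K n \<Longrightarrow> norm (X m - X k) < (1/2) ^ n" by metis
    \<comment> \<open>Each index lies beyond the previous one and beyond the Cauchy threshold for its own tolerance.\<close>
    define r where "r = rec_nat (K 0) (\<lambda>n a. Suc (max a (K (Suc n))))"
    have r0: "r 0 = K 0" and rS: "r (Suc n) = Suc (max (r n) (K (Suc n)))" for n by (auto simp: r_def)
    have "strict_mono r" by (auto simp: strict_mono_Suc_iff rS)
    moreover have rK: "r n \<ge> K n" for n by (cases n) (auto simp: r0 rS)
    moreover have "norm (X (r (Suc n)) - X (r n)) < (1/2) ^ n" for n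
      by (rule K) (use rK[of n] in \<open>auto simp: rS\<close>)
    ultimately show ?thesis by blast
  qed
  then obtain r where r: "strict_mono r" "\<And>n. norm (X (r (Suc n)) - X (r n)) < (1/2) ^ n" by blast
  define f where "f n = rep (X (r n))" for n
  have fL: "f n \<in> L" and fX: "emb (f n) = X (r n)" for n using rep XE by (auto simp: f_def)
  define d where "d n x = f (Suc n) x - f n x" for n x
  have dL: "d n \<in> L" for n unfolding d_def by (intro L_diff fL)
  have "N (d n) < (1/2) ^ n" for n
    using r(2)[of n] norm_emb[OF dL[of n]] unfolding fX[symmetric]
    by (simp add: d_def[abs_def] fL flip: emb_diff)
  then have "summable (\<lambda>n. N (d n))"
    by (intro summable_comparison_test[OF _ summable_geometric[of "1/2::real"]]) (auto simp: N_nonneg intro!: exI[of _ 0] less_imp_le)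
  from summable_in_L[OF dL this] have sm: "AE x in M. summable (\<lambda>n. \<bar>d n x\<bar>)" and sL: "(\<lambda>x. \<Sum>n. \<bar>d n x\<bar>) \<in> L" by auto
  define g where "g x = \<bar>f 0 x\<bar> + (\<Sum>n. \<bar>d n x\<bar>)" for x
  have gL: "g \<in> L" unfolding g_def by (intro L_add L_abs fL sL)
  define h where "h x = lim (\<lambda>n. f n x)" for x
  have [measurable]: "f n \<in> borel_measurable M" for n using fL by (rule L_measurable)
  have hm: "h \<in> borel_measurable M" unfolding h_def by measurable
  have tel: "f n x = f 0 x + (\<Sum>i<n. d i x)" for n x
    using sum_lessThan_telescope[of "\<lambda>i. f i x" n] by (simp add: d_def)
  have "AE x in M. \<bar>f n x\<bar> \<le> g x" for n
    using sm
  proof eventually_elim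
    case (elim x)
    have "\<bar>\<Sum>i<n. d i x\<bar> \<le> (\<Sum>i<n. \<bar>d i x\<bar>)" by (rule sum_abs)
    also have "\<dots> \<le> (\<Sum>i. \<bar>d i x\<bar>)" using elim by (intro sum_le_suminf) auto
    finally show ?case unfolding tel[of n] g_def by linarith
  qed
  moreover have "AE x in M. (\<lambda>n. f n x) \<longlonglongrightarrow> h x"
    using sm
  proof eventually_elim
    case (elim x)
    have "(\<lambda>n. f 0 x + (\<Sum>i<n. d i x)) \<longlonglongrightarrow> f 0 x + (\<Sum>i. d i x)"
      using elim by (intro tendsto_intros summable_LIMSEQ) (rule summable_rabs_cancel)
    then show ?case unfolding h_def tel[symmetric] by (simp add: limI)
  qed
  ultimately have "h \<in> L" "(\<lambda>n. emb (f n)) \<longlonglongrightarrow> emb h" by (rule tendsto_emb_dominated[OF fL gL hm])+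
  moreover have "(\<lambda>n. emb (f n)) \<longlonglongrightarrow> x"
    unfolding fX using LIMSEQ_subseq_LIMSEQ[OF X r(1)] by (simp add: o_def)
  ultimately have "x = emb h" by (intro LIMSEQ_unique)
  then show "x \<in> E" using \<open>h \<in> L\<close> by simp
qed

lemma subspace_E': "subspace E"
  unfolding subspace_def
proof (intro conjI ballI allI)
  show "0 \<in> E" using emb_in_E[OF L_zero] by (simp add: emb_zero)
  show "x + y \<in> E" if "x \<in> E" "y \<in> E" for x y
    using that emb_in_E[OF L_add] by (auto simp: E_def simp flip: emb_add)
  show "c *\<^sub>R x \<in> E" if "x \<in> E" for c x
    using that L_scale by (auto simp: E_def simp flip: emb_scale)
qed

end

instance bcontfun :: (metric_space, banach) banach ..

sublocale lp_space \<subseteq> closed_subspace E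
  by unfold_locales (rule closed_E' subspace_E')+

section \<open>Order, multiplication operators and semigroups on \<open>L\<^sub>p\<close>\<close>

context lp_space begin

lemma P_E_rep: assumes "y \<in> P" obtains f where "f \<in> L" "AE x in M. 0 \<le> f x" "y = emb f"
  using assms by (auto simp: P_def)

text \<open>
  Closedness: if \<open>f\<close> is the limit of positive \<open>g\<close>, its negative part satisfies \<open>|min f 0| \<le> |g - f|\<close> and so has norm \<open>0\<close>.
\<close>

lemma closed_cone_P: "closed_cone P"
  unfolding closed_cone_def
proof (intro conjI ballI allI impI)
  show "0 \<in> P" using emb_in_P_iff[OF L_zero] by (simp add: emb_zero)
  show "x + y \<in> P" if xy: "x \<in> P" "y \<in> P" for x y
  proof -
    obtain f where f: "f \<in> L" "AE x in M. 0 \<le> f x" "x = emb f" using P_E_rep[OF xy(1)] .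
    obtain g where g: "g \<in> L" "AE x in M. 0 \<le> g x" "y = emb g" using P_E_rep[OF xy(2)] .
    have "AE x in M. 0 \<le> f x + g x" using f(2) g(2) by eventually_elim simp
    then show ?thesis using emb_in_P_iff[OF L_add[OF f(1) g(1)]] f g by (simp add: emb_add)
  qed
  show "c *\<^sub>R x \<in> P" if xy: "c \<ge> 0" "x \<in> P" for c x
  proof -
    obtain f where f: "f \<in> L" "AE x in M. 0 \<le> f x" "x = emb f" using P_E_rep[OF xy(2)] .
    have "AE x in M. 0 \<le> c * f x" using f(2) by eventually_elim (use xy in simp)
    then show ?thesis using emb_in_P_iff[OF L_scale[OF f(1)]] f by (simp add: emb_scale)
  qed
  show "closed P"
    unfolding closed_sequential_limits
  proof (intro allI impI, elim conjE)
    fix X x assume XP: "\<forall>n. X n \<in> P" and X: "X \<longlonglongrightarrow> x"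
    have "\<forall>n. X n \<in> E" using XP P_subset_E by auto
    then have "x \<in> E" using E_lim[OF X] by simp
    then obtain f where f: "f \<in> L" "x = emb f" by (auto simp: E_def)
    have [measurable]: "f \<in> borel_measurable M" using f(1) by (rule L_measurable)
    let ?m = "\<lambda>x. min (f x) 0"
    have mL: "?m \<in> L" by (rule L_dominated[OF _ f(1)]) auto
    have bd: "N ?m \<le> norm (X n - x)" for n
    proof -
      obtain g where g: "g \<in> L" "AE x in M. 0 \<le> g x" "X n = emb g" using P_E_rep XP by metis
      have "AE x in M. \<bar>?m x\<bar> \<le> \<bar>g x - f x\<bar>" using g(2) by eventually_elim auto
      then have "N ?m \<le> N (\<lambda>x. g x - f x)" by (rule N_mono[OF mL L_diff[OF g(1) f(1)]])
      then show ?thesis using f g by (simp add: L_diff flip: emb_diff norm_emb)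
    qed
    have "(\<lambda>n. norm (X n - x)) \<longlonglongrightarrow> 0" using X by (intro tendsto_norm_zero LIM_zero)
    then have "N ?m \<le> 0" by (rule LIMSEQ_le_const) (use bd in auto)
    then have "N ?m = 0" using N_nonneg[of ?m] by simp
    then have "AE x in M. ?m x = 0" using N_zero_iff[OF mL] by simp
    then have "AE x in M. 0 \<le> f x" by eventually_elim (auto simp: min_def split: if_splits)
    then show "x \<in> P" using f emb_in_P_iff by simp
  qed
qed

lemma decseq_convergent_Lp:
  assumes XP: "\<And>n::nat. X n \<in> P" and dec: "\<And>n. X n - X (Suc n) \<in> P"
  shows "convergent X"
proof -
  define f where "f n = rep (X n)" for n
  have XE: "X n \<in> E" for n using XP P_subset_E by auto
  have fL: "f n \<in> L" and fX: "emb (f n) = X n" for n using rep[OF XE] by (auto simp: f_def)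
  have [measurable]: "f n \<in> borel_measurable M" for n using fL by (rule L_measurable)
  have "AE x in M. 0 \<le> f n x" for n using XP[of n] emb_in_P_iff[OF fL] fX by simp
  then have pos: "AE x in M. \<forall>n. 0 \<le> f n x" by (simp add: AE_all_countable)
  have "AE x in M. 0 \<le> f n x - f (Suc n) x" for n
    using dec[of n] emb_in_P_iff[OF L_diff[OF fL fL]] fX by (simp add: emb_diff[OF fL fL])
  then have "AE x in M. \<forall>n. 0 \<le> f n x - f (Suc n) x" by (simp add: AE_all_countable)
  then have decs: "AE x in M. decseq (\<lambda>n. f n x)" by eventually_elim (auto intro: decseq_SucI)
  define h where "h x = lim (\<lambda>n. f n x)" for x
  have hm: "h \<in> borel_measurable M" unfolding h_def by measurable
  have "AE x in M. \<bar>f n x\<bar> \<le> \<bar>f 0 x\<bar>" for n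
    using pos decs
  proof eventually_elim
    case (elim x)
    show ?case using elim(1)[rule_format, of n] decseqD[OF elim(2), of 0 n] by auto
  qed
  moreover have "AE x in M. (\<lambda>n. f n x) \<longlonglongrightarrow> h x"
    using pos decs
  proof eventually_elim
    case (elim x)
    obtain l where "(\<lambda>n. f n x) \<longlonglongrightarrow> l" by (rule decseq_convergent[OF elim(2), of 0]) (use elim(1) in auto)
    then show ?case unfolding h_def by (simp add: limI)
  qed
  ultimately have "(\<lambda>n. emb (f n)) \<longlonglongrightarrow> emb h" by (rule tendsto_emb_dominated(2)[OF fL L_abs[OF fL[of 0]] hm])
  then show ?thesis unfolding fX by (auto simp: convergent_def)
qed

end

sublocale lp_space \<subseteq> ordered_closed_subspace E P
proof unfold_locales
  show "closed_cone P" by (rule closed_cone_P)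
  show "P \<subseteq> E" by (rule P_subset_E)
  show "\<exists>y\<in>P. \<exists>z\<in>P. x = y - z \<and> norm y \<le> norm x \<and> norm z \<le> norm x" if xE: "x \<in> E" for x
  proof -
    obtain f where f: "f \<in> L" "x = emb f" using xE by (auto simp: E_def)
    have [measurable]: "f \<in> borel_measurable M" using f(1) by (rule L_measurable)
    have pL: "(\<lambda>x. max (f x) 0) \<in> L" and nL: "(\<lambda>x. max (- f x) 0) \<in> L"
      by (rule L_dominated[OF _ f(1)]; auto)+
    have "N (\<lambda>x. max (f x) 0) \<le> N f" "N (\<lambda>x. max (- f x) 0) \<le> N f"
      by (rule N_mono[OF _ f(1)]; use pL nL in auto)+
    then have n: "norm (emb (\<lambda>x. max (f x) 0)) \<le> norm x" "norm (emb (\<lambda>x. max (- f x) 0)) \<le> norm x"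
      using f pL nL by (simp_all add: norm_emb)
    have "f = (\<lambda>x. max (f x) 0 - max (- f x) 0)" by (auto simp: max_def)
    then have "x = emb (\<lambda>x. max (f x) 0) - emb (\<lambda>x. max (- f x) 0)"
      using emb_diff[OF pL nL] f(2) by simp
    moreover have "emb (\<lambda>x. max (f x) 0) \<in> P" "emb (\<lambda>x. max (- f x) 0) \<in> P"
      using emb_in_P_iff[OF pL] emb_in_P_iff[OF nL] by auto
    ultimately show ?thesis using n by blast
  qed
  show "norm x \<le> norm y" if xy: "x \<in> P" "y - x \<in> P" for x y
  proof -
    obtain f where f: "f \<in> L" "AE x in M. 0 \<le> f x" "x = emb f" using P_E_rep[OF xy(1)] .
    obtain g where g: "g \<in> L" "AE x in M. 0 \<le> g x" "y - x = emb g" using P_E_rep[OF xy(2)] .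
    have "y = emb (\<lambda>x. f x + g x)" using f g by (simp add: emb_add algebra_simps)
    moreover have "AE x in M. \<bar>f x\<bar> \<le> \<bar>f x + g x\<bar>" using f(2) g(2) by eventually_elim simp
    ultimately show ?thesis using N_mono[OF f(1) L_add[OF f(1) g(1)]] f g by (simp add: norm_emb L_add)
  qed
qed (rule decseq_convergent_Lp)

context lp_space begin

definition potential :: "('a \<Rightarrow> real) \<Rightarrow> bool" where
  "potential W \<longleftrightarrow> (\<forall>C\<in>sets M. emeasure M C < \<infinity> \<longrightarrow> W \<in> borel_measurable (restrict_space M C)) \<and>
     (\<exists>c. \<forall>x\<in>space M. \<bar>W x\<bar> \<le> c)"

lemma emeasure_superlevel_finite:
  assumes f: "f \<in> L" and e: "e > 0"
  shows "emeasure M {x \<in> space M. e < \<bar>f x\<bar>} < \<infinity>"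
proof -
  have [measurable]: "f \<in> borel_measurable M" using f by (rule L_measurable)
  have "emeasure M {x \<in> space M. e < \<bar>f x\<bar>} \<le> emeasure M {x \<in> space M. \<bar>f x\<bar> powr p \<ge> e powr p}"
    using e p by (intro emeasure_mono) (auto intro: powr_mono2)
  also have "\<dots> < \<infinity>"
  proof -
    have "emeasure M {x \<in> space M. \<bar>f x\<bar> powr p \<ge> e powr p} \<le> ennreal (1 / e powr p * (\<integral>x. \<bar>f x\<bar> powr p \<partial>M))"
      using integral_Markov_inequality[OF L_integrable[OF f], of "e powr p"] e by simp
    then show ?thesis by (rule le_less_trans) simp
  qed
  finally show ?thesis .
qed

text \<open>
  A locally measurable \<open>W\<close> need not be measurable, but \<open>f\<close> vanishes outside the union of the sets \<open>[|f| > 1/n]\<close>, which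
  have finite measure.
\<close>

lemma potential_mult_measurable:
  assumes W: "potential W" and f: "f \<in> L"
  shows "(\<lambda>x. W x * f x) \<in> borel_measurable M"
proof -
  have [measurable]: "f \<in> borel_measurable M" using f by (rule L_measurable)
  define C where "C n = {x \<in> space M. 1 / Suc n < \<bar>f x\<bar>}" for n :: nat
  have Cm [measurable]: "C n \<in> sets M" for n unfolding C_def by measurable
  have "(\<lambda>x. indicator (C n) x *\<^sub>R W x) \<in> borel_measurable M" for n
  proof -
    have "emeasure M (C n) < \<infinity>" unfolding C_def by (rule emeasure_superlevel_finite[OF f]) simp
    then have "W \<in> borel_measurable (restrict_space M (C n))" using W Cm by (auto simp: potential_def)
    then show ?thesis using borel_measurable_restrict_space_iff[of "C n" M W] Cm[of n] by auto
  qed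
  then have m: "(\<lambda>x. (indicator (C n) x *\<^sub>R W x) * f x) \<in> borel_measurable M" for n by measurable
  show ?thesis
  proof (rule borel_measurable_LIMSEQ_real[OF _ m])
    fix x assume x: "x \<in> space M"
    show "(\<lambda>n. (indicator (C n) x *\<^sub>R W x) * f x) \<longlonglongrightarrow> W x * f x"
    proof (cases "f x = 0")
      case False
      then obtain n0 where n0: "1 / Suc n0 < \<bar>f x\<bar>" using nat_approx_posE[of "\<bar>f x\<bar>"] by auto
      have "x \<in> C n" if "n \<ge> n0" for n
      proof -
        have "1 / real (Suc n) \<le> 1 / real (Suc n0)" using that by (simp add: frac_le)
        then show ?thesis using n0 x by (auto simp: C_def)
      qed
      then have "eventually (\<lambda>n. (indicator (C n) x *\<^sub>R W x) * f x = W x * f x) sequentially"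
        by (intro eventually_sequentiallyI[of n0]) simp
      then show ?thesis by (rule tendsto_eventually)
    qed simp
  qed
qed

lemma potential_mult:
  assumes W: "potential W" and f: "f \<in> L"
  shows "(\<lambda>x. W x * f x) \<in> L"
proof -
  obtain c where c: "\<And>x. x \<in> space M \<Longrightarrow> \<bar>W x\<bar> \<le> c" using W by (auto simp: potential_def)
  have "AE x in M. \<bar>W x * f x\<bar> \<le> \<bar>c * f x\<bar>"
  proof (rule AE_I2)
    fix x assume "x \<in> space M"
    then have "\<bar>W x\<bar> \<le> \<bar>c\<bar>" using c by fastforce
    then show "\<bar>W x * f x\<bar> \<le> \<bar>c * f x\<bar>" by (simp add: abs_mult mult_right_mono)
  qed
  then show ?thesis by (rule L_dominated[OF potential_mult_measurable[OF W f] L_scale[OF f]])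
qed

definition mult_op :: "('a \<Rightarrow> real) \<Rightarrow> 'a ambient \<Rightarrow> 'a ambient" where
  "mult_op W y = emb (\<lambda>x. W x * rep y x)"

lemma mult_op_emb:
  assumes W: "potential W" and f: "f \<in> L" shows "mult_op W (emb f) = emb (\<lambda>x. W x * f x)"
proof -
  have "AE x in M. W x * rep (emb f) x = W x * f x" using rep_emb_AE[OF f] by eventually_elim simp
  then show ?thesis unfolding mult_op_def using emb_eq_iff potential_mult[OF W] rep f by auto
qed

lemma potential_bound: "potential W \<Longrightarrow> \<exists>c\<ge>0. \<forall>x\<in>space M. \<bar>W x\<bar> \<le> c"
  unfolding potential_def by (metis abs_ge_zero abs_of_nonneg le_cases order_trans)

lemma bounded_op_mult_op: assumes W: "potential W" shows "bounded_op (mult_op W)"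
proof -
  obtain c where c: "c \<ge> 0" "\<And>x. x \<in> space M \<Longrightarrow> \<bar>W x\<bar> \<le> c" using potential_bound[OF W] by auto
  show ?thesis
  proof (rule bopI)
    fix x assume "x \<in> E"
    then obtain f where f: "f \<in> L" "x = emb f" by (auto simp: E_def)
    show "mult_op W x \<in> E" using f potential_mult[OF W] by (simp add: mult_op_emb[OF W])
    have "N (\<lambda>x. W x * f x) \<le> N (\<lambda>x. c * f x)"
      using c by (intro N_mono potential_mult W f L_scale AE_I2) (auto simp: abs_mult mult_right_mono)
    also have "\<dots> = c * N f" using norm_emb[OF L_scale[OF f(1), of c]] norm_emb[OF f(1)] c by (simp add: emb_scale f)
    finally show "norm (mult_op W x) \<le> c * norm x" using f potential_mult[OF W] by (simp add: mult_op_emb[OF W] norm_emb)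
  next
    fix x y a b assume "x \<in> E" "y \<in> E"
    then obtain f g where f: "f \<in> L" "x = emb f" and g: "g \<in> L" "y = emb g" by (auto simp: E_def)
    have "mult_op W (emb (\<lambda>x. a * f x + b * g x)) = emb (\<lambda>x. W x * (a * f x + b * g x))"
      by (rule mult_op_emb[OF W L_lincomb[OF f(1) g(1)]])
    also have "(\<lambda>x. W x * (a * f x + b * g x)) = (\<lambda>x. a * (W x * f x) + b * (W x * g x))"
      by (auto simp: algebra_simps)
    also have "emb \<dots> = a *\<^sub>R emb (\<lambda>x. W x * f x) + b *\<^sub>R emb (\<lambda>x. W x * g x)"
      by (intro emb_lincomb potential_mult W f g)
    finally show "mult_op W (a *\<^sub>R x + b *\<^sub>R y) = a *\<^sub>R mult_op W x + b *\<^sub>R mult_op W y"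
      by (simp add: f g emb_lincomb mult_op_emb[OF W])
  qed
qed

lemma pos_op_mult_op: assumes W: "potential W" and pos: "\<And>x. x \<in> space M \<Longrightarrow> 0 \<le> W x" shows "pos_op (mult_op W)"
  unfolding pos_op_def
proof
  fix x assume "x \<in> P"
  then obtain f where f: "f \<in> L" "AE x in M. 0 \<le> f x" "x = emb f" by (rule P_E_rep)
  have "AE x in M. 0 \<le> W x * f x" using f(2) AE_space by eventually_elim (use pos in auto)
  then show "mult_op W x \<in> P" using emb_in_P_iff[OF potential_mult[OF W f(1)]] f by (simp add: mult_op_emb[OF W])
qed

lemma mult_op_lincomb:
  assumes W: "potential W" "potential W'" "potential W''" and x: "x \<in> E"
    and eq: "\<And>x. x \<in> space M \<Longrightarrow> W'' x = a * W x + b * W' x"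
  shows "mult_op W'' x = a *\<^sub>R mult_op W x + b *\<^sub>R mult_op W' x"
proof -
  obtain f where f: "f \<in> L" "x = emb f" using x by (auto simp: E_def)
  have "mult_op W'' x = emb (\<lambda>x. a * (W x * f x) + b * (W' x * f x))"
    unfolding f(2) mult_op_emb[OF W(3) f(1)]
    by (intro emb_eq_iff[THEN iffD2] potential_mult W f L_lincomb AE_I2) (simp add: eq algebra_simps)
  then show ?thesis by (simp add: f emb_lincomb potential_mult W mult_op_emb)
qed

lemma potential_const: "potential (\<lambda>x. c)" by (auto simp: potential_def)
lemma mult_op_const: "x \<in> E \<Longrightarrow> mult_op (\<lambda>_. c) x = c *\<^sub>R x"
  by (auto simp: E_def mult_op_emb[OF potential_const] emb_scale)
lemma potential_lincomb:
  assumes "potential W" "potential W'" shows "potential (\<lambda>x. a * W x + b * W' x)"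
proof -
  obtain c c' where "\<And>x. x \<in> space M \<Longrightarrow> \<bar>W x\<bar> \<le> c" "\<And>x. x \<in> space M \<Longrightarrow> \<bar>W' x\<bar> \<le> c'"
    using assms unfolding potential_def by blast
  then have "\<bar>a * W x + b * W' x\<bar> \<le> \<bar>a\<bar> * c + \<bar>b\<bar> * c'" if "x \<in> space M" for x
    using that by (intro order_trans[OF abs_triangle_ineq] add_mono) (auto simp: abs_mult mult_left_mono)
  then show ?thesis using assms unfolding potential_def by (auto intro!: borel_measurable_add borel_measurable_times)
qed

text \<open>
  Families of operators act on representatives in \<open>Lp_set M p\<close>, abstract semigroups on \<open>E\<close>; \<open>hat\<close> and \<open>unhat\<close> translate.
\<close>

definition hat :: "'a op_family \<Rightarrow> real \<Rightarrow> 'a ambient \<Rightarrow> 'a ambient" where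
  "hat T t y = emb (T t (rep y))"

definition unhat :: "(real \<Rightarrow> 'a ambient \<Rightarrow> 'a ambient) \<Rightarrow> 'a op_family" where
  "unhat U t f = rep (U t (emb f))"

text \<open>
  An operator that is linear and bounded almost everywhere respects equality almost everywhere, since it maps a
  function of norm \<open>0\<close> to one of norm \<open>0\<close>.
\<close>

lemma Lp_bounded_op_cong:
  assumes B: "Lp_bounded_op M p B" and f: "f \<in> L" and g: "g \<in> L" and eq: "AE x in M. f x = g x"
  shows "emb (B f) = emb (B g)"
proof -
  obtain C where C: "\<And>f. f \<in> L \<Longrightarrow> N (B f) \<le> C * N f" using B unfolding Lp_bounded_op_def by blast
  have BL: "B f \<in> L" "B g \<in> L" using B f g by (auto simp: Lp_bounded_op_def)
  let ?d = "\<lambda>y. 1 * f y + (-1) * g y"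
  have dL: "?d \<in> L" by (intro L_lincomb f g)
  have BdL: "B ?d \<in> L" using B dL unfolding Lp_bounded_op_def by blast
  have "AE x in M. B ?d x = 1 * B f x + (-1) * B g x" using B f g unfolding Lp_bounded_op_def by blast
  then have "emb (B ?d) = 1 *\<^sub>R emb (B f) + (-1) *\<^sub>R emb (B g)"
    using emb_eq_iff[OF BdL L_lincomb[OF BL], of 1 "-1"] by (simp only: emb_lincomb[OF BL])
  moreover have "N ?d = 0" using eq N_zero_iff[OF dL] by auto
  then have "norm (emb (B ?d)) \<le> 0" using C[OF dL] norm_emb[OF BdL] by simp
  ultimately show ?thesis by simp
qed

lemma C0D:
  assumes "C0_semigroup M p T"
  shows "t \<ge> 0 \<Longrightarrow> Lp_bounded_op M p (T t)" "t \<ge> 0 \<Longrightarrow> f \<in> L \<Longrightarrow> T t f \<in> L"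
  using assms by (auto simp: C0_semigroup_def Lp_bounded_op_def)

lemma hat_emb:
  assumes T: "C0_semigroup M p T" and t: "t \<ge> 0" and f: "f \<in> L"
  shows "hat T t (emb f) = emb (T t f)"
  unfolding hat_def using rep[of "emb f"] rep_emb_AE[OF f] f
  by (intro Lp_bounded_op_cong[OF C0D(1)[OF T t]]) auto

lemma Lp_tendsto_iff:
  assumes u: "eventually (\<lambda>i. u i \<in> L) F"
  shows "Lp_tendsto M p u g F \<longleftrightarrow> g \<in> L \<and> ((\<lambda>i. emb (u i)) \<longlongrightarrow> emb g) F"
proof (cases "g \<in> L")
  case True
  have "eventually (\<lambda>i. N (\<lambda>x. u i x - g x) = norm (emb (u i) - emb g)) F"
    using u by eventually_elim (simp add: True L_diff flip: norm_emb emb_diff)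
  then have "((\<lambda>i. N (\<lambda>x. u i x - g x)) \<longlongrightarrow> 0) F \<longleftrightarrow> ((\<lambda>i. norm (emb (u i) - emb g)) \<longlongrightarrow> 0) F"
    by (rule tendsto_cong)
  also have "\<dots> \<longleftrightarrow> ((\<lambda>i. emb (u i)) \<longlongrightarrow> emb g) F"
    by (simp add: tendsto_norm_zero_iff LIM_zero_iff)
  finally show ?thesis using True u by (simp add: Lp_tendsto_def)
qed (simp add: Lp_tendsto_def)

lemma c0_sg_hat:
  assumes T: "C0_semigroup M p T" shows "c0_sg (hat T)"
  unfolding c0_sg_def
proof (intro conjI allI ballI impI)
  fix t :: real assume t: "t \<ge> 0"
  note B = C0D(1)[OF T t]
  obtain C where C: "\<And>f. f \<in> L \<Longrightarrow> N (T t f) \<le> C * N f" using B unfolding Lp_bounded_op_def by blast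
  show "bounded_op (hat T t)"
  proof (rule bopI)
    fix x assume "x \<in> E"
    then obtain f where f: "f \<in> L" "x = emb f" by (auto simp: E_def)
    show "hat T t x \<in> E" using C0D(2)[OF T t] f by (simp add: hat_emb[OF T t])
    show "norm (hat T t x) \<le> C * norm x" using C[OF f(1)] C0D(2)[OF T t] f by (simp add: hat_emb[OF T t] norm_emb)
  next
    fix x y a b assume "x \<in> E" "y \<in> E"
    then obtain f g where f: "f \<in> L" "x = emb f" and g: "g \<in> L" "y = emb g" by (auto simp: E_def)
    have TL: "T t f \<in> L" "T t g \<in> L" "T t (\<lambda>y. a * f y + b * g y) \<in> L"
      using C0D(2)[OF T t] f g L_lincomb by auto
    have "AE x in M. T t (\<lambda>y. a * f y + b * g y) x = a * T t f x + b * T t g x"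
      using B f g unfolding Lp_bounded_op_def by blast
    then have "emb (T t (\<lambda>y. a * f y + b * g y)) = a *\<^sub>R emb (T t f) + b *\<^sub>R emb (T t g)"
      using emb_eq_iff[OF TL(3) L_lincomb[OF TL(1,2)]] by (simp add: emb_lincomb TL)
    then show "hat T t (a *\<^sub>R x + b *\<^sub>R y) = a *\<^sub>R hat T t x + b *\<^sub>R hat T t y"
      by (simp add: f g hat_emb[OF T t] L_lincomb flip: emb_lincomb)
  qed
next
  fix x assume "x \<in> E"
  then obtain f where f: "f \<in> L" "x = emb f" by (auto simp: E_def)
  have "AE x in M. T 0 f x = f x" using T f by (auto simp: C0_semigroup_def)
  then show "hat T 0 x = x" using emb_eq_iff[of "T 0 f" f] C0D(2)[OF T] f by (simp add: hat_emb[OF T])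
  have "Lp_tendsto M p (\<lambda>t. T t f) f (at_right 0)" using T f by (auto simp: C0_semigroup_def)
  moreover have "eventually (\<lambda>t. T t f \<in> L) (at_right 0)"
    using C0D(2)[OF T _ f(1)] by (auto simp: eventually_at_filter)
  ultimately have "((\<lambda>t. emb (T t f)) \<longlongrightarrow> emb f) (at_right 0)" by (simp add: Lp_tendsto_iff)
  moreover have "eventually (\<lambda>t. emb (T t f) = hat T t x) (at_right 0)"
    using f by (auto simp: eventually_at_filter hat_emb[OF T])
  ultimately show "((\<lambda>t. hat T t x) \<longlongrightarrow> x) (at_right 0)" unfolding f(2) by (rule Lim_transform_eventually)
next
  fix s t :: real and x assume st: "s \<ge> 0" "t \<ge> 0" and "x \<in> E"
  then obtain f where f: "f \<in> L" "x = emb f" by (auto simp: E_def)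
  have "AE x in M. T (s + t) f x = T s (T t f) x" using T f st by (auto simp: C0_semigroup_def)
  then have "emb (T (s + t) f) = emb (T s (T t f))"
    using st f C0D(2)[OF T] by (subst emb_eq_iff) auto
  then show "hat T (s + t) x = hat T s (hat T t x)"
    using st f C0D(2)[OF T] by (simp add: hat_emb[OF T])
qed

lemma hat_unhat: assumes U: "c0_sg U" and t: "t \<ge> 0" and x: "x \<in> E" shows "hat (unhat U) t x = U t x"
  using c0_sgD(5)[OF U t x] rep x by (simp add: hat_def unhat_def)

lemma C0_unhat:
  assumes U: "c0_sg U" shows "C0_semigroup M p (unhat U)"
proof -
  have UL: "unhat U t f \<in> L" and Ue: "emb (unhat U t f) = U t (emb f)" if "t \<ge> 0" "f \<in> L" for t f
    using c0_sgD(5)[OF U that(1), of "emb f"] that rep by (auto simp: unhat_def)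
  have "Lp_bounded_op M p (unhat U t)" if t: "t \<ge> 0" for t
    unfolding Lp_bounded_op_def
  proof (intro conjI ballI allI)
    show "unhat U t f \<in> L" if "f \<in> L" for f using UL[OF t that] .
    show "AE x in M. unhat U t (\<lambda>y. a * f y + b * g y) x = a * unhat U t f x + b * unhat U t g x"
      if f: "f \<in> L" and g: "g \<in> L" for f g a b
    proof -
      have "emb (unhat U t (\<lambda>y. a * f y + b * g y)) = emb (\<lambda>x. a * unhat U t f x + b * unhat U t g x)"
        using f g t by (simp add: emb_lincomb UL Ue L_lincomb bounded_op_lin[OF c0_sgD(1)[OF U t]])
      then show ?thesis using emb_eq_iff UL L_lincomb f g t by simp
    qed
    obtain C where C: "\<And>x. x \<in> E \<Longrightarrow> norm (U t x) \<le> C * norm x" using bounded_op_bound[OF c0_sgD(1)[OF U t]] by blast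
    have "N (unhat U t f) \<le> C * N f" if "f \<in> L" for f
      using C[of "emb f"] that UL[OF t that] Ue[OF t that] norm_emb by (metis emb_in_E)
    then show "\<exists>C. \<forall>f\<in>L. N (unhat U t f) \<le> C * N f" by blast
  qed
  moreover have "AE x in M. unhat U 0 f x = f x" if f: "f \<in> L" for f
    using emb_eq_iff[OF UL[of 0 f] f] f Ue[of 0 f] c0_sgD(2)[OF U] by simp
  moreover have "AE x in M. unhat U (s + t) f x = unhat U s (unhat U t f) x" if "s \<ge> 0" "t \<ge> 0" and f: "f \<in> L" for s t f
    using emb_eq_iff[OF UL UL[OF that(1) UL[OF that(2) f]], of "s + t" f] that Ue UL c0_sgD(3)[OF U that(1,2), of "emb f"] by simp
  moreover have "Lp_tendsto M p (\<lambda>t. unhat U t f) f (at_right 0)" if f: "f \<in> L" for f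
  proof -
    have "eventually (\<lambda>t. unhat U t f \<in> L) (at_right 0)" using UL f by (auto simp: eventually_at_filter)
    moreover have "((\<lambda>t. emb (unhat U t f)) \<longlongrightarrow> emb f) (at_right 0)"
      by (rule Lim_transform_eventually[OF c0_sgD(4)[OF U emb_in_E[OF f]]])
        (use Ue f in \<open>auto simp: eventually_at_filter\<close>)
    ultimately show ?thesis using f by (simp add: Lp_tendsto_iff)
  qed
  ultimately show ?thesis by (simp add: C0_semigroup_def)
qed

lemma generator_eq:
  assumes T: "C0_semigroup M p T"
  shows "(f, g) \<in> generator M p T \<longleftrightarrow> f \<in> L \<and> g \<in> L \<and> (emb f, emb g) \<in> gen_graph (hat T)"
proof (cases "f \<in> L")
  case True
  have qL: "(\<lambda>x. (T h f x - f x) / h) \<in> L" and qe: "emb (\<lambda>x. (T h f x - f x) / h) = (hat T h (emb f) - emb f) /\<^sub>R h" if "h \<ge> 0" for h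
  proof -
    have eq: "(\<lambda>x. (T h f x - f x) / h) = (\<lambda>x. inverse h * (T h f x - f x))" by (auto simp: field_simps)
    have d: "(\<lambda>x. T h f x - f x) \<in> L" using C0D(2)[OF T that True] True by (intro L_diff)
    show "(\<lambda>x. (T h f x - f x) / h) \<in> L" unfolding eq by (rule L_scale[OF d])
    show "emb (\<lambda>x. (T h f x - f x) / h) = (hat T h (emb f) - emb f) /\<^sub>R h"
      unfolding eq emb_scale[OF d] using C0D(2)[OF T that True] True that by (simp add: emb_diff hat_emb[OF T])
  qed
  have "Lp_tendsto M p (\<lambda>h x. (T h f x - f x) / h) g (at_right 0) \<longleftrightarrow>
      g \<in> L \<and> ((\<lambda>h. emb (\<lambda>x. (T h f x - f x) / h)) \<longlongrightarrow> emb g) (at_right 0)"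
    by (rule Lp_tendsto_iff) (use qL in \<open>auto simp: eventually_at_filter\<close>)
  also have "((\<lambda>h. emb (\<lambda>x. (T h f x - f x) / h)) \<longlongrightarrow> emb g) (at_right 0) \<longleftrightarrow>
      ((\<lambda>h. (hat T h (emb f) - emb f) /\<^sub>R h) \<longlongrightarrow> emb g) (at_right 0)"
    by (rule tendsto_cong) (use qe in \<open>auto simp: eventually_at_filter\<close>)
  finally show ?thesis using True by (auto simp: generator_def gen_graph_def)
qed (simp add: generator_def)

lemma gen_hat_eqI:
  assumes T: "C0_semigroup M p T" and S: "C0_semigroup M p S" and eq: "generator M p T = generator M p S"
  shows "gen_graph (hat T) = gen_graph (hat S)"
proof -
  have "gen_graph (hat T) \<subseteq> gen_graph (hat S)" if T: "C0_semigroup M p T" and S: "C0_semigroup M p S"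
    and eq: "generator M p T = generator M p S" for T S
  proof
    fix z assume z: "z \<in> gen_graph (hat T)"
    obtain x y where xy: "z = (x, y)" by fastforce
    have "x \<in> E" "y \<in> E" using gen_E[OF c0_sg_hat[OF T]] z xy by auto
    then obtain f g where fg: "f \<in> L" "g \<in> L" "x = emb f" "y = emb g" by (auto simp: E_def)
    then have "(f, g) \<in> generator M p T" using z xy generator_eq[OF T] by simp
    then show "z \<in> gen_graph (hat S)" using eq generator_eq[OF S] fg xy by simp
  qed
  from this[OF T S eq] this[OF S T eq[symmetric]] show ?thesis by auto
qed

lemma tangent_cong_family:
  assumes "\<And>t x. t \<ge> 0 \<Longrightarrow> x \<in> E \<Longrightarrow> S t x = S' t x" "tangent U B S" shows "tangent U B S'"
  unfolding tangent_def
proof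
  fix x assume x: "x \<in> E"
  show "((\<lambda>h. (S' h x - U h x) /\<^sub>R h) \<longlongrightarrow> B x) (at_right 0)"
    by (rule Lim_transform_eventually[where f="\<lambda>h. (S h x - U h x) /\<^sub>R h"])
      (use assms x in \<open>auto simp: tangent_def eventually_at_filter\<close>)
qed

text \<open>
  The bounded perturbation theorem shows that \<open>A - W\<close> is the generator of some semigroup, so that the choice operator in
  \<open>gen_semigroup\<close> picks one; by uniqueness it agrees with the constructed semigroup, from which it inherits tangency.
\<close>

lemma gen_semigroup_minus_mult:
  assumes T: "C0_semigroup M p T" and W: "potential W"
  defines "S \<equiv> gen_semigroup M p (minus_mult (generator M p T) W)"
  shows "C0_semigroup M p S" "tangent (hat T) (\<lambda>x. - mult_op W x) (hat S)"
proof -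
  have cT: "c0_sg (hat T)" by (rule c0_sg_hat[OF T])
  have B: "bounded_op (\<lambda>x. - mult_op W x)" using bounded_op_scaled[OF bounded_op_mult_op[OF W], of "-1"] by simp
  define U where "U = perturb (hat T) (\<lambda>x. - mult_op W x)"
  have cU: "c0_sg U" and tU: "tangent (hat T) (\<lambda>x. - mult_op W x) U"
    unfolding U_def by (rule c0_sg_perturb[OF cT B], rule tangent_perturb[OF cT B])
  define S0 where "S0 = unhat U"
  have S0: "C0_semigroup M p S0" unfolding S0_def by (rule C0_unhat[OF cU])
  have hS0: "hat S0 t x = U t x" if "t \<ge> 0" "x \<in> E" for t x unfolding S0_def by (rule hat_unhat[OF cU that])
  have tS0: "tangent (hat T) (\<lambda>x. - mult_op W x) (hat S0)"
    by (rule tangent_cong_family[OF _ tU]) (simp add: hS0)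
  have "(f, k) \<in> generator M p S0 \<longleftrightarrow> (f, k) \<in> minus_mult (generator M p T) W" for f k
  proof -
    have "(f, k) \<in> generator M p S0 \<longleftrightarrow> f \<in> L \<and> k \<in> L \<and> (emb f, emb k - (- mult_op W (emb f))) \<in> gen_graph (hat T)"
      using generator_eq[OF S0] tangent_gen[OF tS0] by auto
    also have "\<dots> \<longleftrightarrow> (f, \<lambda>x. k x + W x * f x) \<in> generator M p T"
    proof
      assume *: "f \<in> L \<and> k \<in> L \<and> (emb f, emb k - - mult_op W (emb f)) \<in> gen_graph (hat T)"
      then have f: "f \<in> L" and k: "k \<in> L" and g: "(emb f, emb k - - mult_op W (emb f)) \<in> gen_graph (hat T)" by auto
      show "(f, \<lambda>x. k x + W x * f x) \<in> generator M p T"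
        using f k g by (simp add: generator_eq[OF T] L_add potential_mult[OF W] emb_add mult_op_emb[OF W])
    next
      assume *: "(f, \<lambda>x. k x + W x * f x) \<in> generator M p T"
      then have f: "f \<in> L" and kW: "(\<lambda>x. k x + W x * f x) \<in> L" by (auto simp: generator_eq[OF T])
      have "k \<in> L" using L_diff[OF kW potential_mult[OF W f]] by simp
      then show "f \<in> L \<and> k \<in> L \<and> (emb f, emb k - - mult_op W (emb f)) \<in> gen_graph (hat T)"
        using * f by (simp add: generator_eq[OF T] potential_mult[OF W] emb_add mult_op_emb[OF W])
    qed
    also have "\<dots> \<longleftrightarrow> (f, k) \<in> minus_mult (generator M p T) W"
    proof
      assume "(f, \<lambda>x. k x + W x * f x) \<in> generator M p T"
      then show "(f, k) \<in> minus_mult (generator M p T) W"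
        unfolding minus_mult_def
        by (intro CollectI, rule_tac exI[of _ f], rule_tac exI[of _ "\<lambda>x. k x + W x * f x"]) simp
    qed (auto simp: minus_mult_def)
    finally show ?thesis .
  qed
  then have g0: "generator M p S0 = minus_mult (generator M p T) W" by (intro set_eqI) (simp add: split_paired_all)
  have "C0_semigroup M p S \<and> generator M p S = minus_mult (generator M p T) W"
    unfolding S_def gen_semigroup_def
    by (rule someI[where x=S0 and P="\<lambda>S. C0_semigroup M p S \<and> generator M p S = minus_mult (generator M p T) W"])
      (intro conjI S0 g0)
  then have S: "C0_semigroup M p S" and gS: "generator M p S = generator M p S0" using g0 by auto
  show "C0_semigroup M p S" by (rule S)
  have eq: "hat S0 t x = hat S t x" if "t \<ge> 0" "x \<in> E" for t x
    using gen_unique[OF c0_sg_hat[OF S0] c0_sg_hat[OF S] gen_hat_eqI[OF S0 S gS[symmetric]] that(2,1)] .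
  show "tangent (hat T) (\<lambda>x. - mult_op W x) (hat S)" by (rule tangent_cong_family[OF _ tS0]) (rule eq)
qed

lemma pos_family_hat:
  assumes T: "C0_semigroup M p T" and pos: "positive_family M p T" shows "pos_family (hat T)"
  unfolding pos_family_def pos_op_def
proof (intro allI ballI impI)
  fix t :: real and x assume t: "t \<ge> 0" and "x \<in> P"
  then obtain f where f: "f \<in> L" "AE x in M. 0 \<le> f x" "x = emb f" using P_E_rep by metis
  have "AE x in M. 0 \<le> T t f x" using pos t f by (auto simp: positive_family_def)
  then show "hat T t x \<in> P" using emb_in_P_iff C0D(2)[OF T t f(1)] f by (simp add: hat_emb[OF T t])
qed

end

section \<open>Monotone limits of absorption semigroups\<close>

context lp_space begin

notation le (infix "\<preceq>" 50)

lemma strong_lim_emb: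
  assumes F: "F \<noteq> bot" and S: "eventually (\<lambda>i. S i t f \<in> L) F" and l: "((\<lambda>i. emb (S i t f)) \<longlongrightarrow> y) F"
  shows "strong_lim M p F S t f \<in> L" "emb (strong_lim M p F S t f) = y"
proof -
  have "y \<in> E" using S by (intro E_lim[OF l F]) (auto elim: eventually_mono)
  then have "Lp_tendsto M p (\<lambda>i. S i t f) (rep y) F" using rep[of y] l by (simp add: Lp_tendsto_iff[OF S])
  then have "Lp_tendsto M p (\<lambda>i. S i t f) (strong_lim M p F S t f) F"
    unfolding strong_lim_def by (rule someI[where P="\<lambda>g. Lp_tendsto M p (\<lambda>i. S i t f) g F"])
  then have *: "strong_lim M p F S t f \<in> L" "((\<lambda>i. emb (S i t f)) \<longlongrightarrow> emb (strong_lim M p F S t f)) F"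
    by (auto simp: Lp_tendsto_iff[OF S])
  show "strong_lim M p F S t f \<in> L" by (rule *(1))
  show "emb (strong_lim M p F S t f) = y" by (rule tendsto_unique[OF F *(2) l])
qed

lemma truncate_nonneg: "0 \<le> V x \<Longrightarrow> truncate V n x = real_of_ereal (min (V x) (ereal (real n)))"
  unfolding truncate_def by (subst max_absorb1) (auto simp: min_def intro: order_trans[of _ 0])

lemma truncate_uminus: "truncate (\<lambda>x. - V x) n x = - truncate V n x"
  unfolding truncate_def by (cases "V x") (auto simp: min_def max_def)

lemma potential_truncate: assumes V: "locally_measurable M V" shows "potential (truncate V n)"
  unfolding potential_def
proof (intro conjI ballI impI)
  fix C assume C: "C \<in> sets M" "emeasure M C < \<infinity>"
  then have [measurable]: "V \<in> borel_measurable (restrict_space M C)" using V by (auto simp: locally_measurable_def)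
  show "truncate V n \<in> borel_measurable (restrict_space M C)"
    unfolding truncate_def[abs_def] by measurable
next
  have "\<bar>truncate V n x\<bar> \<le> real n" for x
    unfolding truncate_def by (cases "V x") (auto simp: min_def max_def)
  then show "\<exists>c. \<forall>x\<in>space M. \<bar>truncate V n x\<bar> \<le> c" by blast
qed

end

locale positive_semigroup = lp_space M p for M :: "'a measure" and p +
  fixes T :: "'a op_family"
  assumes C0: "C0_semigroup M p T" and positive: "positive_family M p T"
begin

definition T_pot :: "('a \<Rightarrow> real) \<Rightarrow> real \<Rightarrow> 'a ambient \<Rightarrow> 'a ambient" where
  "T_pot W = hat (gen_semigroup M p (minus_mult (generator M p T) W))"

lemma c0_sg_T: "c0_sg (hat T)" by (rule c0_sg_hat[OF C0])
lemma pos_family_T: "pos_family (hat T)" by (rule pos_family_hat[OF C0 positive])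

lemma T_pot:
  assumes W: "potential W"
  shows "c0_sg (T_pot W)" "tangent (hat T) (\<lambda>x. - mult_op W x) (T_pot W)" "pos_family (T_pot W)"
proof -
  note g = gen_semigroup_minus_mult[OF C0 W]
  show c: "c0_sg (T_pot W)" unfolding T_pot_def by (rule c0_sg_hat[OF g(1)])
  show t: "tangent (hat T) (\<lambda>x. - mult_op W x) (T_pot W)" unfolding T_pot_def by (rule g(2))
  obtain c0 where c0: "c0 \<ge> 0" "\<And>x. x \<in> space M \<Longrightarrow> \<bar>W x\<bar> \<le> c0" using potential_bound[OF W] by auto
  have b: "bounded_op (\<lambda>x. - mult_op W x)" using bounded_op_scaled[OF bounded_op_mult_op[OF W], of "-1"] by simp
  have pc: "potential (\<lambda>x. c0 * 1 + (-1) * W x)" by (rule potential_lincomb[OF potential_const W])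
  show "pos_family (T_pot W)"
  proof (rule pos_family_tangent_shift[OF c0_sg_T pos_family_T c b t])
    fix x assume x: "x \<in> P"
    have "mult_op (\<lambda>x. c0 * 1 + (-1) * W x) x = c0 *\<^sub>R mult_op (\<lambda>_. 1) x + (-1) *\<^sub>R mult_op W x"
      using x by (intro mult_op_lincomb potential_const W pc) auto
    then have "- mult_op W x + c0 *\<^sub>R x = mult_op (\<lambda>x. c0 * 1 + (-1) * W x) x"
      using x by (simp add: mult_op_const)
    moreover have "pos_op (mult_op (\<lambda>x. c0 * 1 + (-1) * W x))"
      using c0(2) by (intro pos_op_mult_op pc) (auto simp: abs_le_iff)
    ultimately show "- mult_op W x + c0 *\<^sub>R x \<in> P" using pos_opD x by simp
  qed
qed

lemma T_pot_tangent:
  assumes W: "potential W" "potential W'" "potential D" and eq: "\<And>x. x \<in> space M \<Longrightarrow> D x = W x - W' x"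
  shows "tangent (T_pot W) (mult_op D) (T_pot W')"
proof (rule tangent_cong[OF tangent_trans[OF tangent_sym[OF T_pot(2)[OF W(1)]] T_pot(2)[OF W(2)]]])
  fix x assume x: "x \<in> E"
  show "- (- mult_op W x) + - mult_op W' x = mult_op D x"
    using mult_op_lincomb[OF W x, of 1 "-1"] eq by simp
qed

lemma potential_diff: "potential W \<Longrightarrow> potential W' \<Longrightarrow> potential (\<lambda>x. W x - W' x)"
  using potential_lincomb[of W W' 1 "-1"] by simp
lemma potential_add: "potential W \<Longrightarrow> potential W' \<Longrightarrow> potential (\<lambda>x. W x + W' x)"
  using potential_lincomb[of W W' 1 1] by simp
lemma potential_scale: "potential W \<Longrightarrow> potential (\<lambda>x. c * W x)"
  using potential_lincomb[of W W c 0] by simp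

lemma T_pot_mono:
  assumes W: "potential W" "potential W'" and le: "\<And>x. x \<in> space M \<Longrightarrow> W' x \<le> W x" and t: "t \<ge> 0" and x: "x \<in> P"
  shows "T_pot W t x \<preceq> T_pot W' t x"
  by (rule tangent_mono[OF T_pot(1,3)[OF W(1)] T_pot(1,3)[OF W(2)] bounded_op_mult_op[OF potential_diff[OF W]]
        pos_op_mult_op[OF potential_diff[OF W]] T_pot_tangent[OF W potential_diff[OF W]] t x])
    (use le in auto)

lemma T_pot_zero: assumes t: "t \<ge> 0" and x: "x \<in> E" shows "T_pot (\<lambda>_. 0) t x = hat T t x"
proof (rule tangent_unique[OF T_pot(1) c0_sg_T T_pot(2) _ x t])
  show "tangent (hat T) (\<lambda>x. - mult_op (\<lambda>_. 0) x) (hat T)" by (simp add: tangent_def mult_op_const)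
qed (rule potential_const)+

lemma T_pot_le_T:
  assumes "potential W" "\<And>x. x \<in> space M \<Longrightarrow> 0 \<le> W x" "t \<ge> 0" "x \<in> P"
  shows "T_pot W t x \<preceq> hat T t x"
  using T_pot_mono[OF assms(1) potential_const[of 0] assms(2,3,4)] T_pot_zero[OF assms(3)] assms(4) by auto

lemma T_pot_shift:
  assumes W: "potential W" "potential W'" and eq: "\<And>x. x \<in> space M \<Longrightarrow> W' x = W x - c" and t: "t \<ge> 0" and x: "x \<in> E"
  shows "T_pot W' t x = exp (c * t) *\<^sub>R T_pot W t x"
proof (rule tangent_unique[OF T_pot(1)[OF W(2)] c0_sg_exp[OF T_pot(1)[OF W(1)]] T_pot(2)[OF W(2)] _ x t])
  show "tangent (hat T) (\<lambda>x. - mult_op W' x) (\<lambda>t x. exp (c * t) *\<^sub>R T_pot W t x)"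
  proof (rule tangent_cong[OF tangent_exp[OF T_pot(1)[OF W(1)] T_pot(2)[OF W(1)]]])
    fix x assume x: "x \<in> E"
    have "mult_op W' x = 1 *\<^sub>R mult_op W x + (- c) *\<^sub>R mult_op (\<lambda>_. 1) x"
      using eq by (intro mult_op_lincomb W potential_const x) auto
    then show "- mult_op W x + c *\<^sub>R x = - mult_op W' x" using x by (simp add: mult_op_const)
  qed
qed

lemma T_pot_convex:
  assumes W: "potential W" "potential D" and D: "\<And>x. x \<in> space M \<Longrightarrow> 0 \<le> D x" and h: "0 \<le> h" "h \<le> 1"
    and t: "t \<ge> 0" and x: "x \<in> P"
  shows "T_pot (\<lambda>x. W x + h * D x) t x \<preceq> (1 - h) *\<^sub>R T_pot W t x + h *\<^sub>R T_pot (\<lambda>x. W x + D x) t x"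
proof -
  have p1: "potential (\<lambda>x. W x + D x)" and ph: "potential (\<lambda>x. W x + h * D x)"
    by (intro potential_add potential_scale W)+
  have "tangent (T_pot W) (mult_op (\<lambda>x. - 1 * D x)) (T_pot (\<lambda>x. W x + D x))"
    by (intro T_pot_tangent W p1 potential_scale) auto
  then have t1: "tangent (T_pot W) (\<lambda>x. - mult_op D x) (T_pot (\<lambda>x. W x + D x))"
    by (rule tangent_cong) (use mult_op_lincomb[of D D "\<lambda>x. - 1 * D x" _ "-1" 0] W potential_scale[OF W(2), of "-1"] in auto)
  have "tangent (T_pot W) (mult_op (\<lambda>x. - h * D x)) (T_pot (\<lambda>x. W x + h * D x))"
    by (intro T_pot_tangent W ph potential_scale) auto
  then have th: "tangent (T_pot W) (\<lambda>x. - (h *\<^sub>R mult_op D x)) (T_pot (\<lambda>x. W x + h * D x))"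
    by (rule tangent_cong) (use mult_op_lincomb[of D D "\<lambda>x. - h * D x" _ "-h" 0] W potential_scale[OF W(2), of "-h"] in auto)
  show ?thesis
    by (rule convexity[OF T_pot(1,3)[OF W(1)] T_pot(1,3)[OF p1] T_pot(1,3)[OF ph] bounded_op_mult_op[OF W(2)] pos_op_mult_op[OF W(2) D] t1 th h t x])
qed

definition potential_seq :: "(nat \<Rightarrow> 'a \<Rightarrow> real) \<Rightarrow> bool" where
  "potential_seq W \<longleftrightarrow> (\<forall>n. potential (W n)) \<and> (\<forall>n. \<forall>x\<in>space M. 0 \<le> W n x \<and> W n x \<le> W (Suc n) x)"

text \<open>
  For an increasing sequence \<open>W\<close> of potentials the semigroups \<open>T_pot (W n)\<close> decrease on positive elements, so this
  limit exists. It depends only on the cofinality class of \<open>W\<close> (lemma \<open>T_lim_mono\<close>), which absorbs the mismatch between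
  truncating before and after scaling.
\<close>

definition T_lim :: "(nat \<Rightarrow> 'a \<Rightarrow> real) \<Rightarrow> real \<Rightarrow> 'a ambient \<Rightarrow> 'a ambient" where
  "T_lim W t x = lim (\<lambda>n. T_pot (W n) t x)"

lemma T_lim_P:
  assumes W: "potential_seq W" and t: "t \<ge> 0" and x: "x \<in> P"
  shows "(\<lambda>n. T_pot (W n) t x) \<longlonglongrightarrow> T_lim W t x" "T_lim W t x \<in> P" "T_lim W t x \<preceq> T_pot (W n) t x"
proof -
  have pW: "potential (W n)" for n using W by (simp add: potential_seq_def)
  have "0 \<preceq> T_pot (W n) t x" for n using pos_familyD[OF T_pot(3)[OF pW] t x] by (simp add: le_def)
  moreover have "T_pot (W (Suc n)) t x \<preceq> T_pot (W n) t x" for n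
    using W by (intro T_pot_mono pW t x) (auto simp: potential_seq_def)
  ultimately obtain l where l: "(\<lambda>n. T_pot (W n) t x) \<longlonglongrightarrow> l" "0 \<preceq> l" "\<And>n. l \<preceq> T_pot (W n) t x"
    using dec_limit[of 0 "\<lambda>n. T_pot (W n) t x"] by blast
  have "T_lim W t x = l" unfolding T_lim_def using l(1) by (rule limI)
  then show "(\<lambda>n. T_pot (W n) t x) \<longlonglongrightarrow> T_lim W t x" "T_lim W t x \<in> P" "T_lim W t x \<preceq> T_pot (W n) t x"
    using l by (auto simp: le_def)
qed

lemma T_lim_tendsto:
  assumes W: "potential_seq W" and t: "t \<ge> 0" and x: "x \<in> E"
  shows "(\<lambda>n. T_pot (W n) t x) \<longlonglongrightarrow> T_lim W t x"
proof -
  have pW: "potential (W n)" for n using W by (simp add: potential_seq_def)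
  obtain y z where yz: "y \<in> P" "z \<in> P" "x = y - z" using decompose[OF x] by blast
  have "(\<lambda>n. T_pot (W n) t y - T_pot (W n) t z) \<longlonglongrightarrow> T_lim W t y - T_lim W t z"
    by (intro tendsto_diff T_lim_P W t yz)
  moreover have "T_pot (W n) t y - T_pot (W n) t z = T_pot (W n) t x" for n
    using bounded_op_diff[OF c0_sgD(1)[OF T_pot(1)[OF pW] t]] yz by simp
  ultimately have "(\<lambda>n. T_pot (W n) t x) \<longlonglongrightarrow> T_lim W t y - T_lim W t z" by simp
  then show ?thesis unfolding T_lim_def by (simp add: limI)
qed

lemma T_lim_diff:
  assumes W: "potential_seq W" and t: "t \<ge> 0" and yz: "y \<in> E" "z \<in> E"
  shows "T_lim W t (y - z) = T_lim W t y - T_lim W t z"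
proof -
  have pW: "potential (W n)" for n using W by (simp add: potential_seq_def)
  have "(\<lambda>n. T_pot (W n) t y - T_pot (W n) t z) \<longlonglongrightarrow> T_lim W t y - T_lim W t z"
    by (intro tendsto_diff T_lim_tendsto W t yz)
  moreover have "T_pot (W n) t y - T_pot (W n) t z = T_pot (W n) t (y - z)" for n
    using bounded_op_diff[OF c0_sgD(1)[OF T_pot(1)[OF pW] t]] yz by simp
  moreover have "(\<lambda>n. T_pot (W n) t (y - z)) \<longlonglongrightarrow> T_lim W t (y - z)"
    using yz by (intro T_lim_tendsto W t) auto
  ultimately show ?thesis using LIMSEQ_unique by simp
qed

lemma T_lim_mono:
  assumes W: "potential_seq W" "potential_seq W'" and cof: "\<And>n. \<exists>k. \<forall>x\<in>space M. W n x \<le> W' k x"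
    and t: "t \<ge> 0" and x: "x \<in> P"
  shows "T_lim W' t x \<preceq> T_lim W t x"
proof (rule le_lim[OF tendsto_const T_lim_P(1)[OF W(1) t x]])
  have "T_lim W' t x \<preceq> T_pot (W n) t x" for n
  proof -
    obtain k where k: "\<And>x. x \<in> space M \<Longrightarrow> W n x \<le> W' k x" using cof by blast
    have "T_lim W' t x \<preceq> T_pot (W' k) t x" by (rule T_lim_P[OF W(2) t x])
    also have "\<dots> \<preceq> T_pot (W n) t x" using W k by (intro T_pot_mono t x) (auto simp: potential_seq_def)
    finally show ?thesis .
  qed
  then show "eventually (\<lambda>n. T_lim W' t x \<preceq> T_pot (W n) t x) sequentially" by simp
qed simp

lemma potential_seq_truncate:
  assumes "locally_measurable M V" "\<And>x. x \<in> space M \<Longrightarrow> 0 \<le> V x"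
  shows "potential_seq (truncate V)"
  unfolding potential_seq_def
proof (intro conjI allI ballI)
  fix n x assume x: "x \<in> space M"
  show "0 \<le> truncate V n x" "truncate V n x \<le> truncate V (Suc n) x"
    unfolding truncate_nonneg[of V x, OF assms(2)[OF x]] using assms(2)[OF x]
    by (cases "V x"; auto simp: min_def)+
qed (rule potential_truncate[OF assms(1)])

lemma truncated_semigroup_emb:
  assumes V: "locally_measurable M V" and t: "t \<ge> 0" and f: "f \<in> L"
  shows "truncated_semigroup M p T V n t f \<in> L"
    "emb (truncated_semigroup M p T V n t f) = T_pot (truncate V n) t (emb f)"
proof -
  have c: "C0_semigroup M p (truncated_semigroup M p T V n)"
    unfolding truncated_semigroup_def by (rule gen_semigroup_minus_mult[OF C0 potential_truncate[OF V]])
  show "truncated_semigroup M p T V n t f \<in> L" by (rule C0D(2)[OF c t f])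
  show "emb (truncated_semigroup M p T V n t f) = T_pot (truncate V n) t (emb f)"
    unfolding T_pot_def hat_emb[OF c[unfolded truncated_semigroup_def] t f] by (simp add: truncated_semigroup_def)
qed

lemma absorption_semigroup_emb:
  assumes V: "locally_measurable M V" "\<And>x. x \<in> space M \<Longrightarrow> 0 \<le> V x" and t: "t \<ge> 0" and f: "f \<in> L"
  shows "absorption_semigroup M p T V t f \<in> L"
    "emb (absorption_semigroup M p T V t f) = T_lim (truncate V) t (emb f)"
  unfolding absorption_semigroup_def
  using truncated_semigroup_emb[OF V(1) t f] T_lim_tendsto[OF potential_seq_truncate[OF V] t, of "emb f"] f
  by (auto intro!: strong_lim_emb)

end

section \<open>The theorem for a fixed admissible absorption rate\<close>

locale absorption = positive_semigroup M p T for M :: "'a measure" and p T +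
  fixes V :: "'a \<Rightarrow> ereal"
  assumes V_nonneg: "x \<in> space M \<Longrightarrow> 0 \<le> V x" and admissible: "T_admissible M p T V"
begin

abbreviation "v \<equiv> truncate V"
abbreviation "scaled e \<equiv> (\<lambda>x. ereal e * V x)"
abbreviation "excess n \<equiv> (\<lambda>x. V x - min (V x) (ereal (real n)))"

lemma V_lm: "locally_measurable M V" using admissible by (simp add: T_admissible_def)

lemma scaled_lm: "locally_measurable M (scaled e)"
  using V_lm unfolding locally_measurable_def by (auto intro: borel_measurable_ereal_times)

lemma excess_lm: "locally_measurable M (excess n)"
  using V_lm unfolding locally_measurable_def by (auto intro!: borel_measurable_ereal_diff borel_measurable_min)

lemma scaled_nonneg: "e \<ge> 0 \<Longrightarrow> x \<in> space M \<Longrightarrow> 0 \<le> scaled e x"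
  using V_nonneg by (simp add: ereal_zero_le_0_iff)

lemma excess_nonneg: "x \<in> space M \<Longrightarrow> 0 \<le> excess n x"
  using V_nonneg[of x] by (cases "V x") (auto simp: min_def)

lemma v_eq: "x \<in> space M \<Longrightarrow> v n x = real_of_ereal (min (V x) (ereal (real n)))"
  by (rule truncate_nonneg[of V x, OF V_nonneg])

lemma truncate_scaled_eq:
  "x \<in> space M \<Longrightarrow> e \<ge> 0 \<Longrightarrow> truncate (scaled e) n x = real_of_ereal (min (ereal e * V x) (ereal (real n)))"
  by (rule truncate_nonneg[of "scaled e" x, OF scaled_nonneg])

lemma v_bounds: "x \<in> space M \<Longrightarrow> 0 \<le> v n x \<and> v n x \<le> real n"
  using v_eq[of x n] V_nonneg[of x] by (cases "V x") (auto simp: min_def)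

lemma v_mono: "x \<in> space M \<Longrightarrow> n \<le> k \<Longrightarrow> v n x \<le> v k x"
  using V_nonneg[of x] by (cases "V x") (auto simp: min_def v_eq)

lemma truncate_excess: "x \<in> space M \<Longrightarrow> truncate (excess n) k x = v (n + k) x - v n x"
  using V_nonneg[of x] truncate_nonneg[of "excess n" x k, OF excess_nonneg]
  by (cases "V x") (auto simp: min_def v_eq)

lemma real_min_ereal: "real_of_ereal (min (ereal a) (ereal b)) = min a b"
  by (simp add: min_def)

lemma truncate_scaled_ge:
  assumes x: "x \<in> space M" and e: "0 < e" "e \<le> 1"
  shows "e * v k x \<le> truncate (scaled e) k x"
proof (cases "V x")
  case (real r)
  have "e * min r (real k) = min (e * r) (e * real k)" using e by (auto simp: min_def)
  also have "\<dots> \<le> min (e * r) (real k)"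
    using e mult_left_le_one_le[of "real k" e] by (intro min.mono) auto
  finally have "e * min r (real k) \<le> min (e * r) (real k)" .
  then show ?thesis using e by (simp add: v_eq[OF x] truncate_scaled_eq[OF x] real real_min_ereal)
next
  case PInf
  then show ?thesis using e by (simp add: v_eq[OF x] truncate_scaled_eq[OF x] mult_left_le_one_le min_def)
qed (use V_nonneg[OF x] in simp)

lemma truncate_scaled_le:
  assumes x: "x \<in> space M" and e: "0 < e" and j: "real j \<le> e * real k"
  shows "truncate (scaled e) j x \<le> e * v k x"
proof (cases "V x")
  case (real r)
  have "min (e * r) (real j) \<le> min (e * r) (e * real k)" using j by (intro min.mono) auto
  also have "\<dots> = e * min r (real k)" using e by (auto simp: min_def)
  finally have "min (e * r) (real j) \<le> e * min r (real k)" .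
  then show ?thesis using e by (simp add: v_eq[OF x] truncate_scaled_eq[OF x] real real_min_ereal)
next
  case PInf
  then show ?thesis using e j by (simp add: v_eq[OF x] truncate_scaled_eq[OF x] min_def)
qed (use V_nonneg[OF x] in simp)

text \<open>
  Where \<open>V \<le> n\<close>, the left-hand side is at most \<open>0\<close>; where \<open>V > n\<close>, it is \<open>e\<close> times the right-hand side.
\<close>

lemma v_growth:
  assumes x: "x \<in> space M" and e: "0 < e" "e \<le> 1"
  shows "e * v (n + k) x - e * real n \<le> v (n + k) x - v n x"
proof (cases "v (n + k) x \<le> real n")
  case True
  then have "e * v (n + k) x - e * real n \<le> 0" using e by simp
  also have "0 \<le> v (n + k) x - v n x" using v_mono[OF x, of n "n + k"] by simp
  finally show ?thesis .
next
  case False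
  then have "e * (v (n + k) x - real n) \<le> v (n + k) x - real n"
    using e by (intro mult_left_le_one_le) auto
  then show ?thesis using v_bounds[OF x, of n] by (simp add: algebra_simps)
qed

lemma potential_seq_scaled: "e \<ge> 0 \<Longrightarrow> potential_seq (truncate (scaled e))"
  using potential_seq_truncate[OF scaled_lm scaled_nonneg] by simp
lemma potential_seq_excess: "potential_seq (truncate (excess n))"
  by (rule potential_seq_truncate[OF excess_lm excess_nonneg])
lemma potential_seq_v: "potential_seq v" by (rule potential_seq_truncate[OF V_lm V_nonneg])

lemma potential_v: "potential (v n)" by (rule potential_truncate[OF V_lm])

text \<open>
  The three families to be compared: \<open>T_scaled e\<close> is \<open>T\<^bsub>eV\<^esub>\<close>, \<open>T_excess n\<close> is \<open>T\<^bsub>V - V \<and> n\<^esub>\<close>, and \<open>T_restored\<close> is the limit of the latter.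
\<close>

definition T_scaled :: "real \<Rightarrow> real \<Rightarrow> 'a ambient \<Rightarrow> 'a ambient" where
  "T_scaled e = T_lim (truncate (scaled e))"
definition T_excess :: "nat \<Rightarrow> real \<Rightarrow> 'a ambient \<Rightarrow> 'a ambient" where
  "T_excess n = T_lim (truncate (excess n))"
definition T_restored :: "real \<Rightarrow> 'a ambient \<Rightarrow> 'a ambient" where
  "T_restored t x = lim (\<lambda>n. T_excess n t x)"

text \<open>
  \<open>V - V \<and> n \<ge> eV - en\<close>, where subtracting the constant \<open>en\<close> from the potential multiplies the semigroup by \<open>exp (e n t)\<close>.
\<close>

lemma T_excess_le_T_scaled:
  assumes e: "0 < e" "e \<le> 1" and t: "t \<ge> 0" and x: "x \<in> P"
  shows "T_excess n t x \<preceq> exp (e * real n * t) *\<^sub>R T_scaled e t x"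
proof (rule le_lim[OF tendsto_const])
  have xE: "x \<in> E" using x by simp
  have ps: "potential (truncate (scaled e) j)" for j by (rule potential_truncate[OF scaled_lm])
  show "(\<lambda>j. exp (e * real n * t) *\<^sub>R T_pot (truncate (scaled e) j) t x) \<longlonglongrightarrow> exp (e * real n * t) *\<^sub>R T_scaled e t x"
    unfolding T_scaled_def using e by (intro tendsto_intros T_lim_P potential_seq_scaled t x) auto
  have "T_excess n t x \<preceq> exp (e * real n * t) *\<^sub>R T_pot (truncate (scaled e) j) t x" for j
  proof -
    obtain k :: nat where k: "real j \<le> e * real k"
    proof -
      obtain k :: nat where "real j / e \<le> real k" using real_arch_simple by blast
      then have "real j \<le> e * real k" using e by (simp add: field_simps)
      then show ?thesis by (rule that)
    qed
    then have k': "real j \<le> e * real (n + k)" using e by (simp add: distrib_left add_increasing)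
    have pj: "potential (\<lambda>x. truncate (scaled e) j x - e * real n)" by (intro potential_diff ps potential_const)
    have "T_excess n t x \<preceq> T_pot (truncate (excess n) k) t x"
      unfolding T_excess_def by (rule T_lim_P[OF potential_seq_excess t x])
    also have "\<dots> \<preceq> T_pot (\<lambda>x. truncate (scaled e) j x - e * real n) t x"
    proof (rule T_pot_mono[OF potential_truncate[OF excess_lm] pj _ t x])
      fix x assume "x \<in> space M"
      then show "truncate (scaled e) j x - e * real n \<le> truncate (excess n) k x"
        using truncate_scaled_le[OF _ e(1) k', of x] v_growth[of x e n k] e by (simp add: truncate_excess)
    qed
    also have "\<dots> = exp (e * real n * t) *\<^sub>R T_pot (truncate (scaled e) j) t x"
      by (rule T_pot_shift[OF ps pj _ t xE]) simp
    finally show ?thesis .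
  qed
  then show "eventually (\<lambda>j. T_excess n t x \<preceq> exp (e * real n * t) *\<^sub>R T_pot (truncate (scaled e) j) t x) sequentially"
    by simp
qed simp

lemma T_excess_mono: assumes t: "t \<ge> 0" and x: "x \<in> P" shows "T_excess n t x \<preceq> T_excess (Suc n) t x"
  unfolding T_excess_def
proof (rule T_lim_mono[OF potential_seq_excess potential_seq_excess _ t x])
  fix k
  have "truncate (excess (Suc n)) k x \<le> truncate (excess n) (Suc k) x" if "x \<in> space M" for x
    unfolding truncate_excess[OF that] using v_mono[OF that, of n "Suc n"] by simp
  then show "\<exists>j. \<forall>x\<in>space M. truncate (excess (Suc n)) k x \<le> truncate (excess n) j x" by blast
qed

lemma T_excess_le_T: assumes t: "t \<ge> 0" and x: "x \<in> P" shows "T_excess n t x \<preceq> hat T t x"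
proof -
  have "T_excess n t x \<preceq> T_pot (truncate (excess n) 0) t x"
    unfolding T_excess_def by (rule T_lim_P[OF potential_seq_excess t x])
  also have "\<dots> \<preceq> hat T t x"
    using potential_seq_excess[of n] by (intro T_pot_le_T t x) (auto simp: potential_seq_def)
  finally show ?thesis .
qed

lemma T_restored_P:
  assumes t: "t \<ge> 0" and x: "x \<in> P"
  shows "(\<lambda>n. T_excess n t x) \<longlonglongrightarrow> T_restored t x" "T_excess n t x \<preceq> T_restored t x"
proof -
  obtain l where l: "(\<lambda>n. T_excess n t x) \<longlonglongrightarrow> l" "\<And>n. T_excess n t x \<preceq> l"
    using inc_limit[of "\<lambda>n. T_excess n t x" "hat T t x", OF T_excess_le_T[OF t x] T_excess_mono[OF t x]] by blast
  have "T_restored t x = l" unfolding T_restored_def using l(1) by (rule limI)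
  then show "(\<lambda>n. T_excess n t x) \<longlonglongrightarrow> T_restored t x" "T_excess n t x \<preceq> T_restored t x" using l by auto
qed

lemma T_restored_tendsto:
  assumes t: "t \<ge> 0" and x: "x \<in> E"
  shows "(\<lambda>n. T_excess n t x) \<longlonglongrightarrow> T_restored t x"
proof -
  obtain y z where yz: "y \<in> P" "z \<in> P" "x = y - z" using decompose[OF x] by blast
  have "(\<lambda>n. T_excess n t y - T_excess n t z) \<longlonglongrightarrow> T_restored t y - T_restored t z" by (intro tendsto_diff T_restored_P t yz)
  moreover have "T_excess n t y - T_excess n t z = T_excess n t x" for n
    using T_lim_diff[OF potential_seq_excess t] yz by (auto simp: T_excess_def)
  ultimately have "(\<lambda>n. T_excess n t x) \<longlonglongrightarrow> T_restored t y - T_restored t z" by simp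
  then show ?thesis unfolding T_restored_def by (simp add: limI)
qed

text \<open>
  The potentials \<open>e (V \<and> n) = eV \<and> en\<close> are truncations of \<open>eV\<close> at the levels \<open>en\<close>, cofinal with the integer levels that define
  \<open>T\<^bsub>eV\<^esub>\<close>.
\<close>

lemma T_pot_scaled_v_tendsto:
  assumes e: "0 < e" "e \<le> 1" and t: "t \<ge> 0" and x: "x \<in> P"
  shows "(\<lambda>n. T_pot (\<lambda>x. e * v n x) t x) \<longlonglongrightarrow> T_scaled e t x"
proof -
  have s: "potential_seq (\<lambda>n x. e * v n x)"
    using potential_seq_v e by (auto simp: potential_seq_def intro: potential_scale mult_left_mono)
  have ts: "potential_seq (truncate (scaled e))" using e by (intro potential_seq_scaled) auto
  have "T_lim (\<lambda>n x. e * v n x) t x = T_scaled e t x"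
  proof (rule le_antisym)
    show "T_scaled e t x \<preceq> T_lim (\<lambda>n x. e * v n x) t x"
      unfolding T_scaled_def using truncate_scaled_ge e by (intro T_lim_mono[OF s ts _ t x]) fastforce
    show "T_lim (\<lambda>n x. e * v n x) t x \<preceq> T_scaled e t x"
      unfolding T_scaled_def
    proof (rule T_lim_mono[OF ts s _ t x])
      fix j
      obtain k :: nat where "real j / e \<le> real k" using real_arch_simple by blast
      then have "real j \<le> e * real k" using e by (simp add: field_simps)
      then show "\<exists>k. \<forall>x\<in>space M. truncate (scaled e) j x \<le> e * v k x"
        using truncate_scaled_le e by blast
    qed
  qed
  then show ?thesis using T_lim_P(1)[OF s t x] by simp
qed

text \<open>
  The key inequality. Convexity is applied to the segment from \<open>W = eV \<and> en\<close> in the direction \<open>D = V \<and> (n + k) - V \<and> n\<close>: the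
  point at parameter \<open>e\<close> is \<open>e (V \<and> (n + k))\<close>, and the end point \<open>W + D\<close> lies above the truncation of \<open>V - V \<and> n\<close>. After
  \<open>k \<rightarrow> \<infinity>\<close> and \<open>n \<rightarrow> \<infinity>\<close> the term \<open>(1 - e) T\<^bsub>eV\<^esub>\<close> appears on the right and can be absorbed into the left-hand side.
\<close>

lemma T_scaled_le_T_restored:
  assumes e: "0 < e" "e \<le> 1" and t: "t \<ge> 0" and x: "x \<in> P"
  shows "T_scaled e t x \<preceq> T_restored t x"
proof -
  have main: "T_scaled e t x \<preceq> (1 - e) *\<^sub>R T_pot (\<lambda>x. e * v n x) t x + e *\<^sub>R T_excess n t x" for n
  proof (rule le_lim[OF tendsto_const])
    show "(\<lambda>k. (1 - e) *\<^sub>R T_pot (\<lambda>x. e * v n x) t x + e *\<^sub>R T_pot (truncate (excess n) k) t x)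
        \<longlonglongrightarrow> (1 - e) *\<^sub>R T_pot (\<lambda>x. e * v n x) t x + e *\<^sub>R T_excess n t x"
      unfolding T_excess_def by (intro tendsto_intros T_lim_P potential_seq_excess t x)
    have "T_scaled e t x \<preceq> (1 - e) *\<^sub>R T_pot (\<lambda>x. e * v n x) t x + e *\<^sub>R T_pot (truncate (excess n) k) t x" for k
    proof -
      define D where "D x = v (n + k) x - v n x" for x
      have pD: "potential D" unfolding D_def by (intro potential_diff potential_v)
      have D0: "0 \<le> D x" if "x \<in> space M" for x using v_mono[OF that, of n "n + k"] by (simp add: D_def)
      have pe: "potential (\<lambda>x. e * v n x)" by (intro potential_scale potential_v)
      have "T_scaled e t x \<preceq> T_pot (truncate (scaled e) (n + k)) t x"
        unfolding T_scaled_def using e by (intro T_lim_P[OF potential_seq_scaled t x]) auto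
      also have "\<dots> \<preceq> T_pot (\<lambda>x. e * v n x + e * D x) t x"
      proof (rule T_pot_mono[OF potential_truncate[OF scaled_lm] _ _ t x])
        show "potential (\<lambda>x. e * v n x + e * D x)" by (intro potential_add potential_scale potential_v pD)
        show "e * v n x + e * D x \<le> truncate (scaled e) (n + k) x" if "x \<in> space M" for x
          using truncate_scaled_ge[OF that, of e "n + k"] e by (simp add: D_def algebra_simps)
      qed
      also have "\<dots> \<preceq> (1 - e) *\<^sub>R T_pot (\<lambda>x. e * v n x) t x + e *\<^sub>R T_pot (\<lambda>x. e * v n x + D x) t x"
        using e by (intro T_pot_convex pe pD D0 t x) auto
      also have "\<dots> \<preceq> (1 - e) *\<^sub>R T_pot (\<lambda>x. e * v n x) t x + e *\<^sub>R T_pot (truncate (excess n) k) t x"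
      proof (intro le_add le_refl le_scale)
        show "T_pot (\<lambda>x. e * v n x + D x) t x \<preceq> T_pot (truncate (excess n) k) t x"
        proof (rule T_pot_mono[OF potential_add[OF pe pD] potential_truncate[OF excess_lm] _ t x])
          show "truncate (excess n) k x \<le> e * v n x + D x" if "x \<in> space M" for x
            using v_bounds[OF that, of n] e that by (simp add: truncate_excess D_def)
        qed
      qed (use e in auto)
      finally show ?thesis .
    qed
    then show "eventually (\<lambda>k. T_scaled e t x \<preceq> (1 - e) *\<^sub>R T_pot (\<lambda>x. e * v n x) t x + e *\<^sub>R T_pot (truncate (excess n) k) t x) sequentially"
      by simp
  qed simp
  have "T_scaled e t x \<preceq> (1 - e) *\<^sub>R T_scaled e t x + e *\<^sub>R T_restored t x"
    by (rule le_lim[OF tendsto_const tendsto_add[OF tendsto_scaleR[OF tendsto_const T_pot_scaled_v_tendsto[OF e t x]]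
          tendsto_scaleR[OF tendsto_const T_restored_P(1)[OF t x]]]]) (use main in auto)
  then have "e *\<^sub>R (T_restored t x - T_scaled e t x) \<in> P" by (simp add: le_def algebra_simps)
  from P_simps(3)[OF this, of "inverse e"]
  show ?thesis using e by (simp add: le_def)
qed

lemma T_scaled_tendsto:
  assumes t: "t \<ge> 0" and x: "x \<in> E"
  shows "((\<lambda>e. T_scaled e t x) \<longlongrightarrow> T_restored t x) (at_right 0)"
proof -
  have pos: "((\<lambda>e. T_scaled e t x) \<longlongrightarrow> T_restored t x) (at_right 0)" if x: "x \<in> P" for x
  proof (rule tendstoI)
    fix d :: real assume d: "d > 0"
    obtain n where n: "norm (T_restored t x - T_excess n t x) < d"
      using tendstoD[OF T_restored_P(1)[OF t x] d] by (auto simp: eventually_sequentially dist_norm norm_minus_commute)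
    have "((\<lambda>e. norm (T_restored t x - exp (- (e * real n * t)) *\<^sub>R T_excess n t x))
        \<longlongrightarrow> norm (T_restored t x - exp (- (0 * real n * t)) *\<^sub>R T_excess n t x)) (at_right 0)"
      by (intro tendsto_intros)
    then have "((\<lambda>e. norm (T_restored t x - exp (- (e * real n * t)) *\<^sub>R T_excess n t x))
        \<longlongrightarrow> norm (T_restored t x - T_excess n t x)) (at_right 0)" by simp
    then have "eventually (\<lambda>e. norm (T_restored t x - exp (- (e * real n * t)) *\<^sub>R T_excess n t x) < d) (at_right 0)"
      using n by (rule order_tendstoD(2))
    moreover have "eventually (\<lambda>e::real. e \<in> {0<..<1}) (at_right 0)" by (intro eventually_at_right_real) auto
    ultimately show "eventually (\<lambda>e. dist (T_scaled e t x) (T_restored t x) < d) (at_right 0)"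
    proof eventually_elim
      case (elim e)
      have e: "0 < e" "e \<le> 1" using elim by auto
      have "exp (- (e * real n * t)) *\<^sub>R T_excess n t x \<preceq> exp (- (e * real n * t)) *\<^sub>R exp (e * real n * t) *\<^sub>R T_scaled e t x"
        by (intro le_scale T_excess_le_T_scaled e t x) auto
      then have "exp (- (e * real n * t)) *\<^sub>R T_excess n t x \<preceq> T_scaled e t x" by (simp flip: exp_add)
      then have "norm (T_restored t x - T_scaled e t x) \<le> norm (T_restored t x - exp (- (e * real n * t)) *\<^sub>R T_excess n t x)"
        by (rule le_norm_diff'[OF _ T_scaled_le_T_restored[OF e t x]])
      then show ?case using elim by (simp add: dist_norm norm_minus_commute)
    qed
  qed
  obtain y z where yz: "y \<in> P" "z \<in> P" "x = y - z" using decompose[OF x] by blast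
  have "((\<lambda>e. T_scaled e t y - T_scaled e t z) \<longlongrightarrow> T_restored t y - T_restored t z) (at_right 0)" by (intro tendsto_diff pos yz)
  moreover have "eventually (\<lambda>e. T_scaled e t y - T_scaled e t z = T_scaled e t x) (at_right 0)"
    using T_lim_diff[OF potential_seq_scaled t] yz by (auto simp: eventually_at_filter T_scaled_def)
  ultimately have l: "((\<lambda>e. T_scaled e t x) \<longlongrightarrow> T_restored t y - T_restored t z) (at_right 0)" by (rule Lim_transform_eventually)
  have "(\<lambda>n. T_excess n t y - T_excess n t z) \<longlonglongrightarrow> T_restored t y - T_restored t z" by (intro tendsto_diff T_restored_P t yz)
  moreover have "T_excess n t y - T_excess n t z = T_excess n t x" for n
    using T_lim_diff[OF potential_seq_excess t] yz by (auto simp: T_excess_def)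
  ultimately have "T_restored t y - T_restored t z = T_restored t x" using LIMSEQ_unique T_restored_tendsto[OF t x] by simp
  then show ?thesis using l by simp
qed

abbreviation "TV \<equiv> absorption_semigroup M p T V"

lemma C0_TV: "C0_semigroup M p TV" using admissible by (simp add: T_admissible_def)

lemma hat_TV: assumes t: "t \<ge> 0" and x: "x \<in> E" shows "hat TV t x = T_lim v t x"
proof -
  obtain f where f: "f \<in> L" "x = emb f" using x by (auto simp: E_def)
  show ?thesis unfolding f(2) hat_emb[OF C0_TV t f(1)]
    by (rule absorption_semigroup_emb[OF V_lm V_nonneg t f(1)])
qed

lemma pos_family_TV: "pos_family (hat TV)"
  unfolding pos_family_def pos_op_def using hat_TV T_lim_P(2)[OF potential_seq_v] by simp

text \<open>
  \<open>T\<^bsub>V - V \<and> n\<^esub>\<close> is the perturbation of \<open>T\<^sub>V\<close> by \<open>V \<and> n\<close>. For the truncations at height \<open>n + k\<close> this holds by additivity of tangency;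
  then \<open>k \<rightarrow> \<infinity>\<close>.
\<close>

lemma T_excess_tangent: "c0_sg (T_excess n)" "tangent (hat TV) (mult_op (v n)) (T_excess n)"
proof -
  have pe: "potential (truncate (excess n) k)" for k by (rule potential_truncate[OF excess_lm])
  have tg: "tangent (T_pot (v (n + k))) (mult_op (v n)) (T_pot (truncate (excess n) k))" for k
    by (rule T_pot_tangent[OF potential_v pe potential_v]) (simp add: truncate_excess)
  have vt: "hat TV t x \<preceq> T_pot (v (n + k)) t x" if "t \<ge> 0" "x \<in> P" for k t x
    using T_lim_P(3)[OF potential_seq_v that] hat_TV[OF that(1)] that(2) by simp
  have su: "T_pot (truncate (excess n) k) t x \<preceq> hat T t x" if "t \<ge> 0" "x \<in> P" for k t x
    using potential_seq_excess[of n] that by (intro T_pot_le_T) (auto simp: potential_seq_def)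
  have tl: "(\<lambda>k. T_pot (v (n + k)) t x) \<longlonglongrightarrow> hat TV t x" if "t \<ge> 0" "x \<in> E" for t x
    using LIMSEQ_ignore_initial_segment[OF T_lim_tendsto[OF potential_seq_v that], of n] hat_TV[OF that] by (simp add: add.commute)
  have sl: "(\<lambda>k. T_pot (truncate (excess n) k) t x) \<longlonglongrightarrow> T_excess n t x" if "t \<ge> 0" "x \<in> E" for t x
    unfolding T_excess_def by (rule T_lim_tendsto[OF potential_seq_excess that])
  have pv: "pos_op (mult_op (v n))" using v_bounds by (intro pos_op_mult_op potential_v) auto
  note tl' = tangent_limit[OF c0_sg_hat[OF C0_TV] pos_family_TV c0_sg_T pos_family_T T_pot(1)[OF potential_v] T_pot(3)[OF potential_v]
    T_pot(1)[OF pe] T_pot(3)[OF pe] bounded_op_mult_op[OF potential_v] pv tg vt su tl sl]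
  show "c0_sg (T_excess n)" by (rule tl'(1))
  show "tangent (hat TV) (mult_op (v n)) (T_excess n)" by (rule tl'(2))
qed

text \<open>
  \<open>e\<^bsup>t(A\<^sub>V + V \<and> n)\<^esup> = T\<^bsub>V - V \<and> n\<^esub>(t)\<close>, as both sides are perturbations of \<open>T\<^sub>V\<close> by \<open>V \<and> n\<close>.
\<close>

lemma restored_truncation:
  assumes t: "t \<ge> 0" and f: "f \<in> L"
  shows "truncated_semigroup M p TV (\<lambda>x. - V x) n t f \<in> L"
    "emb (truncated_semigroup M p TV (\<lambda>x. - V x) n t f) = T_excess n t (emb f)"
proof -
  let ?W = "truncate (\<lambda>x. - V x) n"
  have W: "?W = (\<lambda>x. (-1) * v n x)" by (auto simp: truncate_uminus)
  have pW: "potential ?W" unfolding W by (intro potential_scale potential_v)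
  note g = gen_semigroup_minus_mult[OF C0_TV pW, folded truncated_semigroup_def]
  show "truncated_semigroup M p TV (\<lambda>x. - V x) n t f \<in> L" by (rule C0D(2)[OF g(1) t f])
  have "tangent (hat TV) (mult_op (v n)) (hat (truncated_semigroup M p TV (\<lambda>x. - V x) n))"
  proof (rule tangent_cong[OF g(2)])
    fix x assume x: "x \<in> E"
    have "mult_op ?W x = (-1) *\<^sub>R mult_op (v n) x + 0 *\<^sub>R mult_op (v n) x"
      by (intro mult_op_lincomb potential_v pW x) (simp add: W)
    then show "- mult_op ?W x = mult_op (v n) x" by simp
  qed
  from tangent_unique[OF c0_sg_hat[OF g(1)] T_excess_tangent(1) this T_excess_tangent(2) emb_in_E[OF f] t]
  show "emb (truncated_semigroup M p TV (\<lambda>x. - V x) n t f) = T_excess n t (emb f)"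
    by (simp add: hat_emb[OF g(1) t f])
qed

lemma restored_emb:
  assumes t: "t \<ge> 0" and f: "f \<in> L"
  shows "restored_semigroup M p T V t f \<in> L" "emb (restored_semigroup M p T V t f) = T_restored t (emb f)"
  unfolding restored_semigroup_def absorption_semigroup_def[of M p TV]
  using restored_truncation[OF t f] T_restored_tendsto[OF t, of "emb f"] f
  by (auto intro!: strong_lim_emb)

lemma excess_limit_emb:
  assumes t: "t \<ge> 0" and f: "f \<in> L"
  defines "S \<equiv> strong_lim M p sequentially (\<lambda>n. absorption_semigroup M p T (excess n))"
  shows "S t f \<in> L" "emb (S t f) = T_restored t (emb f)"
  unfolding S_def
  using absorption_semigroup_emb[OF excess_lm excess_nonneg t f] T_restored_tendsto[OF t, of "emb f"] f
  by (auto intro!: strong_lim_emb simp: T_excess_def)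

lemma zero_absorption_emb:
  assumes t: "t \<ge> 0" and f: "f \<in> L"
  shows "zero_absorption M p T V t f \<in> L" "emb (zero_absorption M p T V t f) = T_restored t (emb f)"
proof -
  have a: "absorption_semigroup M p T (scaled e) t f \<in> L"
    "emb (absorption_semigroup M p T (scaled e) t f) = T_scaled e t (emb f)" if "e > 0" for e
    using absorption_semigroup_emb[OF scaled_lm scaled_nonneg t f, of e] that by (auto simp: T_scaled_def)
  have e0: "eventually (\<lambda>e::real. e > 0) (at_right 0)" by (auto simp: eventually_at_filter)
  have 1: "eventually (\<lambda>e. absorption_semigroup M p T (scaled e) t f \<in> L) (at_right 0)"
    using e0 by eventually_elim (rule a)
  have "eventually (\<lambda>e. T_scaled e t (emb f) = emb (absorption_semigroup M p T (scaled e) t f)) (at_right 0)"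
    using e0 by eventually_elim (simp add: a)
  with T_scaled_tendsto[OF t emb_in_E[OF f]]
  have 2: "((\<lambda>e. emb (absorption_semigroup M p T (scaled e) t f)) \<longlongrightarrow> T_restored t (emb f)) (at_right 0)"
    by (rule Lim_transform_eventually)
  show "zero_absorption M p T V t f \<in> L" "emb (zero_absorption M p T V t f) = T_restored t (emb f)"
    unfolding zero_absorption_def
    by (rule strong_lim_emb[where S="\<lambda>e. absorption_semigroup M p T (scaled e)" and t=t and f=f,
        OF trivial_limit_at_right_real 1 2])+
qed

lemma family_eq_emb:
  assumes "\<And>t f. t \<ge> 0 \<Longrightarrow> f \<in> L \<Longrightarrow> S t f \<in> L \<and> S' t f \<in> L \<and> emb (S t f) = emb (S' t f)"
  shows "family_eq M p S S'"
  unfolding family_eq_def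
proof (intro allI impI ballI)
  fix t :: real and f assume "t \<ge> 0" "f \<in> L"
  then show "AE x in M. S t f x = S' t f x" using assms[of t f] emb_eq_iff by blast
qed

lemma zero_eq_restored: "family_eq M p (zero_absorption M p T V) (restored_semigroup M p T V)"
  by (rule family_eq_emb) (simp add: zero_absorption_emb restored_emb)

lemma restored_eq_limit:
  "family_eq M p (restored_semigroup M p T V) (strong_lim M p sequentially (\<lambda>n. absorption_semigroup M p T (excess n)))"
  by (rule family_eq_emb) (simp add: excess_limit_emb restored_emb)

end

lemma family_eq_trans:
  assumes "family_eq M p S S'" "family_eq M p S' S''" shows "family_eq M p S S''"
  unfolding family_eq_def
proof (intro allI impI ballI)
  fix t :: real and f assume "t \<ge> 0" "f \<in> Lp_set M p"
  then have "AE x in M. S t f x = S' t f x" "AE x in M. S' t f x = S'' t f x"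
    using assms by (auto simp: family_eq_def)
  then show "AE x in M. S t f x = S'' t f x" by eventually_elim simp
qed

lemma family_eq_sym: "family_eq M p S S' \<Longrightarrow> family_eq M p S' S"
  unfolding family_eq_def by (simp add: eq_commute)

theorem theorem1p1:
  fixes M :: "'a measure" and p :: real
    and T :: "real \<Rightarrow> ('a \<Rightarrow> real) \<Rightarrow> 'a \<Rightarrow> real" and V :: "'a \<Rightarrow> ereal"
  assumes "1 \<le> p"
    and "C0_semigroup M p T"
    and "positive_family M p T"
    and "\<forall>x\<in>space M. 0 \<le> V x"
    and "T_admissible M p T V"
  shows "family_eq M p (zero_absorption M p T V) (restored_semigroup M p T V) \<and>
    family_eq M p (restored_semigroup M p T V)
      (strong_lim M p sequentially
        (\<lambda>n. absorption_semigroup M p T (\<lambda>x. V x - min (V x) (ereal (real n))))) \<and>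
    (T_regular M p T V \<longleftrightarrow> strongly_T_regular M p T V)"
proof -
  interpret absorption M p T V using assms by unfold_locales auto
  have "family_eq M p (zero_absorption M p T V) T \<longleftrightarrow> family_eq M p (restored_semigroup M p T V) T"
    using family_eq_trans[OF zero_eq_restored] family_eq_trans[OF family_eq_sym[OF zero_eq_restored]] by blast
  then show ?thesis
    using zero_eq_restored restored_eq_limit by (simp add: T_regular_def strongly_T_regular_def)
qed

end
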